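(* Assume that we are in the two branches, non-ramified case: $\mathbf L=\mathbf K_1\times\mathbf K$, where $\mathbf K_1$ is a quadratic field extension of $\mathbf K$, $\mathbf A=\mathbf D_1\times\mathbf D$, the maximal ideal of the discrete valuation ring $\mathbf D_1$ is $t\mathbf D_1$, and $\mathbf D_1/t\mathbf D_1=\mathbf k[\bar\theta]$ is a quadratic field extension of $\mathbf k$. Let $e_1$ be the idempotent of $\mathbf A$ such that $e_1\mathbf A=\mathbf D_1$. For integers $l,q\ge0$ and $\alpha\in\mathbf D_1\setminus(e_1\mathbf D+t\mathbf D_1)$ put $$\mathbf C_{l,q}(\alpha)=\mathbf D+t^l(e_1+t^q\alpha)\mathbf D+t^{r}\mathbf A,\qquad r=2l+q .$$ Then: (1) every over-ring of $\mathbf A_m$ coincides with one of the rings $t^k\mathbf C_{l,q}(\alpha)+\mathbf D$, where $k+r\le m$ (i.e. $k+2l+q\le m$); (2) the rings $\mathbf C_{l,q}(\alpha)$ are just all plane curve singularities in this case (i.e. among the cubic rings over $\mathbf D$ in $\mathbf L$).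
   Context: $\mathbf D$ is a complete discrete valuation ring with field of fractions $\mathbf K$, maximal ideal $t\mathbf D$ and residue field $\mathbf k=\mathbf D/t\mathbf D$. $\mathbf L$ is a $3$-dimensional (commutative) semisimple $\mathbf K$-algebra. A cubic ring over $\mathbf D$ (in $\mathbf L$) is a $\mathbf D$-subalgebra of $\mathbf L$ that is a free $\mathbf D$-module of rank $3$. $\mathbf A$ is the integral closure of $\mathbf D$ in $\mathbf L$; it is assumed to be a finitely generated $\mathbf D$-module. For $m\ge0$, $\mathbf A_m=t^m\mathbf A+\mathbf D$. An over-ring of a cubic ring $\mathbf C$ is a cubic ring $\mathbf B$ with $\mathbf C\subseteq\mathbf B\subset\mathbf L$. $\mathbf D$ is embedded diagonally in $\mathbf A=\mathbf D_1\times\mathbf D$, and $\mathbf D_1$ is identified with $e_1\mathbf A=\mathbf D_1\times 0$. The embedding dimension of a local noetherian ring $\mathbf C$ with maximal ideal $\mathbf J$ is $\dim_{\mathbf C/\mathbf J}\mathbf J/\mathbf J^2$; a local noetherian ring of Krull dimension $1$ and embedding dimension $2$ is called a plane curve singularity.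
   Formalization: In (2) the rings C_{l,q}(α) are taken with l ≥ 1 only: for l = 0 the ring contains the nontrivial idempotent e_1, so it is not local and is not a plane curve singularity (e.g. C_{0,0}(α) = A). Part (1) keeps all l, q ≥ 0. *)

theory Defs
  imports
    "HOL-Library.Extended_Nat"
    "HOL-Algebra.Algebra"
    "Jordan_Normal_Form.Missing_VectorSpace"
begin

section \<open>Commutative algebra\<close>

definition local_ring :: "('a, 'b) ring_scheme \<Rightarrow> bool"
  where "local_ring R \<longleftrightarrow> cring R \<and> (\<exists>!J. maximalideal J R)"

definition max_ideal :: "('a, 'b) ring_scheme \<Rightarrow> 'a set"
  where "max_ideal R = (THE J. maximalideal J R)"

definition krull_dim :: "('a, 'b) ring_scheme \<Rightarrow> enat"
  where "krull_dim R = Sup {enat n | n. \<exists>P :: nat \<Rightarrow> 'a set.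
           (\<forall>i\<le>n. primeideal (P i) R) \<and> (\<forall>i<n. P i \<subset> P (Suc i))}"

text \<open>
  \<open>J/J\<^sup>2\<close> as a module over \<open>R/J\<close>. The action multiplies cosets elementwise:
  \<open>(c + J) (x + J\<^sup>2) = c x + J\<^sup>2\<close> for \<open>x\<close> in \<open>J\<close>.
  The fields \<open>mult\<close> and \<open>one\<close> play no role in a module.
\<close>

definition cotangent_space :: "('a, 'b) ring_scheme \<Rightarrow> 'a set \<Rightarrow> ('a set, 'a set) module"
  where "cotangent_space R J =
    \<lparr> carrier = (\<lambda>x. (J \<cdot>\<^bsub>R\<^esub> J) +>\<^bsub>R\<^esub> x) ` J,
      monoid.mult = rcoset_mult R (J \<cdot>\<^bsub>R\<^esub> J),
      monoid.one = undefined,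
      ring.zero = J \<cdot>\<^bsub>R\<^esub> J,
      ring.add = set_add R,
      smult = rcoset_mult R (J \<cdot>\<^bsub>R\<^esub> J) \<rparr>"

definition embedding_dim :: "('a, 'b) ring_scheme \<Rightarrow> nat"
  where "embedding_dim R =
    vectorspace.dim (R Quot (max_ideal R)) (cotangent_space R (max_ideal R))"

definition plane_curve_singularity :: "('a, 'b) ring_scheme \<Rightarrow> bool"
  where "plane_curve_singularity R \<longleftrightarrow>
    local_ring R \<and> noetherian_ring R \<and> krull_dim R = 1 \<and> embedding_dim R = 2"

definition quadratic_extension :: "'a set \<Rightarrow> ('a, 'b) ring_scheme \<Rightarrow> bool"
  where "quadratic_extension k E \<longleftrightarrow>
    field E \<and> subfield k E \<and> ring.dimension E 2 k (carrier E)"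

text \<open>A discrete valuation ring whose maximal ideal is generated by \<open>t\<close>.\<close>

definition dvr :: "('a, 'b) ring_scheme \<Rightarrow> 'a \<Rightarrow> bool"
  where "dvr R t \<longleftrightarrow> principal_domain R \<and> \<not> field R \<and> local_ring R \<and>
    t \<in> carrier R \<and> maximalideal (PIdl\<^bsub>R\<^esub> t) R"

text \<open>
  The residue ring \<open>R/t R\<close>, and the image in it of a subring \<open>D\<close>. When \<open>D\<close> and \<open>R\<close> are discrete
  valuation rings with the same uniformizer \<open>t\<close>, this image is a copy of \<open>D/t D\<close>.
\<close>

definition residue_ring_at :: "('a, 'b) ring_scheme \<Rightarrow> 'a \<Rightarrow> 'a set ring"
  where "residue_ring_at R t = R Quot (PIdl\<^bsub>R\<^esub> t)"

definition residue_image :: "('a, 'b) ring_scheme \<Rightarrow> 'a \<Rightarrow> 'a set \<Rightarrow> 'a set set"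
  where "residue_image R t D = (\<lambda>d. (PIdl\<^bsub>R\<^esub> t) +>\<^bsub>R\<^esub> d) ` D"

text \<open>
  Completeness of a discrete valuation ring: every compatible system of residues modulo
  the powers of \<open>t\<close> comes from an element of the ring. Separatedness is automatic.
\<close>

definition adically_complete :: "('a, 'b) ring_scheme \<Rightarrow> 'a \<Rightarrow> bool"
  where "adically_complete R t \<longleftrightarrow>
    (\<forall>a :: nat \<Rightarrow> 'a.
       (\<forall>n. a n \<in> carrier R) \<and>
       (\<forall>n. a (Suc n) \<ominus>\<^bsub>R\<^esub> a n \<in> PIdl\<^bsub>R\<^esub> (t [^]\<^bsub>R\<^esub> n)) \<longrightarrow>
       (\<exists>b\<in>carrier R. \<forall>n. b \<ominus>\<^bsub>R\<^esub> a n \<in> PIdl\<^bsub>R\<^esub> (t [^]\<^bsub>R\<^esub> n)))"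

definition fractions :: "('a, 'b) ring_scheme \<Rightarrow> 'a set \<Rightarrow> 'a set"
  where "fractions F D = {a \<otimes>\<^bsub>F\<^esub> inv\<^bsub>F\<^esub> b | a b. a \<in> D \<and> b \<in> D - {\<zero>\<^bsub>F\<^esub>}}"

definition integral_closure :: "('a, 'b) ring_scheme \<Rightarrow> 'a set \<Rightarrow> 'a set"
  where "integral_closure L S = {x \<in> carrier L.
    \<exists>p \<in> carrier (univ_poly L S). p \<noteq> [] \<and> hd p = \<one>\<^bsub>L\<^esub> \<and> ring.eval L p x = \<zero>\<^bsub>L\<^esub>}"


section \<open>Cubic rings\<close>

text \<open>
  Throughout, \<open>D\<close> is a subring of the ambient algebra \<open>L\<close>. A subset \<open>C\<close> of \<open>L\<close> that is closed
  under multiplication by \<open>D\<close> is regarded as a module over \<open>D\<close>.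
\<close>

definition submod :: "('a, 'b) ring_scheme \<Rightarrow> 'a set \<Rightarrow> ('a, 'a) module"
  where "submod L C =
    \<lparr> carrier = C, monoid.mult = monoid.mult L, monoid.one = \<one>\<^bsub>L\<^esub>,
      ring.zero = \<zero>\<^bsub>L\<^esub>, ring.add = ring.add L, smult = monoid.mult L \<rparr>"

definition finitely_generated_module :: "('r, 's) ring_scheme \<Rightarrow> ('r, 'm, 'n) module_scheme \<Rightarrow> bool"
  where "finitely_generated_module R M \<longleftrightarrow> module R M \<and>
    (\<exists>B \<subseteq> carrier M. finite B \<and> module.span R M B = carrier M)"

definition free_module_of_rank :: "nat \<Rightarrow> ('r, 's) ring_scheme \<Rightarrow> ('r, 'm, 'n) module_scheme \<Rightarrow> bool"
  where "free_module_of_rank n R M \<longleftrightarrow> module R M \<and>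
    (\<exists>B \<subseteq> carrier M. finite B \<and> card B = n \<and>
       \<not> module.lin_dep R M B \<and> module.span R M B = carrier M)"

definition cubic_ring :: "('a, 'b) ring_scheme \<Rightarrow> 'a set \<Rightarrow> 'a set \<Rightarrow> bool"
  where "cubic_ring L D C \<longleftrightarrow>
    subring C L \<and> D \<subseteq> C \<and> free_module_of_rank 3 (L\<lparr>carrier := D\<rparr>) (submod L C)"

definition over_ring :: "('a, 'b) ring_scheme \<Rightarrow> 'a set \<Rightarrow> 'a set \<Rightarrow> 'a set \<Rightarrow> bool"
  where "over_ring L D C B \<longleftrightarrow> cubic_ring L D B \<and> C \<subseteq> B"

text \<open>\<open>t\<^sup>k C + D\<close>; the ring \<open>A\<^sub>m\<close> is \<open>thicken L D t m A\<close>.\<close>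

definition thicken :: "('a, 'b) ring_scheme \<Rightarrow> 'a set \<Rightarrow> 'a \<Rightarrow> nat \<Rightarrow> 'a set \<Rightarrow> 'a set"
  where "thicken L D t k C = ((t [^]\<^bsub>L\<^esub> k) <#\<^bsub>L\<^esub> C) <+>\<^bsub>L\<^esub> D"


section \<open>The two branches, non-ramified case\<close>

definition diagonal :: "'a set \<Rightarrow> ('a \<times> 'a) set"
  where "diagonal S = (\<lambda>d. (d, d)) ` S"

text \<open>
  The range of \<open>\<alpha>\<close>, i.e. \<open>D\<^sub>1 - (e\<^sub>1 D + t D\<^sub>1)\<close>, where \<open>D\<^sub>1\<close> is identified with \<open>e\<^sub>1 A\<close>.
\<close>

definition alphas :: "('a, 'b) ring_scheme \<Rightarrow> 'a set \<Rightarrow> 'a set \<Rightarrow> 'a \<Rightarrow> 'a \<Rightarrow> 'a set"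
  where "alphas L D A t e1 =
    (e1 <#\<^bsub>L\<^esub> A) - ((e1 <#\<^bsub>L\<^esub> D) <+>\<^bsub>L\<^esub> (t <#\<^bsub>L\<^esub> (e1 <#\<^bsub>L\<^esub> A)))"

text \<open>
  \<open>C\<^sub>l\<^sub>,\<^sub>q(\<alpha>) = D + t\<^sup>l (e\<^sub>1 + t\<^sup>q \<alpha>) D + t\<^sup>r A\<close> with \<open>r = 2 l + q\<close>. For \<open>l = 0\<close> it contains both
  \<open>e\<^sub>1 + t\<^sup>q \<alpha>\<close> and \<open>t\<^sup>q \<alpha>\<close>, hence the nontrivial idempotent \<open>e\<^sub>1\<close>, so it is not local; these rings
  are needed to describe the over-rings of \<open>A\<^sub>m\<close>, but they are not plane curve singularities.
\<close>

definition C_ring ::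
    "('a, 'b) ring_scheme \<Rightarrow> 'a set \<Rightarrow> 'a set \<Rightarrow> 'a \<Rightarrow> 'a \<Rightarrow> nat \<Rightarrow> nat \<Rightarrow> 'a \<Rightarrow> 'a set"
  where "C_ring L D A t e1 l q \<alpha> =
    D <+>\<^bsub>L\<^esub>
    (((t [^]\<^bsub>L\<^esub> l) \<otimes>\<^bsub>L\<^esub> (e1 \<oplus>\<^bsub>L\<^esub> ((t [^]\<^bsub>L\<^esub> q) \<otimes>\<^bsub>L\<^esub> \<alpha>))) <#\<^bsub>L\<^esub> D) <+>\<^bsub>L\<^esub>
    ((t [^]\<^bsub>L\<^esub> (2 * l + q)) <#\<^bsub>L\<^esub> A)"

end

theory Submission
  imports Defs
begin

text \<open>
  Write \<open>E\<close> for \<open>D\<^sub>1\<close>. A cubic ring has bounded denominators, hence lies in \<open>A = E \<times> D\<close>, and since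
  it contains the diagonal it splits as \<open>D \<oplus> (M \<times> 0)\<close> for a \<open>D\<close>-submodule \<open>M\<close> of \<open>E\<close> with
  \<open>M \<cdot> M \<subseteq> M\<close>; rank three forces \<open>t\<^sup>m E \<subseteq> M\<close> for some \<open>m\<close>. Let \<open>k\<close> be the least valuation on \<open>M\<close>
  and \<open>s\<close> the least exponent with \<open>t\<^sup>s E \<subseteq> M\<close>. An element of \<open>M\<close> of valuation \<open>k\<close> can be taken to be
  \<open>t\<^sup>k \<xi>\<close> with \<open>\<xi> = 1 + t\<^sup>q \<alpha>\<close> and \<open>q \<le> s - k\<close>, modulo \<open>t\<^sup>s E\<close>. As \<open>\<xi>\<close> is a unit, \<open>\<xi>, \<alpha> \<xi>\<close> is a basis of
  \<open>E\<close> over \<open>D\<close>, which gives \<open>M = t\<^sup>k \<xi> D + t\<^sup>s E\<close>; and \<open>\<xi>\<^sup>2 = \<xi> + t\<^sup>q \<alpha> \<xi>\<close> shows that \<open>M \<cdot> M \<subseteq> M\<close> exactly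
  when \<open>s \<le> 2 k + q\<close>. This is part (1).

  For part (2), the maximal ideal of \<open>D \<oplus> (M \<times> 0)\<close> is \<open>J = t D \<oplus> (M \<times> 0)\<close>. If \<open>M = t\<^sup>k M'\<close> with
  \<open>k \<ge> 1\<close> and \<open>M'\<close> multiplicatively closed, then \<open>J\<^sup>2 = t J\<close> and the embedding dimension is \<open>3\<close>. For
  \<open>C\<^sub>l\<^sub>,\<^sub>q(\<alpha>)\<close> with \<open>l \<ge> 1\<close> the square of the generator \<open>b = t\<^sup>l \<xi>\<close> is \<open>t\<^sup>l b\<close> plus the second generator of
  \<open>M\<close>, so \<open>t\<close> and \<open>b\<close> alone generate \<open>J\<close> modulo \<open>J\<^sup>2\<close>.
\<close>

section \<open>Embedding dimension\<close>

text \<open>Both rings lie in one field and share the uniformizer \<open>t\<close>, so valuations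
  are expressed by membership in \<open>P n\<close>, the ideal t^n E. The decisive property of
  \<alpha> is that 1 and \<alpha> are independent modulo t, so the valuation of a + b \<alpha> is
  the minimum of those of a and b. Clearing denominators of coordinates over K then makes 1,
  \<alpha> a D-basis of E. A pole in a coordinate of an element of a cubic ring would grow without
  bound in its powers, although all of them lie in one finitely generated module. A submodule M of E
  containing no t^m E is cyclic, and D + (M x 0) then has no three independent elements. The bound q
  \<le> s - k is a truncation: a \<xi> closer to 1 than that cannot be distinguished modulo t^s E,
  and without truncation \<xi> = 1 would need an infinite q. In part (2) an inverse taken in A need
  not lie in the ring; a quadratic relation for the elements of M brings it back. Dimension one
  holds because inverting t turns the ring into the product of two fields, so primes avoiding t are
  incomparable.\<close>

lemma maximalideal_imp_max_ideal:
  assumes "local_ring R" "maximalideal J R"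
  shows "max_ideal R = J"
  using assms unfolding local_ring_def max_ideal_def by (metis the1_equality)

context ideal begin

lemma coset_eq_iff:
  assumes "x \<in> carrier R" "y \<in> carrier R"
  shows "I +> x = I +> y \<longleftrightarrow> x \<ominus> y \<in> I"
proof
  assume "I +> x = I +> y"
  then have "x \<in> I +> y" using a_rcos_self assms by metis
  then obtain i where "i \<in> I" "x = i \<oplus> y" by (auto simp: a_r_coset_def r_coset_def)
  moreover have "i \<oplus> y \<ominus> y = i" using a_Hcarr[OF \<open>i \<in> I\<close>] assms by (simp add: minus_eq a_assoc r_neg)
  ultimately show "x \<ominus> y \<in> I" by simp
next
  assume "x \<ominus> y \<in> I"
  moreover have "x = (x \<ominus> y) \<oplus> y" using assms by (simp add: minus_eq a_assoc l_neg)
  ultimately have "x \<in> I +> y" by (auto simp: a_r_coset_def r_coset_def)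
  then show "I +> x = I +> y" using a_repr_independence'[of x y] assms by simp
qed

lemma coset_zero_iff:
  assumes "x \<in> carrier R"
  shows "I +> x = I \<longleftrightarrow> x \<in> I"
  using a_rcos_const a_rcos_self assms by metis

end

text \<open>The action of \<open>R/J\<close> on \<open>J/J\<^sup>2\<close> is well defined because \<open>J \<cdot> J\<close> absorbs the change of representatives.\<close>

lemma (in cring) cotangent_smult:
  assumes J: "ideal J R" and c: "c \<in> carrier R" and x: "x \<in> J"
  shows "rcoset_mult R (J \<cdot> J) (J +> c) ((J \<cdot> J) +> x) = (J \<cdot> J) +> (c \<otimes> x)"
proof -
  interpret J: ideal J R by (rule J)
  interpret Q: ideal "J \<cdot> J" R by (rule ideal_prod_is_ideal[OF J J])
  have QJ: "J \<cdot> J \<subseteq> J" using ideal_prod_inter[OF J J] by blast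
  have xc: "x \<in> carrier R" using x J.a_Hcarr by blast
  have same: "(J \<cdot> J) +> (a \<otimes> b) = (J \<cdot> J) +> (c \<otimes> x)"
    if a: "a \<in> J +> c" and b: "b \<in> (J \<cdot> J) +> x" for a b
  proof -
    obtain i where i: "i \<in> J" "a = i \<oplus> c" using a by (auto simp: a_r_coset_def r_coset_def)
    obtain j where j: "j \<in> J \<cdot> J" "b = j \<oplus> x" using b by (auto simp: a_r_coset_def r_coset_def)
    have car: "i \<in> carrier R" "j \<in> carrier R" "c \<in> carrier R" "x \<in> carrier R"
      using i j c xc J.a_Hcarr Q.a_Hcarr by auto
    have "a \<otimes> b \<ominus> c \<otimes> x = a \<otimes> j \<oplus> i \<otimes> x" unfolding i(2) j(2) using car by algebra
    moreover have "a \<otimes> j \<in> J \<cdot> J" using Q.I_l_closed j i car by simp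
    moreover have "i \<otimes> x \<in> J \<cdot> J" using ideal_prod.prod[OF i(1) x] by blast
    ultimately have "a \<otimes> b \<ominus> c \<otimes> x \<in> J \<cdot> J" using Q.a_closed by simp
    then show ?thesis using Q.coset_eq_iff[of "a \<otimes> b" "c \<otimes> x"] i j car by simp
  qed
  have "c \<in> J +> c" "x \<in> (J \<cdot> J) +> x" using J.a_rcos_self Q.a_rcos_self c xc by auto
  then show ?thesis using same unfolding rcoset_mult_def by blast
qed

text \<open>All operations are reduced to representatives, so that later arguments compute in R and
  never with elementwise products of cosets.\<close>

lemma (in cring) cotangent_space_simps:
  assumes J: "ideal J R"
  shows "carrier (cotangent_space R J) = (\<lambda>x. (J \<cdot> J) +> x) ` J" "\<zero>\<^bsub>cotangent_space R J\<^esub> = J \<cdot> J"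
    "\<And>x y. x \<in> J \<Longrightarrow> y \<in> J \<Longrightarrow>
      ((J \<cdot> J) +> x) \<oplus>\<^bsub>cotangent_space R J\<^esub> ((J \<cdot> J) +> y) = (J \<cdot> J) +> (x \<oplus> y)"
    "\<And>c x. c \<in> carrier R \<Longrightarrow> x \<in> J \<Longrightarrow>
      (J +> c) \<odot>\<^bsub>cotangent_space R J\<^esub> ((J \<cdot> J) +> x) = (J \<cdot> J) +> (c \<otimes> x)"
    "\<And>a. a \<in> carrier (R Quot J) \<longleftrightarrow> (\<exists>c\<in>carrier R. a = J +> c)"
proof -
  interpret J: ideal J R by (rule J)
  interpret Q: ideal "J \<cdot> J" R by (rule ideal_prod_is_ideal[OF J J])
  show "((J \<cdot> J) +> x) \<oplus>\<^bsub>cotangent_space R J\<^esub> ((J \<cdot> J) +> y) = (J \<cdot> J) +> (x \<oplus> y)"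
    if "x \<in> J" "y \<in> J" for x y
    using Q.a_rcos_sum J.a_Hcarr that by (simp add: cotangent_space_def)
  show "(J +> c) \<odot>\<^bsub>cotangent_space R J\<^esub> ((J \<cdot> J) +> x) = (J \<cdot> J) +> (c \<otimes> x)"
    if "c \<in> carrier R" "x \<in> J" for c x
    using cotangent_smult[OF J that] by (simp add: cotangent_space_def)
  show "a \<in> carrier (R Quot J) \<longleftrightarrow> (\<exists>c\<in>carrier R. a = J +> c)" for a
    by (auto simp: FactRing_simps)
qed (simp_all add: cotangent_space_def)

lemma (in cring) cotangent_vectorspace:
  assumes J: "maximalideal J R"
  shows "vectorspace (R Quot J) (cotangent_space R J)"
proof -
  interpret J: maximalideal J R by (rule J)
  have JI: "ideal J R" by (rule J.ideal_axioms)
  interpret Q: ideal "J \<cdot> J" R by (rule ideal_prod_is_ideal[OF JI JI])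
  have f: "field (R Quot J)" using J.quotient_is_field is_cring by blast
  interpret F: field "R Quot J" by (rule f)
  let ?p = "\<lambda>x. (J \<cdot> J) +> x"
  have Jc: "x \<in> carrier R" if "x \<in> J" for x using that J.a_Hcarr by blast
  note V = cotangent_space_simps(1,2)[OF JI] and add = cotangent_space_simps(3)[OF JI]
    and smult = cotangent_space_simps(4)[OF JI] and q = cotangent_space_simps(5)[OF JI]
  have zero: "\<zero>\<^bsub>cotangent_space R J\<^esub> = ?p \<zero>" using V(2) Q.coset_zero_iff[of \<zero>] by simp
  have qm: "(J +> a) \<otimes>\<^bsub>R Quot J\<^esub> (J +> b) = J +> (a \<otimes> b)" "(J +> a) \<oplus>\<^bsub>R Quot J\<^esub> (J +> b) = J +> (a \<oplus> b)"
     "\<one>\<^bsub>R Quot J\<^esub> = J +> \<one>"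
    if "a \<in> carrier R" "b \<in> carrier R" for a b
    using that by (simp_all add: FactRing_def J.rcoset_mult_add J.a_rcos_sum)
  have "module (R Quot J) (cotangent_space R J)"
  proof (rule module_criteria, goal_cases)
    case 1 then show ?case by (rule F.is_cring)
  next
    case 2 then show ?case unfolding zero V by simp
  next
    case 3 then show ?case using V add by auto
  next
    case 4 show ?case
    proof
      fix v assume "v \<in> carrier (cotangent_space R J)"
      then obtain x where x: "x \<in> J" "v = ?p x" using V by auto
      then have "v \<oplus>\<^bsub>cotangent_space R J\<^esub> ?p (\<ominus> x) = \<zero>\<^bsub>cotangent_space R J\<^esub>"
        using add Jc zero by (simp add: r_neg)
      then show "\<exists>w\<in>carrier (cotangent_space R J). v \<oplus>\<^bsub>cotangent_space R J\<^esub> w = \<zero>\<^bsub>cotangent_space R J\<^esub>"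
        using x V by auto
    qed
  next
    case 5 then show ?case using V smult q J.I_l_closed by auto
  next
    case 6 then show ?case using V add Jc by (auto simp: a_comm)
  next
    case 7 then show ?case using V add Jc by (auto simp: a_assoc)
  next
    case 8 show ?case unfolding zero using V(1) add[of _ \<zero>] Jc by auto
  next
    case 9 then show ?case using V(1) q smult qm J.I_l_closed Jc by (auto simp: m_assoc)
  next
    case 10 then show ?case using V(1) smult qm(3)[OF one_closed one_closed] Jc by auto
  next
    case 11 then show ?case using V(1) q smult qm add J.I_l_closed Jc by (auto simp: l_distr)
  next
    case 12 then show ?case using V(1) q smult add J.I_l_closed Jc by (auto simp: r_distr)
  qed
  then show ?thesis using f by (simp add: vectorspace_def)
qed

text \<open>The two conditions say that the classes of S span J/J^2 and are independent over R/J.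
  They are phrased by sums in R, so an application has to deal only with membership in J and
  J^2.\<close>

theorem embedding_dim_eq_card:
  fixes R (structure)
  assumes "local_ring R" and J: "maximalideal J R" and S: "finite S" "S \<subseteq> J"
    and gen: "\<And>j. j \<in> J \<Longrightarrow> \<exists>r \<in> S \<rightarrow> carrier R. j \<ominus> (\<Oplus>s\<in>S. r s \<otimes> s) \<in> J \<cdot> J"
    and indep: "\<And>r s. r \<in> S \<rightarrow> carrier R \<Longrightarrow> (\<Oplus>s\<in>S. r s \<otimes> s) \<in> J \<cdot> J \<Longrightarrow> s \<in> S \<Longrightarrow> r s \<in> J"
  shows "embedding_dim R = card S"
proof -
  interpret cring R using assms(1) by (simp add: local_ring_def)
  interpret J: maximalideal J R by (rule J)
  have JI: "ideal J R" by (rule J.ideal_axioms)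
  interpret Q: ideal "J \<cdot> J" R by (rule ideal_prod_is_ideal[OF JI JI])
  let ?V = "cotangent_space R J"
  interpret V: vectorspace "R Quot J" ?V by (rule cotangent_vectorspace[OF J])
  let ?p = "\<lambda>x. (J \<cdot> J) +> x"
  have Jc: "x \<in> carrier R" if "x \<in> J" for x using that J.a_Hcarr by blast
  note carV = cotangent_space_simps(1,2)[OF JI] and add = cotangent_space_simps(3)[OF JI]
    and smult = cotangent_space_simps(4)[OF JI] and qc = cotangent_space_simps(5)[OF JI]
  have q0: "\<zero>\<^bsub>R Quot J\<^esub> = J" by (simp add: FactRing_def)
  have J1: "\<one> \<notin> J" using J.I_notcarr J.one_imp_carrier by auto
  have inj: "inj_on ?p S"
  proof (rule inj_onI, rule ccontr)
    fix s s' assume s: "s \<in> S" "s' \<in> S" "?p s = ?p s'" "s \<noteq> s'"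
    \<comment> \<open>Equal classes of s and s' would give a relation with coefficients 1 and -1,
      and independence would put 1 into J.\<close>
    define r where "r = (\<lambda>v. if v = s then \<one> else if v = s' then \<ominus> \<one> else \<zero>)"
    define S0 where "S0 = S - {s, s'}"
    have S0: "S = insert s (insert s' S0)" "finite S0" "s \<notin> insert s' S0" "s' \<notin> S0"
      using s S by (auto simp: S0_def)
    have SJ: "v \<in> carrier R" if "v \<in> S" for v using S Jc that by blast
    have r: "r \<in> S \<rightarrow> carrier R" by (auto simp: r_def)
    have S0z: "(\<Oplus>v\<in>S0. r v \<otimes> v) = \<zero>"
    proof -
      have "(\<Oplus>v\<in>S0. r v \<otimes> v) = (\<Oplus>v\<in>S0. \<zero>)"
        using S0 SJ by (intro finsum_cong') (auto simp: r_def)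
      then show ?thesis by simp
    qed
    have c: "s \<in> carrier R" "s' \<in> carrier R" using SJ s by auto
    have "(\<Oplus>v\<in>S. r v \<otimes> v) = r s \<otimes> s \<oplus> (r s' \<otimes> s' \<oplus> (\<Oplus>v\<in>S0. r v \<otimes> v))"
      unfolding S0(1) using S0 SJ r by (subst finsum_insert; (subst finsum_insert)?) auto
    also have "\<dots> = s \<ominus> s'" using S0z s c by (simp add: r_def l_minus minus_eq)
    also have "s \<ominus> s' \<in> J \<cdot> J" using Q.coset_eq_iff s c by blast
    finally have "r s \<in> J" using indep[OF r] s by blast
    then show False using J1 by (simp add: r_def)
  qed
  \<comment> \<open>Coefficients in the quotient space are indexed by cosets. Injectivity on S turns
    a sum over the image of A into a sum over A.\<close>
  have lin: "V.lincomb a (?p ` A) = ?p (\<Oplus>s\<in>A. r s \<otimes> s) \<and> (\<Oplus>s\<in>A. r s \<otimes> s) \<in> J"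
    if A: "A \<subseteq> S" "r \<in> A \<rightarrow> carrier R" "\<And>s. s \<in> A \<Longrightarrow> a (?p s) = J +> r s" for A a r
  proof -
    have "finite A" using A S finite_subset by blast
    then show ?thesis using A
    proof (induction A)
      case empty
      then show ?case unfolding V.lincomb_def using carV Q.coset_zero_iff[of \<zero>] by simp
    next
      case (insert x A)
      have xJ: "x \<in> J" "r x \<in> carrier R" and AJ: "A \<subseteq> J" using insert.prems S by auto
      have IH: "V.lincomb a (?p ` A) = ?p (\<Oplus>s\<in>A. r s \<otimes> s)" "(\<Oplus>s\<in>A. r s \<otimes> s) \<in> J"
        using insert.IH insert.prems by auto
      have Ac: "s \<in> carrier R" if "s \<in> A" for s using AJ Jc that by blast
      have nin: "?p x \<notin> ?p ` A" using inj insert.hyps(2) insert.prems(1) by (auto simp: inj_on_def)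
      have fs: "(\<Oplus>s\<in>insert x A. r s \<otimes> s) = r x \<otimes> x \<oplus> (\<Oplus>s\<in>A. r s \<otimes> s)"
        using insert.hyps insert.prems xJ Ac Jc by (intro finsum_insert) auto
      have "V.lincomb a (?p ` insert x A) = a (?p x) \<odot>\<^bsub>?V\<^esub> ?p x \<oplus>\<^bsub>?V\<^esub> V.lincomb a (?p ` A)"
        unfolding V.lincomb_def image_insert
      proof (rule V.finsum_insert)
        show "finite (?p ` A)" "?p x \<notin> ?p ` A" using insert nin by auto
        have "a v \<odot>\<^bsub>?V\<^esub> v \<in> carrier ?V" if v: "v \<in> ?p ` insert x A" for v
        proof (rule V.smult_closed)
          show "v \<in> carrier ?V" using v carV xJ AJ by auto
          obtain s where s: "s \<in> insert x A" "v = ?p s" using v by blast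
          then have "a v = J +> r s" "r s \<in> carrier R" using insert.prems by auto
          then show "a v \<in> carrier (R Quot J)" using qc by blast
        qed
        then show "(\<lambda>v. a v \<odot>\<^bsub>?V\<^esub> v) \<in> ?p ` A \<rightarrow> carrier ?V" "a (?p x) \<odot>\<^bsub>?V\<^esub> ?p x \<in> carrier ?V" by auto
      qed
      also have "\<dots> = ?p (r x \<otimes> x) \<oplus>\<^bsub>?V\<^esub> ?p (\<Oplus>s\<in>A. r s \<otimes> s)"
        using smult xJ insert.prems IH by simp
      also have "\<dots> = ?p (\<Oplus>s\<in>insert x A. r s \<otimes> s)" unfolding fs using xJ IH J.I_l_closed by (intro add) auto
      finally show ?case using fs xJ IH J.I_l_closed J.a_closed by simp
    qed
  qed
  have SV: "?p ` S \<subseteq> carrier ?V" using S carV by auto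
  have "V.gen_set (?p ` S)"
  proof
    show "V.span (?p ` S) \<subseteq> carrier ?V" using V.span_is_subset2[OF SV] .
    show "carrier ?V \<subseteq> V.span (?p ` S)"
    proof
      fix v assume "v \<in> carrier ?V"
      then obtain j where j: "j \<in> J" "v = ?p j" using carV by auto
      obtain r where r: "r \<in> S \<rightarrow> carrier R" "j \<ominus> (\<Oplus>s\<in>S. r s \<otimes> s) \<in> J \<cdot> J" using gen j by blast
      \<comment> \<open>A coefficient function must depend on the coset alone;
        \<open>inv_into\<close> recovers the unique representative in S.\<close>
      define a where "a = (\<lambda>v. J +> r (inv_into S ?p v))"
      have a: "a (?p s) = J +> r s" if "s \<in> S" for s using that inj by (simp add: a_def)
      have "V.lincomb a (?p ` S) = ?p (\<Oplus>s\<in>S. r s \<otimes> s)" "(\<Oplus>s\<in>S. r s \<otimes> s) \<in> J" using lin[of S r a] r a by auto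
      then have "v = V.lincomb a (?p ` S)" using Q.coset_eq_iff[of j "\<Oplus>s\<in>S. r s \<otimes> s"] j r(2) Jc by simp
      moreover have "a \<in> ?p ` S \<rightarrow> carrier (R Quot J)"
      proof
        fix w assume "w \<in> ?p ` S"
        then obtain s where s: "s \<in> S" "w = ?p s" by blast
        then have "a w = J +> r s" "r s \<in> carrier R" using a r(1) by auto
        then show "a w \<in> carrier (R Quot J)" using qc by blast
      qed
      ultimately show "v \<in> V.span (?p ` S)" using V.finite_span[of "?p ` S"] S SV by blast
    qed
  qed
  moreover have "V.lin_indpt (?p ` S)"
  proof (rule V.finite_lin_indpt2)
    show "finite (?p ` S)" "?p ` S \<subseteq> carrier ?V" using S SV by auto
    fix a assume a: "a \<in> ?p ` S \<rightarrow> carrier (R Quot J)" and z: "V.lincomb a (?p ` S) = \<zero>\<^bsub>?V\<^esub>"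
    have "\<forall>s\<in>S. \<exists>c\<in>carrier R. a (?p s) = J +> c" using a qc by (metis Pi_mem imageI)
    then obtain r where r: "\<forall>s\<in>S. r s \<in> carrier R \<and> a (?p s) = J +> r s" by metis
    then have "?p (\<Oplus>s\<in>S. r s \<otimes> s) = J \<cdot> J" "(\<Oplus>s\<in>S. r s \<otimes> s) \<in> J" using lin[of S r a] z carV by auto
    then have "(\<Oplus>s\<in>S. r s \<otimes> s) \<in> J \<cdot> J" using Q.coset_zero_iff Jc by blast
    then have "r s \<in> J" if "s \<in> S" for s using indep[of r s] r that by blast
    then show "\<forall>v\<in>?p ` S. a v = \<zero>\<^bsub>R Quot J\<^esub>" using r q0 J.coset_zero_iff by auto
  qed
  ultimately have "V.dim = card (?p ` S)"
    using V.dim_basis[of "?p ` S"] S SV by (simp add: V.basis_def)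
  then show ?thesis
    using maximalideal_imp_max_ideal[OF assms(1) J] card_image[OF inj] by (simp add: embedding_dim_def)
qed

section \<open>Local rings and ideals of subrings\<close>

text \<open>Negation is defined as the inverse in the additive monoid, found within the carrier.
  Shrinking the carrier could therefore change it, and uniqueness of inverses shows that it does
  not.\<close>

lemma (in cring) subring_uminus:
  assumes C: "subring C R" and x: "x \<in> C"
  shows "\<ominus>\<^bsub>R\<lparr>carrier := C\<rparr>\<^esub> x = \<ominus> x"
proof -
  interpret S: ring "R\<lparr>carrier := C\<rparr>" by (rule subring_is_ring[OF C])
  have "x \<in> carrier R" using subringE(1)[OF C] x by blast
  then show ?thesis using S.minus_equality[of "\<ominus> x" x] subringE(5)[OF C x] x by (simp add: l_neg)
qed

lemma (in cring) subring_minus: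
  assumes C: "subring C R" and x: "x \<in> C" "y \<in> C"
  shows "x \<ominus>\<^bsub>R\<lparr>carrier := C\<rparr>\<^esub> y = x \<ominus> y"
  using subring_uminus[OF C x(2)] by (simp add: a_minus_def)

lemma (in cring) ideal_in_subringI:
  assumes C: "subring C R" and I: "I \<subseteq> C" "\<zero> \<in> I" "\<And>x y. x \<in> I \<Longrightarrow> y \<in> I \<Longrightarrow> x \<oplus> y \<in> I"
    "\<And>c x. c \<in> C \<Longrightarrow> x \<in> I \<Longrightarrow> c \<otimes> x \<in> I"
  shows "ideal I (R\<lparr>carrier := C\<rparr>)"
proof -
  note c = subringE[OF C]
  interpret S: ring "R\<lparr>carrier := C\<rparr>" by (rule subring_is_ring[OF C])
  show ?thesis
  proof (rule idealI)
    show "subgroup I (add_monoid (R\<lparr>carrier := C\<rparr>))"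
    proof (rule S.add.subgroupI)
      fix x assume x: "x \<in> I"
      then have xc: "x \<in> C" "x \<in> carrier R" using I c by auto
      have "\<ominus> x = (\<ominus> \<one>) \<otimes> x" using xc by (simp add: l_minus)
      then have "\<ominus> x \<in> I" using I(4)[of "\<ominus> \<one>" x] c(3,5) x by simp
      then show "\<ominus>\<^bsub>R\<lparr>carrier := C\<rparr>\<^esub> x \<in> I" using subring_uminus[OF C xc(1)] by simp
    qed (use I in auto)
    fix a x assume a: "a \<in> I" and x: "x \<in> carrier (R\<lparr>carrier := C\<rparr>)"
    then show "x \<otimes>\<^bsub>R\<lparr>carrier := C\<rparr>\<^esub> a \<in> I" using I by simp
    have "a \<otimes> x = x \<otimes> a" using a x I c(1) by (intro m_comm) auto
    then show "a \<otimes>\<^bsub>R\<lparr>carrier := C\<rparr>\<^esub> x \<in> I" using a x I by simp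
  qed (rule S.ring_axioms)
qed

text \<open>The inverse condition says that R/J is a field. A larger ideal contains some x outside
  J, hence x y - j = 1.\<close>

lemma (in cring) maximalidealI_inverse:
  assumes J: "ideal J R" and one: "\<one> \<notin> J"
    and inv: "\<And>x. x \<in> carrier R \<Longrightarrow> x \<notin> J \<Longrightarrow> \<exists>y\<in>carrier R. \<exists>j\<in>J. x \<otimes> y = \<one> \<oplus> j"
  shows "maximalideal J R"
proof (rule maximalidealI[OF J])
  show "carrier R \<noteq> J" using one by auto
  fix I assume I: "ideal I R" "J \<subseteq> I" "I \<subseteq> carrier R"
  interpret I: ideal I R by (rule I(1))
  show "I = J \<or> I = carrier R"
  proof (cases "I \<subseteq> J")
    case False
    then obtain x where x: "x \<in> I" "x \<notin> J" by blast
    then obtain y j where y: "y \<in> carrier R" "j \<in> J" "x \<otimes> y = \<one> \<oplus> j" using inv I by blast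
    have jc: "j \<in> carrier R" "j \<in> I" using y I by auto
    have "x \<otimes> y \<in> I" using I.I_r_closed x y by blast
    then have "x \<otimes> y \<ominus> j \<in> I" unfolding minus_eq using I.a_closed I.a_inv_closed jc(2) by blast
    also have "x \<otimes> y \<ominus> j = \<one>" unfolding y(3) using jc by algebra
    finally show ?thesis using I.one_imp_carrier by blast
  qed (use I in blast)
qed

text \<open>A proper ideal contains no unit, so each maximal ideal lies inside J and equals
  it.\<close>

lemma (in cring) local_ringI_units:
  assumes J: "maximalideal J R" and inv: "\<And>x. x \<in> carrier R \<Longrightarrow> x \<notin> J \<Longrightarrow> \<exists>y\<in>carrier R. x \<otimes> y = \<one>"
  shows "local_ring R"
  unfolding local_ring_def
proof (intro conjI ex1I[of _ J])
  show "cring R" by (rule is_cring)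
  show "maximalideal J R" by (rule J)
  fix I assume I: "maximalideal I R"
  interpret I: maximalideal I R by (rule I)
  interpret J: maximalideal J R by (rule J)
  have "I \<subseteq> J"
  proof
    fix x assume x: "x \<in> I"
    show "x \<in> J"
    proof (rule ccontr)
      assume "x \<notin> J"
      then obtain y where "y \<in> carrier R" "x \<otimes> y = \<one>" using inv x I.a_Hcarr by blast
      then have "\<one> \<in> I" using I.I_r_closed[OF x] by metis
      then show False using I.one_imp_carrier I.I_notcarr by blast
    qed
  qed
  moreover have "J \<subseteq> carrier R" using J.a_subset .
  ultimately show "I = J" using I.I_maximal[OF J.ideal_axioms] J.I_notcarr by blast
qed

text \<open>Excluding three-term chains suffices, since any longer chain starts with its first three
  members.\<close>

lemma krull_dim_eq_1:
  assumes chain: "primeideal P0 R" "primeideal P1 R" "P0 \<subset> P1"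
    and no_chain: "\<And>P0 P1 P2. primeideal P0 R \<Longrightarrow> primeideal P1 R \<Longrightarrow> primeideal P2 R \<Longrightarrow> P0 \<subset> P1 \<Longrightarrow> \<not> P1 \<subset> P2"
  shows "krull_dim R = 1"
  unfolding krull_dim_def
proof (rule antisym)
  show "Sup {enat n | n. \<exists>P. (\<forall>i\<le>n. primeideal (P i) R) \<and> (\<forall>i<n. P i \<subset> P (Suc i))} \<le> 1"
  proof (rule Sup_least, clarify)
    fix n :: nat and P assume P: "\<forall>i\<le>n. primeideal (P i) R" "\<forall>i<n. P i \<subset> P (Suc i)"
    have "n \<le> 1"
    proof (rule ccontr)
      assume "\<not> n \<le> 1"
      then have "2 \<le> n" by simp
      then show False using no_chain[of "P 0" "P 1" "P 2"] P by (auto simp: numeral_2_eq_2)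
    qed
    then show "enat n \<le> 1" by (simp add: one_enat_def)
  qed
  have "\<exists>P. (\<forall>i\<le>1. primeideal (P i) R) \<and> (\<forall>i<1. P i \<subset> P (Suc i))"
    using chain by (intro exI[of _ "\<lambda>i::nat. if i = 0 then P0 else P1"]) auto
  then show "1 \<le> Sup {enat n | n. \<exists>P. (\<forall>i\<le>n. primeideal (P i) R) \<and> (\<forall>i<n. P i \<subset> P (Suc i))}"
    unfolding one_enat_def by (intro Sup_upper) blast
qed

lemma (in primeideal) nat_pow_mem:
  assumes "x \<in> carrier R" "x [^] (n::nat) \<in> I" shows "x \<in> I"
  using assms(2)
proof (induction n)
  case 0
  then show ?case using one_imp_carrier I_notcarr by simp
next
  case (Suc n)
  then show ?case using I_prime[of "x [^] n" x] assms(1) by auto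
qed

text \<open>Zorn's lemma applies to the ideals that contain x but not 1, with no finiteness
  condition on the ring. In a local ring this makes every element outside the maximal ideal a
  unit.\<close>

lemma (in cring) nonunit_in_maximalideal:
  assumes x: "x \<in> carrier R" "x \<notin> Units R"
  shows "\<exists>J. maximalideal J R \<and> x \<in> J"
proof -
  let ?A = "{I. ideal I R \<and> x \<in> I \<and> \<one> \<notin> I}"
  have "\<one> \<notin> PIdl x"
  proof
    assume "\<one> \<in> PIdl x"
    then obtain y where y: "y \<in> carrier R" "y \<otimes> x = \<one>" by (auto simp: cgenideal_def)
    then have "x \<in> Units R" using x m_comm[of x y] unfolding Units_def by auto
    then show False using x by simp
  qed
  then have "PIdl x \<in> ?A" using x cgenideal_ideal cgenideal_self by simp
  then have ne: "?A \<noteq> {}" by blast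
  have un: "\<Union>C \<in> ?A" if C: "C \<noteq> {}" "subset.chain ?A C" for C
  proof -
    have "subset.chain {I. ideal I R} C" using C(2) by (auto simp: subset_chain_def)
    then have "ideal (\<Union>C) R" using chain_Union_is_ideal[of C] C(1) by simp
    moreover have "x \<in> \<Union>C" "\<one> \<notin> \<Union>C" using C by (auto simp: subset_chain_def)
    ultimately show ?thesis by blast
  qed
  obtain J where J: "J \<in> ?A" "\<And>I. I \<in> ?A \<Longrightarrow> J \<subseteq> I \<Longrightarrow> I = J"
    using subset_Zorn_nonempty[OF ne un] by blast
  have "maximalideal J R"
  proof (rule maximalidealI)
    show "ideal J R" "carrier R \<noteq> J" using J by auto
    fix I assume I: "ideal I R" "J \<subseteq> I" "I \<subseteq> carrier R"
    show "I = J \<or> I = carrier R"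
    proof (cases "\<one> \<in> I")
      case True
      then show ?thesis using ideal.one_imp_carrier[OF I(1)] by blast
    next
      case False
      then show ?thesis using J I by blast
    qed
  qed
  then show ?thesis using J by blast
qed

text \<open>If e and 1 - e were both nonunits, they would share the only maximal ideal, which would
  contain 1. A unit idempotent is 1, and a unit 1 - e kills e.\<close>

lemma local_ring_idempotent:
  fixes R (structure)
  assumes loc: "local_ring R" and e: "e \<in> carrier R" "e \<otimes> e = e"
  shows "e = \<zero> \<or> e = \<one>"
proof -
  interpret cring R using loc by (simp add: local_ring_def)
  have e': "\<one> \<ominus> e \<in> carrier R" using e by simp
  have "e \<in> Units R \<or> \<one> \<ominus> e \<in> Units R"
  proof (rule ccontr)
    assume "\<not> ?thesis"
    then obtain J J' where J: "maximalideal J R" "e \<in> J" "maximalideal J' R" "\<one> \<ominus> e \<in> J'"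
      using nonunit_in_maximalideal e e' by metis
    have "J' = J" using loc J unfolding local_ring_def by blast
    interpret J: maximalideal J R by (rule J(1))
    have "e \<oplus> (\<one> \<ominus> e) \<in> J" using J.a_closed J \<open>J' = J\<close> by simp
    moreover have "e \<oplus> (\<one> \<ominus> e) = \<one>" using e(1) by algebra
    ultimately show False using J.one_imp_carrier J.I_notcarr by simp
  qed
  then show ?thesis
  proof
    assume u: "e \<in> Units R"
    have "e = (inv e \<otimes> e) \<otimes> e" using u e(1) by simp
    also have "\<dots> = inv e \<otimes> (e \<otimes> e)" using u e(1) by (intro m_assoc) auto
    also have "\<dots> = \<one>" unfolding e(2) using u by simp
    finally show ?thesis by blast
  next
    assume u: "\<one> \<ominus> e \<in> Units R"
    have "e \<otimes> (\<one> \<ominus> e) = e \<ominus> e \<otimes> e" using e(1) by algebra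
    also have "\<dots> = \<zero>" using e by (simp add: minus_eq r_neg)
    finally have "(e \<otimes> (\<one> \<ominus> e)) \<otimes> inv (\<one> \<ominus> e) = \<zero>" using u by simp
    moreover have "(e \<otimes> (\<one> \<ominus> e)) \<otimes> inv (\<one> \<ominus> e) = e" using u e by (simp add: m_assoc)
    ultimately show ?thesis by simp
  qed
qed

lemma (in cring) subring_is_cring: "subring H R \<Longrightarrow> cring (R\<lparr>carrier := H\<rparr>)"
  using subcring_iff[OF subringE(1)] subcringI' by blast

lemma (in cring) submod_module:
  assumes D: "subring D R" and C: "subring C R" "D \<subseteq> C"
  shows "module (R\<lparr>carrier := D\<rparr>) (submod R C)"
proof -
  note c = subringE[OF C(1)]
  have Dc: "d \<in> carrier R" if "d \<in> D" for d using that C c(1) by blast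
  have Cc: "d \<in> carrier R" if "d \<in> C" for d using that c(1) by blast
  have neg: "\<exists>w\<in>C. v \<oplus> w = \<zero>" if "v \<in> C" for v
    using that c(5)[OF that] Cc r_neg by blast
  show ?thesis
    using c C neg Dc Cc
    by (intro module_criteria subring_is_cring[OF D])
       (auto simp: submod_def a_ac m_assoc l_distr r_distr)
qed

lemma submod_simps [simp]:
  "carrier (submod R C) = C" "\<zero>\<^bsub>submod R C\<^esub> = \<zero>\<^bsub>R\<^esub>" "x \<oplus>\<^bsub>submod R C\<^esub> y = x \<oplus>\<^bsub>R\<^esub> y" "a \<odot>\<^bsub>submod R C\<^esub> x = a \<otimes>\<^bsub>R\<^esub> x"
  by (simp_all add: submod_def)

text \<open>This and the next three rules open up sums and multiples of sets: p lies in X exactly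
  when p = y for some y in X, and the quantifier over y then unfolds into quantifiers over D and
  E.\<close>

lemma bex_l_coset: "(\<exists>y \<in> a <#\<^bsub>R\<^esub> H. Q y) \<longleftrightarrow> (\<exists>h\<in>H. Q (a \<otimes>\<^bsub>R\<^esub> h))"
  by (auto simp: l_coset_def)

lemma bex_set_add: "(\<exists>y \<in> A <+>\<^bsub>R\<^esub> B. Q y) \<longleftrightarrow> (\<exists>a\<in>A. \<exists>b\<in>B. Q (a \<oplus>\<^bsub>R\<^esub> b))"
  by (auto simp: set_add_def set_mult_def)

lemma bex_Times: "(\<exists>p \<in> A \<times> B. Q p) \<longleftrightarrow> (\<exists>a\<in>A. \<exists>b\<in>B. Q (a, b))"
  by auto

lemma bex_diagonal: "(\<exists>p \<in> diagonal S. Q p) \<longleftrightarrow> (\<exists>d\<in>S. Q (d, d))"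
  by (auto simp: diagonal_def)

text \<open>Used in \<open>fin_gen_step\<close>: subtracting a multiple of one element cancels the
  coordinate at the new generator g.\<close>

lemma (in cring) eliminate_generator:
  assumes "p \<in> carrier R" "q \<in> carrier R" "c \<in> carrier R" "e \<in> carrier R" "g \<in> carrier R"
  shows "(p \<oplus> (c \<otimes> e) \<otimes> g) \<oplus> (\<ominus> c) \<otimes> (q \<oplus> e \<otimes> g) = p \<oplus> (\<ominus> c) \<otimes> q"
  using assms by algebra

lemma (in cring) restore_generator:
  assumes "x \<in> carrier R" "c \<in> carrier R" "n \<in> carrier R"
  shows "(x \<oplus> (\<ominus> c) \<otimes> n) \<oplus> c \<otimes> n = x"
  using assms by algebra

section \<open>Pairs of discrete valuation rings with a common uniformizer\<close>

text \<open>Replaces the abstract definition by the normal form t^n u. Inverses are those of the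
  ambient field, so elements of two subrings can be compared directly.\<close>

lemma (in field) dvr_subring:
  assumes D: "subring D R" and dvr: "dvr (R\<lparr>carrier := D\<rparr>) t"
  shows "t \<in> D" "t \<noteq> \<zero>" "inv t \<notin> D"
    "\<And>d. d \<in> D \<Longrightarrow> d \<noteq> \<zero> \<Longrightarrow> \<exists>n::nat. \<exists>u\<in>D. u \<noteq> \<zero> \<and> inv u \<in> D \<and> d = t [^] n \<otimes> u"
proof -
  let ?S = "R\<lparr>carrier := D\<rparr>"
  note d = subringE[OF D]
  have pd: "principal_domain ?S" and nf: "\<not> field ?S" and loc: "local_ring ?S" and max: "maximalideal (PIdl\<^bsub>?S\<^esub> t) ?S"
    using dvr by (auto simp: dvr_def)
  show tD: "t \<in> D" using dvr by (simp add: dvr_def)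
  interpret S: principal_domain ?S by (rule pd)
  interpret J: maximalideal "PIdl\<^bsub>?S\<^esub> t" ?S by (rule max)
  have car: "x \<in> carrier R" if "x \<in> D" for x using d(1) that by blast
  show t0: "t \<noteq> \<zero>"
  proof
    assume "t = \<zero>"
    then have "PIdl\<^bsub>?S\<^esub> t = {\<zero>\<^bsub>?S\<^esub>}" using d(2) car by (auto simp: cgenideal_def intro!: exI[of _ \<zero>])
    then show False using max S.zeromaximalideal_eq_field nf by simp
  qed
  have invt: "inv t \<in> carrier R" "inv t \<otimes> t = \<one>" using t0 tD car field_Units by auto
  have one: "\<one> \<notin> PIdl\<^bsub>?S\<^esub> t"
    using J.one_imp_carrier J.I_notcarr by auto
  show it: "inv t \<notin> D"
    using one invt(2) by (force simp: cgenideal_def)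
  \<comment> \<open>In a local ring a nonunit lies in the only maximal ideal, here the one generated
    by t.\<close>
  have unit: "inv x \<in> D \<and> x \<noteq> \<zero>" if x: "x \<in> D" "x \<notin> PIdl\<^bsub>?S\<^esub> t" for x
  proof -
    have "x \<in> Units ?S"
    proof (rule ccontr)
      assume "x \<notin> Units ?S"
      then obtain J where J: "maximalideal J ?S" "x \<in> J" using S.nonunit_in_maximalideal[of x] x by auto
      then have "J = PIdl\<^bsub>?S\<^esub> t" using loc max unfolding local_ring_def by blast
      then show False using J x by simp
    qed
    then obtain y where y: "y \<in> D" "y \<otimes> x = \<one>" "x \<otimes> y = \<one>" by (auto simp: Units_def)
    then have "inv x = y" using comm_inv_char x car by blast
    then show ?thesis using y car x d by auto
  qed
  have tpow: "t [^] (n::nat) \<in> D \<and> t [^] n \<noteq> \<zero>" for n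
    using tD t0 d car by (induction n) (auto simp: integral_iff)
  fix x assume x: "x \<in> D" "x \<noteq> \<zero>"
  have xc: "x \<in> carrier R" using x car by simp
  have ipow: "inv (t [^] (n::nat)) \<in> carrier R" "t [^] n \<otimes> inv (t [^] n) = \<one>" "inv (t [^] n) \<otimes> t [^] n = \<one>" for n
    using tpow[of n] car field_Units by auto
  \<comment> \<open>\<open>y n\<close> is x / t^n in the field; the exponent sought is the last n
    for which this quotient stays in D.\<close>
  define y where "y = (\<lambda>n::nat. inv (t [^] n) \<otimes> x)"
  have yc: "y n \<in> carrier R" for n using ipow xc by (simp add: y_def)
  have xy: "x = t [^] n \<otimes> y n" for n
    unfolding y_def using ipow[of n] tpow[of n] car xc by (simp add: m_assoc[symmetric])
  have y0: "y n \<noteq> \<zero>" for n using xy[of n] x tpow[of n] car by auto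
  have y_Suc: "y n = t \<otimes> y (Suc n)" for n
  proof -
    have "t [^] n \<otimes> y n = t [^] n \<otimes> (t \<otimes> y (Suc n))"
      using xy[of n] xy[of "Suc n"] yc tpow[of n] tD car by (simp add: m_assoc)
    then show ?thesis using m_lcancel[of "t [^] n" "y n" "t \<otimes> y (Suc n)"] tpow[of n] yc tD car by simp
  qed
  \<comment> \<open>If every quotient stayed in D, the ideals they generate would ascend. In a
    principal ideal domain the chain stops, which makes t invertible.\<close>
  have "\<exists>n. y n \<notin> D"
  proof (rule ccontr)
    assume "\<not> ?thesis"
    then have yD: "y n \<in> D" for n by blast
    define C where "C = range (\<lambda>n. PIdl\<^bsub>?S\<^esub> (y n))"
    have sub: "PIdl\<^bsub>?S\<^esub> (y n) \<subseteq> PIdl\<^bsub>?S\<^esub> (y (Suc n))" for n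
    proof
      fix z assume "z \<in> PIdl\<^bsub>?S\<^esub> (y n)"
      then obtain a where a: "a \<in> D" "z = a \<otimes> y n" by (auto simp: cgenideal_def)
      then have "z = (a \<otimes> t) \<otimes> y (Suc n)" using y_Suc[of n] yc tD car by (simp add: m_assoc)
      then show "z \<in> PIdl\<^bsub>?S\<^esub> (y (Suc n))" using a tD d(6) unfolding cgenideal_def by auto
    qed
    have mono: "PIdl\<^bsub>?S\<^esub> (y m) \<subseteq> PIdl\<^bsub>?S\<^esub> (y n)" if "m \<le> n" for m n
      using lift_Suc_mono_le[of "\<lambda>n. PIdl\<^bsub>?S\<^esub> (y n)", OF sub that] .
    have "subset.chain {I. ideal I ?S} C"
      unfolding subset_chain_def
    proof (intro conjI ballI)
      show "C \<subseteq> {I. ideal I ?S}" using S.cgenideal_ideal yD by (auto simp: C_def)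
      fix I J assume "I \<in> C" "J \<in> C"
      then obtain m n where "I = PIdl\<^bsub>?S\<^esub> (y m)" "J = PIdl\<^bsub>?S\<^esub> (y n)" by (auto simp: C_def)
      then show "I \<subseteq> J \<or> J \<subseteq> I" using mono[of m n] mono[of n m] nat_le_linear[of m n] by blast
    qed
    then have "\<Union>C \<in> C" using S.ideal_chain_is_trivial[of C] by (auto simp: C_def)
    then obtain m where m: "\<Union>C = PIdl\<^bsub>?S\<^esub> (y m)" by (auto simp: C_def)
    have "y (Suc m) \<in> \<Union>C" using S.cgenideal_self[of "y (Suc m)"] yD by (auto simp: C_def)
    then obtain a where a: "a \<in> D" "y (Suc m) = a \<otimes> y m" unfolding m by (auto simp: cgenideal_def)
    then have "\<one> \<otimes> y (Suc m) = (a \<otimes> t) \<otimes> y (Suc m)" using y_Suc[of m] yc tD car by (simp add: m_assoc)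
    then have "a \<otimes> t = \<one>" using m_rcancel[of "y (Suc m)" \<one> "a \<otimes> t"] y0[of "Suc m"] yc[of "Suc m"] car[OF a(1)] car[OF tD] by simp
    then show False using one a by (auto simp: cgenideal_def)
  qed
  \<comment> \<open>The last quotient inside D is not divisible by t, hence it is a unit.\<close>
  define n where "n = (LEAST n. y n \<notin> D)"
  have n: "y n \<notin> D" unfolding n_def using \<open>\<exists>n. y n \<notin> D\<close> by (rule LeastI_ex)
  have "y 0 = x" using xc by (simp add: y_def)
  then have "n \<noteq> 0" using n x by (intro notI) simp
  then obtain k where k: "n = Suc k" by (cases n) auto
  have yk: "y k \<in> D" using not_less_Least[of k "\<lambda>n. y n \<notin> D"] k n_def by auto
  have "y k \<notin> PIdl\<^bsub>?S\<^esub> t"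
  proof
    assume "y k \<in> PIdl\<^bsub>?S\<^esub> t"
    then obtain a where a: "a \<in> D" "y k = a \<otimes> t" by (auto simp: cgenideal_def)
    then have "t \<otimes> a = t \<otimes> y (Suc k)" using y_Suc[of k] tD car by (simp add: m_comm)
    then have "a = y (Suc k)" using m_lcancel[of t a "y (Suc k)"] t0 tD a yc car by simp
    then show False using n k a by simp
  qed
  then have "inv (y k) \<in> D \<and> y k \<noteq> \<zero>" using unit yk by blast
  then show "\<exists>n::nat. \<exists>u\<in>D. u \<noteq> \<zero> \<and> inv u \<in> D \<and> x = t [^] n \<otimes> u"
    using yk xy[of k] by blast
qed

text \<open>An element outside K is independent of 1, and two independent vectors span a space of
  dimension two.\<close>

lemma (in ring) dimension_2_span:
  assumes K: "subfield K R" and dim: "dimension 2 K (carrier R)"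
    and a: "a \<in> carrier R" "a \<notin> K" and x: "x \<in> carrier R"
  shows "\<exists>h\<in>K. \<exists>k\<in>K. x = h \<oplus> k \<otimes> a"
proof -
  have Kc: "k \<in> carrier R" if "k \<in> K" for k using subfieldE(3)[OF K] that by blast
  have span1: "Span K [\<one>] = K"
    using Kc by (force simp: line_extension_mem_iff)
  have "independent K []" by simp
  moreover have "\<one> \<notin> Span K []" using subfieldE(6)[OF K] by simp
  ultimately have "independent K [\<one>]" by (intro li_Cons) auto
  then have ind: "independent K [a, \<one>]" using a span1 subfieldE(6)[OF K] by (intro li_Cons) simp_all
  have "Span K [a, \<one>] = carrier R"
    using independent_length_eq_dimension[OF K dim ind] a by simp
  then have "x \<in> line_extension K a (Span K [\<one>])" using x by simp
  then show ?thesis unfolding span1 line_extension_mem_iff using a Kc by (auto simp: a_comm)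
qed

text \<open>Serves to refute the absence of a residue generator: D would then cover all residues and
  the residue extension would have degree one.\<close>

lemma residue_image_eq_carrier:
  assumes t: "t \<in> E" and cr: "cring (R\<lparr>carrier := E\<rparr>)" and D: "D \<subseteq> E"
    and cover: "\<And>x. x \<in> E \<Longrightarrow> \<exists>d\<in>D. x \<ominus>\<^bsub>R\<lparr>carrier := E\<rparr>\<^esub> d \<in> PIdl\<^bsub>R\<lparr>carrier := E\<rparr>\<^esub> t"
  shows "residue_image (R\<lparr>carrier := E\<rparr>) t D = carrier (residue_ring_at (R\<lparr>carrier := E\<rparr>) t)"
proof -
  let ?S = "R\<lparr>carrier := E\<rparr>"
  interpret S: cring ?S by (rule cr)
  interpret I: ideal "PIdl\<^bsub>?S\<^esub> t" ?S using S.cgenideal_ideal t by simp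
  have "carrier (residue_ring_at ?S t) = (\<lambda>x. PIdl\<^bsub>?S\<^esub> t +>\<^bsub>?S\<^esub> x) ` E"
    unfolding residue_ring_at_def FactRing_def A_RCOSETS_def RCOSETS_def a_r_coset_def by auto
  moreover have "PIdl\<^bsub>?S\<^esub> t +>\<^bsub>?S\<^esub> x \<in> residue_image ?S t D" if x: "x \<in> E" for x
  proof -
    obtain d where d: "d \<in> D" "x \<ominus>\<^bsub>?S\<^esub> d \<in> PIdl\<^bsub>?S\<^esub> t" using cover[OF x] by blast
    then have "PIdl\<^bsub>?S\<^esub> t +>\<^bsub>?S\<^esub> x = PIdl\<^bsub>?S\<^esub> t +>\<^bsub>?S\<^esub> d" using I.coset_eq_iff[of x d] x D by auto
    then show ?thesis using d by (auto simp: residue_image_def)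
  qed
  ultimately show ?thesis using D by (auto simp: residue_image_def)
qed

text \<open>No valuation function is introduced. Being unramified is expressed by the same
  \<open>t\<close> serving D and E in the two normal forms, and \<open>inv_t_notin_E\<close> makes
  the exponent unique.\<close>

locale dvr_pair = field R for R (structure) +
  fixes D E :: "'a set" and t :: 'a
  assumes D_subring: "subring D R"
    and E_subring: "subring E R"
    and D_subset_E: "D \<subseteq> E"
    and t_in_D: "t \<in> D"
    and t_nonzero: "t \<noteq> \<zero>"
    and inv_t_notin_E: "inv t \<notin> E"
    and D_val: "\<And>d. \<lbrakk>d \<in> D; d \<noteq> \<zero>\<rbrakk> \<Longrightarrow> \<exists>n::nat. \<exists>u\<in>D. u \<noteq> \<zero> \<and> inv u \<in> D \<and> d = t [^] n \<otimes> u"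
    and E_val: "\<And>x. \<lbrakk>x \<in> E; x \<noteq> \<zero>\<rbrakk> \<Longrightarrow> \<exists>n::nat. \<exists>u\<in>E. u \<noteq> \<zero> \<and> inv u \<in> E \<and> x = t [^] n \<otimes> u"
begin

text \<open>Membership means valuation at least n, with zero included without a special
  case.\<close>

definition P :: "nat \<Rightarrow> 'a set"
  where "P n = {t [^] n \<otimes> x | x. x \<in> E}"

text \<open>The elements of \<open>E\<close> whose residues generate the residue extension; this is the range of \<open>\<alpha>\<close>.\<close>

definition gens :: "'a set"
  where "gens = {\<alpha> \<in> E. \<forall>d\<in>D. \<alpha> \<ominus> d \<notin> P 1}"

definition submodule_D :: "'a set \<Rightarrow> bool"
  where "submodule_D M \<longleftrightarrow> M \<subseteq> E \<and> \<zero> \<in> M \<and> (\<forall>x\<in>M. \<forall>y\<in>M. x \<oplus> y \<in> M) \<and> (\<forall>d\<in>D. \<forall>x\<in>M. d \<otimes> x \<in> M)"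

lemma E_carrier [simp]: "x \<in> E \<Longrightarrow> x \<in> carrier R"
  using subringE(1)[OF E_subring] by blast

lemma D_E [simp]: "d \<in> D \<Longrightarrow> d \<in> E"
  using D_subset_E by blast

lemma D_carrier [simp]: "d \<in> D \<Longrightarrow> d \<in> carrier R"
  using E_carrier D_E by metis

lemmas D_closed [simp] = subringE(2,3,5-7)[OF D_subring]
lemmas E_closed [simp] = subringE(2,3,5-7)[OF E_subring]

lemma D_minus [simp]: "a \<in> D \<Longrightarrow> b \<in> D \<Longrightarrow> a \<ominus> b \<in> D"
  by (simp add: minus_eq)

lemma E_minus [simp]: "a \<in> E \<Longrightarrow> b \<in> E \<Longrightarrow> a \<ominus> b \<in> E"
  by (simp add: minus_eq)

lemma t_simps [simp]: "t \<in> D" "t \<noteq> \<zero>"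
  using t_in_D t_nonzero by auto

lemma tpow_D [simp]: "t [^] (n::nat) \<in> D"
  by (induction n) auto

lemma tpow_nonzero [simp]: "t [^] (n::nat) \<noteq> \<zero>"
  by (induction n) (auto simp: integral_iff)

lemma tpow_add: "t [^] (m + n) = t [^] m \<otimes> t [^] (n::nat)"
  by (simp add: nat_pow_mult)

lemma inv_inv_mult:
  assumes "u \<in> carrier R" "u \<noteq> \<zero>" "x \<in> carrier R"
  shows "inv u \<in> carrier R" "u \<otimes> (inv u \<otimes> x) = x" "inv u \<otimes> (u \<otimes> x) = x" "u \<otimes> inv u = \<one>" "inv u \<otimes> u = \<one>"
proof -
  have u: "u \<in> Units R" using assms field_Units by auto
  then show "inv u \<in> carrier R" "u \<otimes> inv u = \<one>" "inv u \<otimes> u = \<one>"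
    by auto
  then show "u \<otimes> (inv u \<otimes> x) = x" "inv u \<otimes> (u \<otimes> x) = x"
    using assms u by (auto simp: m_assoc[symmetric])
qed

lemma tpow_cancel:
  assumes "x \<in> carrier R" "y \<in> carrier R" "t [^] (n::nat) \<otimes> x = t [^] n \<otimes> y"
  shows "x = y"
  using assms m_lcancel[of "t [^] n" x y] by simp

lemma PI [simp, intro]: "x \<in> E \<Longrightarrow> t [^] n \<otimes> x \<in> P n"
  by (auto simp: P_def)

lemma PE:
  assumes "x \<in> P n"
  obtains y where "y \<in> E" "x = t [^] n \<otimes> y"
  using assms by (auto simp: P_def)

lemma P_E: "x \<in> P n \<Longrightarrow> x \<in> E"
  by (auto simp: P_def)

lemma P_0: "P 0 = E"
  by (force simp: P_def)

lemma P_zero [simp]: "\<zero> \<in> P n"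
  using PI[of \<zero> n] by simp

lemma P_mono:
  assumes "m \<le> n" "x \<in> P n" shows "x \<in> P m"
proof -
  obtain y where y: "y \<in> E" "x = t [^] n \<otimes> y" using assms PE by blast
  have "x = t [^] m \<otimes> (t [^] (n - m) \<otimes> y)"
    using y assms(1) tpow_add[of m "n - m"] by (simp add: m_assoc)
  then show ?thesis using PI[of "t [^] (n - m) \<otimes> y" m] y by auto
qed

lemma P_add [simp]: "x \<in> P n \<Longrightarrow> y \<in> P n \<Longrightarrow> x \<oplus> y \<in> P n"
proof -
  assume "x \<in> P n" "y \<in> P n"
  then obtain a b where "a \<in> E" "x = t [^] n \<otimes> a" "b \<in> E" "y = t [^] n \<otimes> b" by (auto simp: P_def)
  then have "x \<oplus> y = t [^] n \<otimes> (a \<oplus> b)" "a \<oplus> b \<in> E" by (auto simp: r_distr)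
  then show ?thesis using PI by metis
qed

lemma P_mult:
  assumes "x \<in> P m" "y \<in> P n" shows "x \<otimes> y \<in> P (m + n)"
proof -
  obtain a b where ab: "a \<in> E" "x = t [^] m \<otimes> a" "b \<in> E" "y = t [^] n \<otimes> b"
    using assms by (auto simp: P_def)
  have "x \<otimes> y = t [^] (m + n) \<otimes> (a \<otimes> b)"
    using ab by (simp add: tpow_add m_ac)
  then show ?thesis using PI[of "a \<otimes> b"] ab by auto
qed

lemma P_smult [simp]: "x \<in> E \<Longrightarrow> y \<in> P n \<Longrightarrow> x \<otimes> y \<in> P n"
  using P_mult[of x 0 y n] by (simp add: P_0)

lemma P_uminus [simp]: "x \<in> P n \<Longrightarrow> \<ominus> x \<in> P n"
  using P_smult[of "\<ominus> \<one>" x n] P_E[of x n] by (simp add: l_minus)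

lemma P_minus [simp]: "x \<in> P n \<Longrightarrow> y \<in> P n \<Longrightarrow> x \<ominus> y \<in> P n"
  by (simp add: minus_eq)

lemma tpow_mult_P_iff: "x \<in> carrier R \<Longrightarrow> t [^] m \<otimes> x \<in> P (m + n) \<longleftrightarrow> x \<in> P n"
proof
  assume x: "x \<in> carrier R" and "t [^] m \<otimes> x \<in> P (m + n)"
  then obtain y where y: "y \<in> E" "t [^] m \<otimes> x = t [^] (m + n) \<otimes> y" by (auto simp: P_def)
  then have "t [^] m \<otimes> x = t [^] m \<otimes> (t [^] n \<otimes> y)" by (simp add: tpow_add m_assoc)
  then have "x = t [^] n \<otimes> y" using tpow_cancel[of x "t [^] n \<otimes> y" m] x y by simp
  then show "x \<in> P n" using y by simp
next
  assume "x \<in> P n" then show "t [^] m \<otimes> x \<in> P (m + n)"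
    using P_mult[of "t [^] m" m x n] PI[of \<one> m] by auto
qed

text \<open>From u = t x one gets 1/t = x / u, which would lie in E.\<close>

lemma unit_notin_P1:
  assumes "u \<in> E" "u \<noteq> \<zero>" "inv u \<in> E" shows "u \<notin> P 1"
proof
  assume "u \<in> P 1"
  then obtain x where x: "x \<in> E" "u = t \<otimes> x" by (auto simp: P_def)
  have "inv t = inv t \<otimes> (u \<otimes> inv u)" using inv_inv_mult[of u u] inv_inv_mult[of t t] assms by simp
  also have "\<dots> = (inv t \<otimes> (t \<otimes> x)) \<otimes> inv u" using x assms inv_inv_mult(1)[of t t] by (simp add: m_assoc)
  also have "\<dots> = x \<otimes> inv u" using x inv_inv_mult(3)[of t x] by simp
  finally show False using x assms inv_t_notin_E by auto
qed

lemma E_unit: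
  assumes "x \<in> E" "x \<notin> P 1" shows "x \<noteq> \<zero>" "inv x \<in> E"
proof -
  show nz: "x \<noteq> \<zero>" using assms by auto
  obtain n u where u: "u \<in> E" "u \<noteq> \<zero>" "inv u \<in> E" "x = t [^] (n::nat) \<otimes> u"
    using E_val assms nz by metis
  have "x \<in> P n" using u by auto
  then have "n = 0" using assms P_mono[of 1 n x] by (cases n) auto
  then show "inv x \<in> E" using u by auto
qed

lemma D_unit:
  assumes "x \<in> D" "x \<notin> P 1" shows "x \<noteq> \<zero>" "inv x \<in> D"
proof -
  show nz: "x \<noteq> \<zero>" using assms by auto
  obtain n u where u: "u \<in> D" "u \<noteq> \<zero>" "inv u \<in> D" "x = t [^] (n::nat) \<otimes> u"
    using D_val assms nz by metis
  have "x \<in> P n" using u by auto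
  then have "n = 0" using assms P_mono[of 1 n x] by (cases n) auto
  then show "inv x \<in> D" using u by auto
qed

text \<open>The valuation of E restricts to that of D: a unit of D is a unit of E, so the exponent
  found in D cannot be improved in E.\<close>

lemma D_Int_P:
  assumes "d \<in> D" "d \<in> P n" shows "\<exists>c\<in>D. d = t [^] n \<otimes> c"
proof (cases "d = \<zero>")
  case True then show ?thesis by (intro bexI[of _ \<zero>]) auto
next
  case False
  obtain m u where u: "u \<in> D" "u \<noteq> \<zero>" "inv u \<in> D" "d = t [^] (m::nat) \<otimes> u"
    using D_val assms False by metis
  have "n \<le> m"
  proof (rule ccontr)
    assume "\<not> n \<le> m"
    then have "d \<in> P (m + 1)" using assms P_mono[of "m+1" n d] by auto
    then have "u \<in> P 1" using u tpow_mult_P_iff[of u m 1] by auto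
    then show False using unit_notin_P1[of u] u by auto
  qed
  then have "d = t [^] n \<otimes> (t [^] (m - n) \<otimes> u)"
    using u tpow_add[of n "m - n"] by (simp add: m_assoc)
  then show ?thesis using u by (intro bexI[of _ "t [^] (m - n) \<otimes> u"]) auto
qed

lemma P_separated:
  assumes "x \<in> E" "\<And>n. x \<in> P n" shows "x = \<zero>"
proof (rule ccontr)
  assume "x \<noteq> \<zero>"
  then obtain m u where u: "u \<in> E" "u \<noteq> \<zero>" "inv u \<in> E" "x = t [^] (m::nat) \<otimes> u"
    using E_val assms by metis
  have "u \<in> P 1" using assms(2)[of "m + 1"] u tpow_mult_P_iff[of u m 1] by auto
  then show False using unit_notin_P1 u by auto
qed

lemma gens_E: "\<alpha> \<in> gens \<Longrightarrow> \<alpha> \<in> E"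
  by (simp add: gens_def)

text \<open>If b were a unit, \<alpha> would be congruent to -a/b in D modulo t, against the choice
  of \<alpha>.\<close>

lemma gens_indep:
  assumes al: "\<alpha> \<in> gens" and ab: "a \<in> D" "b \<in> D" and P: "a \<oplus> b \<otimes> \<alpha> \<in> P 1"
  shows "a \<in> P 1 \<and> b \<in> P 1"
proof -
  have E: "\<alpha> \<in> E" using al gens_E by auto
  have b: "b \<in> P 1"
  proof (rule ccontr)
    assume "b \<notin> P 1"
    then have bu: "b \<noteq> \<zero>" "inv b \<in> D" using D_unit ab by auto
    have "inv b \<otimes> (a \<oplus> b \<otimes> \<alpha>) \<in> P 1" using P bu by auto
    also have "inv b \<otimes> (a \<oplus> b \<otimes> \<alpha>) = inv b \<otimes> a \<oplus> inv b \<otimes> (b \<otimes> \<alpha>)"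
      using ab E bu by (simp add: r_distr)
    also have "inv b \<otimes> (b \<otimes> \<alpha>) = \<alpha>" using inv_inv_mult[of b \<alpha>] ab E bu by auto
    also have "inv b \<otimes> a \<oplus> \<alpha> = \<alpha> \<ominus> (\<ominus> (inv b \<otimes> a))" using ab E bu by (simp add: minus_eq a_comm)
    finally show False using al ab bu unfolding gens_def by auto
  qed
  then have "b \<otimes> \<alpha> \<in> P 1" using P_smult[of \<alpha> b 1] E ab by (simp add: m_comm)
  then have "(a \<oplus> b \<otimes> \<alpha>) \<ominus> b \<otimes> \<alpha> \<in> P 1" using P by auto
  also have "(a \<oplus> b \<otimes> \<alpha>) \<ominus> b \<otimes> \<alpha> = a" using ab E by (simp add: minus_eq a_assoc r_neg)
  finally show ?thesis using b by auto
qed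

text \<open>Independence modulo t lets both coefficients be divided by t; iterating gives that the
  valuation of a + b \<alpha> is the smaller of the two.\<close>

lemma gens_indep_P:
  assumes al: "\<alpha> \<in> gens"
  shows "a \<in> D \<Longrightarrow> b \<in> D \<Longrightarrow> a \<oplus> b \<otimes> \<alpha> \<in> P n \<Longrightarrow> a \<in> P n \<and> b \<in> P n"
proof (induction n arbitrary: a b)
  case 0 then show ?case by (auto simp: P_0)
next
  case (Suc n)
  have E: "\<alpha> \<in> E" using al gens_E by auto
  have "a \<oplus> b \<otimes> \<alpha> \<in> P 1" using Suc.prems P_mono[of 1 "Suc n"] by auto
  then have "a \<in> P 1" "b \<in> P 1" using gens_indep[OF al, of a b] Suc.prems by simp_all
  then obtain a' b' where *: "a' \<in> D" "b' \<in> D" "a = t [^] (1::nat) \<otimes> a'" "b = t [^] (1::nat) \<otimes> b'"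
    using D_Int_P Suc.prems by meson
  then have "t [^] (1::nat) \<otimes> (a' \<oplus> b' \<otimes> \<alpha>) = a \<oplus> b \<otimes> \<alpha>" using E by (simp add: r_distr m_assoc)
  then have "t [^] (1::nat) \<otimes> (a' \<oplus> b' \<otimes> \<alpha>) \<in> P (1 + n)" using Suc.prems by simp
  then have "a' \<oplus> b' \<otimes> \<alpha> \<in> P n" using tpow_mult_P_iff[of "a' \<oplus> b' \<otimes> \<alpha>" 1 n] * E by auto
  then have "a' \<in> P n" "b' \<in> P n" using Suc.IH[of a' b'] * by simp_all
  then show ?case using * tpow_mult_P_iff[of a' 1 n] tpow_mult_P_iff[of b' 1 n] by simp
qed

definition xi :: "nat \<Rightarrow> 'a \<Rightarrow> 'a"
  where "xi q \<alpha> = \<one> \<oplus> t [^] q \<otimes> \<alpha>"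

text \<open>The coefficient 1 is not divisible by t, so independence makes this a unit even for q =
  0, where t^q \<alpha> does not vanish modulo t.\<close>

lemma xi_props:
  assumes "\<alpha> \<in> gens"
  shows "xi q \<alpha> \<in> E" "xi q \<alpha> \<noteq> \<zero>" "inv (xi q \<alpha>) \<in> E"
proof -
  have E: "\<alpha> \<in> E" using assms gens_E by auto
  show xE: "xi q \<alpha> \<in> E" using E by (auto simp: xi_def)
  have "xi q \<alpha> \<notin> P 1"
  proof
    assume "xi q \<alpha> \<in> P 1"
    then have "\<one> \<in> P 1" using gens_indep[OF assms, of \<one> "t [^] q"] by (auto simp: xi_def)
    then show False using unit_notin_P1[of \<one>] by auto
  qed
  then show "xi q \<alpha> \<noteq> \<zero>" "inv (xi q \<alpha>) \<in> E" using E_unit xE by auto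
qed

lemma xi_square:
  assumes "\<alpha> \<in> E"
  shows "xi q \<alpha> \<otimes> xi q \<alpha> = xi q \<alpha> \<oplus> t [^] q \<otimes> (\<alpha> \<otimes> xi q \<alpha>)"
  using assms unfolding xi_def by (simp add: l_distr m_assoc)

text \<open>Dividing by the unit \<xi> leaves the case of 1 and \<alpha>.\<close>

lemma xi_indep_P:
  assumes al: "\<alpha> \<in> gens" and ab: "a \<in> D" "b \<in> D" "a \<otimes> xi q \<alpha> \<oplus> b \<otimes> (\<alpha> \<otimes> xi q \<alpha>) \<in> P n"
  shows "a \<in> P n \<and> b \<in> P n"
proof -
  let ?x = "xi q \<alpha>"
  note x = xi_props[OF al, of q]
  have E: "\<alpha> \<in> E" using al gens_E by auto
  have car: "\<alpha> \<in> carrier R" "a \<in> carrier R" "b \<in> carrier R" "?x \<in> carrier R" "inv ?x \<in> carrier R"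
    using E ab x by auto
  have "inv ?x \<otimes> (a \<otimes> ?x \<oplus> b \<otimes> (\<alpha> \<otimes> ?x)) \<in> P n" using ab x by auto
  also have "inv ?x \<otimes> (a \<otimes> ?x \<oplus> b \<otimes> (\<alpha> \<otimes> ?x)) = inv ?x \<otimes> (?x \<otimes> (a \<oplus> b \<otimes> \<alpha>))"
    using car by algebra
  also have "\<dots> = a \<oplus> b \<otimes> \<alpha>" using x E ab by (intro inv_inv_mult(3)) auto
  finally show ?thesis using gens_indep_P[OF al ab(1,2)] by blast
qed

lemma xi_indep:
  assumes al: "\<alpha> \<in> gens" and ab: "a \<in> D" "b \<in> D" "a \<otimes> xi q \<alpha> \<oplus> b \<otimes> (\<alpha> \<otimes> xi q \<alpha>) = \<zero>"
  shows "a = \<zero> \<and> b = \<zero>"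
  using xi_indep_P[OF al ab(1,2), of q] ab P_separated by simp

end

section \<open>Multiplicatively closed submodules\<close>

locale unramified_pair = dvr_pair +
  assumes gens_span: "\<And>\<alpha> x. \<lbrakk>\<alpha> \<in> gens; x \<in> E\<rbrakk> \<Longrightarrow> \<exists>a\<in>D. \<exists>b\<in>D. x = a \<oplus> b \<otimes> \<alpha>"
    and gens_nonempty: "gens \<noteq> {}"
begin

lemma unit_span:
  assumes al: "\<alpha> \<in> gens" and u: "u \<in> E" "u \<noteq> \<zero>" "inv u \<in> E" and x: "x \<in> E"
  shows "\<exists>a\<in>D. \<exists>b\<in>D. x = a \<otimes> u \<oplus> b \<otimes> (\<alpha> \<otimes> u)"
proof -
  obtain a b where ab: "a \<in> D" "b \<in> D" "inv u \<otimes> x = a \<oplus> b \<otimes> \<alpha>"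
    using gens_span[OF al, of "inv u \<otimes> x"] u x by auto
  have car: "\<alpha> \<in> carrier R" "a \<in> carrier R" "b \<in> carrier R" "u \<in> carrier R"
    using gens_E[OF al] ab u by auto
  have "x = u \<otimes> (a \<oplus> b \<otimes> \<alpha>)" using inv_inv_mult(2)[of u x] u x ab by simp
  also have "\<dots> = a \<otimes> u \<oplus> b \<otimes> (\<alpha> \<otimes> u)" using car by algebra
  finally show ?thesis using ab by blast
qed

lemma submoduleD:
  assumes "submodule_D M"
  shows "\<And>x. x \<in> M \<Longrightarrow> x \<in> E" "\<zero> \<in> M" "\<And>x y. x \<in> M \<Longrightarrow> y \<in> M \<Longrightarrow> x \<oplus> y \<in> M"
    "\<And>d x. d \<in> D \<Longrightarrow> x \<in> M \<Longrightarrow> d \<otimes> x \<in> M" "\<And>x. x \<in> M \<Longrightarrow> \<ominus> x \<in> M"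
    "\<And>x y. x \<in> M \<Longrightarrow> y \<in> M \<Longrightarrow> x \<ominus> y \<in> M"
proof -
  show *: "\<And>x. x \<in> M \<Longrightarrow> x \<in> E" "\<zero> \<in> M" "\<And>x y. x \<in> M \<Longrightarrow> y \<in> M \<Longrightarrow> x \<oplus> y \<in> M"
    "\<And>d x. d \<in> D \<Longrightarrow> x \<in> M \<Longrightarrow> d \<otimes> x \<in> M"
    using assms by (auto simp: submodule_D_def)
  show m: "\<ominus> x \<in> M" if "x \<in> M" for x
    using *(4)[of "\<ominus> \<one>" x] *(1)[OF that] that by (simp add: l_minus)
  show "x \<ominus> y \<in> M" if "x \<in> M" "y \<in> M" for x y
    using *(3) m that by (simp add: minus_eq)
qed

text \<open>Since u and \<alpha> u generate E over D, two membership tests decide that a whole ideal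
  lies in M.\<close>

lemma P_subset_of_generators:
  assumes M: "submodule_D M" and al: "\<alpha> \<in> gens" and u: "u \<in> E" "u \<noteq> \<zero>" "inv u \<in> E"
    and gens: "t [^] (n::nat) \<otimes> u \<in> M" "t [^] n \<otimes> (\<alpha> \<otimes> u) \<in> M"
  shows "P n \<subseteq> M"
proof
  fix x assume "x \<in> P n"
  then obtain y where y: "y \<in> E" "x = t [^] n \<otimes> y" by (rule PE)
  obtain a b where ab: "a \<in> D" "b \<in> D" "y = a \<otimes> u \<oplus> b \<otimes> (\<alpha> \<otimes> u)"
    using unit_span[OF al u y(1)] by blast
  have car: "\<alpha> \<in> carrier R" "a \<in> carrier R" "b \<in> carrier R" "u \<in> carrier R" "t [^] n \<in> carrier R"
    using gens_E[OF al] ab u by auto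
  have "x = a \<otimes> (t [^] n \<otimes> u) \<oplus> b \<otimes> (t [^] n \<otimes> (\<alpha> \<otimes> u))"
    unfolding y(2) ab(3) using car by algebra
  then show "x \<in> M" using submoduleD[OF M] ab gens by simp
qed

text \<open>Write x = a t^k u + b t^k \<alpha> u. If b = t^j v with v a unit, dividing the second
  summand by v puts t^(k+j) \<alpha> u into M, and t^(k+j) u is there already, so
  \<open>P (k + j)\<close> lies in M. The alternative \<open>y = \<zero>\<close> covers b = 0 and
  keeps the statement usable when M contains no such ideal.\<close>

lemma absorb_second_generator:
  assumes M: "submodule_D M" and al: "\<alpha> \<in> gens" and u: "u \<in> E" "u \<noteq> \<zero>" "inv u \<in> E"
    and ku: "t [^] (k::nat) \<otimes> u \<in> M" and x: "x \<in> M" "x \<in> P k"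
  shows "\<exists>a\<in>D. \<exists>y. x = a \<otimes> (t [^] k \<otimes> u) \<oplus> y \<and> (y = \<zero> \<or> (\<exists>s. y \<in> P s \<and> P s \<subseteq> M))"
proof -
  obtain z where z: "z \<in> E" "x = t [^] k \<otimes> z" using x by (auto elim: PE)
  obtain a b where ab: "a \<in> D" "b \<in> D" "z = a \<otimes> u \<oplus> b \<otimes> (\<alpha> \<otimes> u)"
    using unit_span[OF al u z(1)] by blast
  have car: "\<alpha> \<in> carrier R" "a \<in> carrier R" "b \<in> carrier R" "u \<in> carrier R" "t [^] k \<in> carrier R"
    using gens_E[OF al] ab u by auto
  define y where "y = b \<otimes> (t [^] k \<otimes> (\<alpha> \<otimes> u))"
  have x_eq: "x = a \<otimes> (t [^] k \<otimes> u) \<oplus> y"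
    unfolding z(2) ab(3) y_def using car by algebra
  have "y = x \<ominus> a \<otimes> (t [^] k \<otimes> u)"
    unfolding x_eq y_def using car by algebra
  then have yM: "y \<in> M" using submoduleD[OF M] x ku ab by simp
  have "y = \<zero> \<or> (\<exists>s. y \<in> P s \<and> P s \<subseteq> M)"
  proof (cases "b = \<zero>")
    case True then show ?thesis using car by (simp add: y_def)
  next
    case False
    then obtain j v where v: "v \<in> D" "v \<noteq> \<zero>" "inv v \<in> D" "b = t [^] (j::nat) \<otimes> v"
      using D_val ab by metis
    have vc: "v \<in> carrier R" "t [^] j \<in> carrier R" using v by auto
    have y2: "y = v \<otimes> (t [^] (k + j) \<otimes> (\<alpha> \<otimes> u))"
      unfolding y_def v(4) tpow_add using car vc by algebra
    have "inv v \<otimes> y \<in> M" using submoduleD[OF M] yM v by simp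
    then have "t [^] (k + j) \<otimes> (\<alpha> \<otimes> u) \<in> M"
      using inv_inv_mult(3)[of v "t [^] (k + j) \<otimes> (\<alpha> \<otimes> u)"] v car y2 by simp
    moreover have "t [^] (k + j) \<otimes> u \<in> M"
    proof -
      have "t [^] (k + j) \<otimes> u = t [^] j \<otimes> (t [^] k \<otimes> u)" unfolding tpow_add using car vc by algebra
      then show ?thesis using submoduleD[OF M] ku by simp
    qed
    ultimately have "P (k + j) \<subseteq> M" using P_subset_of_generators[OF M al u] by blast
    moreover have "y \<in> P (k + j)" unfolding y2 using v gens_E[OF al] u by simp
    ultimately show ?thesis by blast
  qed
  then show ?thesis using x_eq ab by blast
qed

lemma primitive_element:
  assumes "M \<subseteq> E" "\<not> M \<subseteq> P n"
  shows "\<exists>k<n. \<exists>u\<in>E. u \<noteq> \<zero> \<and> inv u \<in> E \<and> t [^] k \<otimes> u \<in> M \<and> M \<subseteq> P k"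
proof -
  \<comment> \<open>The minimal valuation k on M is one less than the first m with M not inside
    \<open>P m\<close>.\<close>
  define m where "m = (LEAST m. \<not> M \<subseteq> P m)"
  have m: "\<not> M \<subseteq> P m" unfolding m_def using assms(2) by (rule LeastI)
  have mn: "m \<le> n" unfolding m_def using assms(2) by (rule Least_le)
  have "m \<noteq> 0" using m assms by (metis P_0)
  then obtain k where k: "m = k + 1" by (cases m) auto
  have Mk: "M \<subseteq> P k" using not_less_Least[of k "\<lambda>m. \<not> M \<subseteq> P m"] k m_def by auto
  obtain x where x: "x \<in> M" "x \<notin> P (k + 1)" using m k by blast
  then obtain u where u: "u \<in> E" "x = t [^] k \<otimes> u" using Mk by (auto elim: PE)
  then have "u \<notin> P 1" using x tpow_mult_P_iff[of u k 1] by auto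
  then show ?thesis using u x Mk k mn E_unit[of u] by (intro exI[of _ k]) auto
qed

text \<open>If no \<open>P m\<close> fits into M, the remainder in
  \<open>absorb_second_generator\<close> is always zero, so an element of least valuation generates
  M.\<close>

lemma submodule_dichotomy:
  assumes M: "submodule_D M"
  shows "(\<exists>m. P m \<subseteq> M) \<or> (\<exists>z\<in>M. \<forall>x\<in>M. \<exists>d\<in>D. x = d \<otimes> z)"
proof (cases "M = {\<zero>}")
  case True
  then show ?thesis using D_closed(1) by (intro disjI2 bexI[of _ \<zero>]) (auto intro: exI[of _ \<zero>])
next
  case False
  then obtain w where w: "w \<in> M" "w \<noteq> \<zero>" using submoduleD(2)[OF M] by blast
  then obtain n where "w \<notin> P n" using P_separated submoduleD(1)[OF M] by blast
  then obtain k u where u: "u \<in> E" "u \<noteq> \<zero>" "inv u \<in> E" "t [^] (k::nat) \<otimes> u \<in> M" "M \<subseteq> P k"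
    using primitive_element[of M n] submoduleD(1)[OF M] w by blast
  obtain \<alpha> where al: "\<alpha> \<in> gens" using gens_nonempty by blast
  show ?thesis
  proof (cases "\<exists>m. P m \<subseteq> M")
    case False
    have "\<exists>d\<in>D. x = d \<otimes> (t [^] k \<otimes> u)" if "x \<in> M" for x
      using absorb_second_generator[OF M al u(1-4) that] u(1,5) that False by auto
    then show ?thesis using u by blast
  qed auto
qed

text \<open>Normalizes a unit x = a + b \<beta> by a unit of D. Which coefficient is divisible by t,
  and how far, determines q.\<close>

lemma xi_approx:
  assumes x: "x \<in> E" "x \<notin> P 1"
  shows "\<exists>q\<le>n. \<exists>u\<in>D. \<exists>\<alpha>\<in>gens. u \<noteq> \<zero> \<and> inv u \<in> D \<and> x \<ominus> u \<otimes> xi q \<alpha> \<in> P n"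
proof -
  obtain \<beta> where be: "\<beta> \<in> gens" using gens_nonempty by blast
  then have bE: "\<beta> \<in> E" by (rule gens_E)
  obtain a b where ab: "a \<in> D" "b \<in> D" "x = a \<oplus> b \<otimes> \<beta>" using gens_span[OF be x(1)] by blast
  show ?thesis
  proof (cases "a \<in> P 1")
    case True
    have bP: "b \<notin> P 1"
    proof
      assume "b \<in> P 1"
      then have "b \<otimes> \<beta> \<in> P 1" using P_smult[of \<beta> b 1] bE ab by (simp add: m_comm)
      then show False using x ab True by simp
    qed
    \<comment> \<open>Here a vanishes modulo t and b is a unit, so x - 1 is a residue generator and
      x = \<open>xi 0 \<alpha>\<close> exactly.\<close>
    define \<alpha> where "\<alpha> = x \<ominus> \<one>"
    have "\<alpha> \<in> gens"
      unfolding gens_def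
    proof (intro CollectI conjI ballI)
      show "\<alpha> \<in> E" using x by (simp add: \<alpha>_def)
      fix d assume d: "d \<in> D"
      have car: "a \<in> carrier R" "b \<in> carrier R" "\<beta> \<in> carrier R" "d \<in> carrier R"
        using ab bE d by auto
      show "\<alpha> \<ominus> d \<notin> P 1"
      proof
        assume "\<alpha> \<ominus> d \<in> P 1"
        moreover have "\<alpha> \<ominus> d = (a \<ominus> \<one> \<ominus> d) \<oplus> b \<otimes> \<beta>"
          unfolding \<alpha>_def ab(3) using car by algebra
        ultimately show False using gens_indep[OF be, of "a \<ominus> \<one> \<ominus> d" b] ab d bP by simp
      qed
    qed
    moreover have "x \<ominus> \<one> \<otimes> xi 0 \<alpha> = \<zero>"
    proof -
      have "x \<in> carrier R" using x by auto
      then show ?thesis unfolding xi_def \<alpha>_def nat_pow_0 by algebra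
    qed
    ultimately show ?thesis by (intro exI[of _ 0] conjI bexI[of _ \<one>] bexI[of _ \<alpha>]) auto
  next
    case False
    then have a: "a \<noteq> \<zero>" "inv a \<in> D" using D_unit ab by auto
    show ?thesis
    \<comment> \<open>The precision n enters here: if b vanishes modulo t^n, then q = n works with
      \<beta> itself; otherwise the valuation of b is the exact q.\<close>
    proof (cases "b \<in> P n")
      case True
      have car: "a \<in> carrier R" "b \<in> carrier R" "\<beta> \<in> carrier R" "t [^] n \<in> carrier R"
        using ab bE by auto
      have "x \<ominus> a \<otimes> xi n \<beta> = b \<otimes> \<beta> \<ominus> t [^] n \<otimes> (a \<otimes> \<beta>)"
        unfolding ab(3) xi_def using car by algebra
      moreover have "b \<otimes> \<beta> \<in> P n" using P_smult[of \<beta> b n] bE ab True by (simp add: m_comm)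
      ultimately have "x \<ominus> a \<otimes> xi n \<beta> \<in> P n" using ab bE by simp
      then show ?thesis using a ab be by blast
    next
      case b: False
      then have "b \<noteq> \<zero>" by auto
      then obtain q v where v: "v \<in> D" "v \<noteq> \<zero>" "inv v \<in> D" "b = t [^] (q::nat) \<otimes> v"
        using D_val ab by metis
      have "b \<in> P q" using v by simp
      then have q: "q \<le> n" using b P_mono[of n q b] by linarith
      \<comment> \<open>From x = a (1 + t^q v \<beta> / a); the factor v / a is a unit of D, so the
        residue still generates.\<close>
      define \<alpha> where "\<alpha> = inv a \<otimes> (v \<otimes> \<beta>)"
      have car: "a \<in> carrier R" "inv a \<in> carrier R" "v \<in> carrier R" "\<beta> \<in> carrier R" "t [^] q \<in> carrier R"
        using ab bE v a by auto
      have "\<alpha> \<in> gens"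
        unfolding gens_def
      proof (intro CollectI conjI ballI)
        show "\<alpha> \<in> E" using a v bE by (simp add: \<alpha>_def)
        fix d assume d: "d \<in> D"
        have dc: "d \<in> carrier R" using d by auto
        show "\<alpha> \<ominus> d \<notin> P 1"
        proof
          assume "\<alpha> \<ominus> d \<in> P 1"
          moreover have "\<alpha> \<ominus> d = (\<ominus> d) \<oplus> (inv a \<otimes> v) \<otimes> \<beta>"
            unfolding \<alpha>_def using car dc by algebra
          ultimately have "inv a \<otimes> v \<in> P 1" using gens_indep[OF be, of "\<ominus> d" "inv a \<otimes> v"] a v d by simp
          then have "a \<otimes> (inv a \<otimes> v) \<in> P 1" using ab by simp
          then show False using inv_inv_mult(2)[of a v] car a unit_notin_P1[of v] v by simp
        qed
      qed
      moreover have "x \<ominus> a \<otimes> xi q \<alpha> = \<zero>"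
      proof -
        have "a \<otimes> xi q \<alpha> = a \<oplus> t [^] q \<otimes> (a \<otimes> (inv a \<otimes> (v \<otimes> \<beta>)))"
          unfolding xi_def \<alpha>_def using car by algebra
        also have "a \<otimes> (inv a \<otimes> (v \<otimes> \<beta>)) = v \<otimes> \<beta>" using inv_inv_mult(2)[of a "v \<otimes> \<beta>"] car a by simp
        finally have "a \<otimes> xi q \<alpha> = x" unfolding ab(3) v(4) using car by (simp add: m_assoc)
        then show ?thesis using x by (simp add: minus_eq r_neg)
      qed
      ultimately show ?thesis using q a ab by (metis P_zero)
    qed
  qed
qed

text \<open>The module \<open>t\<^sup>j \<xi> D + t\<^sup>s E\<close>.\<close>

definition std_mod :: "nat \<Rightarrow> nat \<Rightarrow> 'a \<Rightarrow> nat \<Rightarrow> 'a set"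
  where "std_mod j q \<alpha> s = {t [^] j \<otimes> xi q \<alpha> \<otimes> d \<oplus> y | d y. d \<in> D \<and> y \<in> P s}"

lemma std_mod_I:
  assumes "\<alpha> \<in> gens" "d \<in> D" "y \<in> P s"
  shows "d \<otimes> (t [^] j \<otimes> xi q \<alpha>) \<oplus> y \<in> std_mod j q \<alpha> s"
proof -
  have "d \<otimes> (t [^] j \<otimes> xi q \<alpha>) = t [^] j \<otimes> xi q \<alpha> \<otimes> d" using assms xi_props by (simp add: m_comm)
  then show ?thesis unfolding std_mod_def using assms by auto
qed

lemma std_mod_E:
  assumes "x \<in> std_mod j q \<alpha> s" "\<alpha> \<in> gens"
  obtains d y where "d \<in> D" "y \<in> P s" "x = d \<otimes> (t [^] j \<otimes> xi q \<alpha>) \<oplus> y"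
proof -
  obtain d y where "d \<in> D" "y \<in> P s" "x = t [^] j \<otimes> xi q \<alpha> \<otimes> d \<oplus> y" using assms(1) by (auto simp: std_mod_def)
  moreover have "t [^] j \<otimes> xi q \<alpha> \<otimes> d = d \<otimes> (t [^] j \<otimes> xi q \<alpha>)"
    using assms xi_props \<open>d \<in> D\<close> by (simp add: m_comm)
  ultimately show thesis using that by metis
qed

theorem classify_multiplicative_submodules:
  assumes M: "submodule_D M" and mult: "\<And>x y. x \<in> M \<Longrightarrow> y \<in> M \<Longrightarrow> x \<otimes> y \<in> M" and Pm: "P m \<subseteq> M"
  shows "\<exists>k l q. \<exists>\<alpha>\<in>gens. k + 2 * l + q \<le> m \<and> M = std_mod (k + l) q \<alpha> (k + 2 * l + q)"
proof -
  define s where "s = (LEAST s. P s \<subseteq> M)"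
  have Ps: "P s \<subseteq> M" unfolding s_def using Pm by (rule LeastI)
  have s_least: "s \<le> n" if "P n \<subseteq> M" for n unfolding s_def using that by (rule Least_le)
  \<comment> \<open>This ensures k \<le> s, so the natural-number subtraction s - k below is
    genuine.\<close>
  have "t [^] s \<in> M" using Ps PI[of \<one> s] by auto
  moreover have "t [^] s \<notin> P (s + 1)"
    using tpow_mult_P_iff[of \<one> s 1] unit_notin_P1[of \<one>] by auto
  ultimately obtain k w where w: "k < s + 1" "w \<in> E" "w \<noteq> \<zero>" "inv w \<in> E" "t [^] k \<otimes> w \<in> M" "M \<subseteq> P k"
    using primitive_element[of M "s + 1"] submoduleD(1)[OF M] by blast
  \<comment> \<open>Precision s - k is enough: multiplied by t^k the error lies in
    \<open>P s\<close>, hence in M.\<close>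
  obtain q u \<alpha> where q: "q \<le> s - k" "u \<in> D" "\<alpha> \<in> gens" "u \<noteq> \<zero>" "inv u \<in> D" "w \<ominus> u \<otimes> xi q \<alpha> \<in> P (s - k)"
    using xi_approx[of w "s - k"] w unit_notin_P1[of w] by blast
  note xi = xi_props[OF q(3), of q]
  have ks: "k + (s - k) = s" using w by simp
  have car: "w \<in> carrier R" "u \<in> carrier R" "xi q \<alpha> \<in> carrier R" "t [^] k \<in> carrier R" "\<alpha> \<in> carrier R" "t [^] q \<in> carrier R"
    using w q xi gens_E[OF q(3)] by auto
  have xiM: "t [^] k \<otimes> xi q \<alpha> \<in> M"
  proof -
    have "t [^] k \<otimes> (w \<ominus> u \<otimes> xi q \<alpha>) \<in> P s" using tpow_mult_P_iff[of "w \<ominus> u \<otimes> xi q \<alpha>" k "s - k"] q car ks by simp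
    then have "t [^] k \<otimes> w \<ominus> t [^] k \<otimes> (w \<ominus> u \<otimes> xi q \<alpha>) \<in> M" using Ps w submoduleD(6)[OF M] by blast
    also have "t [^] k \<otimes> w \<ominus> t [^] k \<otimes> (w \<ominus> u \<otimes> xi q \<alpha>) = u \<otimes> (t [^] k \<otimes> xi q \<alpha>)"
      using car by algebra
    finally have "inv u \<otimes> (u \<otimes> (t [^] k \<otimes> xi q \<alpha>)) \<in> M" using submoduleD(4)[OF M] q by blast
    then show ?thesis using inv_inv_mult(3)[of u "t [^] k \<otimes> xi q \<alpha>"] car q by simp
  qed
  have eq: "M = std_mod k q \<alpha> s"
  proof
    show "std_mod k q \<alpha> s \<subseteq> M"
    proof
      fix x assume "x \<in> std_mod k q \<alpha> s"
      then obtain d y where "d \<in> D" "y \<in> P s" "x = d \<otimes> (t [^] k \<otimes> xi q \<alpha>) \<oplus> y" using std_mod_E q by metis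
      then show "x \<in> M" using submoduleD(3,4)[OF M] xiM Ps by auto
    qed
    show "M \<subseteq> std_mod k q \<alpha> s"
    proof
      fix x assume x: "x \<in> M"
      then obtain a y where a: "a \<in> D" "x = a \<otimes> (t [^] k \<otimes> xi q \<alpha>) \<oplus> y" "y = \<zero> \<or> (\<exists>s. y \<in> P s \<and> P s \<subseteq> M)"
        using absorb_second_generator[OF M q(3) xi xiM x] w by blast
      then have "y \<in> P s" using s_least P_mono P_zero by metis
      then show "x \<in> std_mod k q \<alpha> s" using std_mod_I q a by auto
    qed
  qed
  \<comment> \<open>By minimality of s it suffices that \<open>P (2 * k + q)\<close> lies in M. The
    square of t^k \<xi> minus t^k times itself is exactly the second generator of that
    ideal.\<close>
  have "s \<le> 2 * k + q"
  proof (rule s_least, rule P_subset_of_generators[OF M q(3) xi])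
    have e: "t [^] (2 * k + q) = t [^] q \<otimes> (t [^] k \<otimes> t [^] k)" 
      using tpow_add[of q "k + k"] tpow_add[of k k] by (simp add: mult_2 add.commute)
    have "t [^] (2 * k + q) \<otimes> xi q \<alpha> = (t [^] q \<otimes> t [^] k) \<otimes> (t [^] k \<otimes> xi q \<alpha>)"
      unfolding e using car by algebra
    then show "t [^] (2 * k + q) \<otimes> xi q \<alpha> \<in> M" using submoduleD(4)[OF M] xiM by simp
    have "(t [^] k \<otimes> xi q \<alpha>) \<otimes> (t [^] k \<otimes> xi q \<alpha>) = t [^] k \<otimes> t [^] k \<otimes> (xi q \<alpha> \<otimes> xi q \<alpha>)"
      using car by algebra
    also have "xi q \<alpha> \<otimes> xi q \<alpha> = xi q \<alpha> \<oplus> t [^] q \<otimes> (\<alpha> \<otimes> xi q \<alpha>)" using xi_square gens_E q by blast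
    finally have "t [^] (2 * k + q) \<otimes> (\<alpha> \<otimes> xi q \<alpha>) =
        (t [^] k \<otimes> xi q \<alpha>) \<otimes> (t [^] k \<otimes> xi q \<alpha>) \<ominus> t [^] k \<otimes> (t [^] k \<otimes> xi q \<alpha>)"
      unfolding e using car by algebra
    then show "t [^] (2 * k + q) \<otimes> (\<alpha> \<otimes> xi q \<alpha>) \<in> M"
      using mult submoduleD(4,6)[OF M] xiM by simp
  qed
  \<comment> \<open>Solves k = k' + l and s = k' + 2 l + q for the new exponents. Nonnegativity of l
    is q \<le> s - k, and that of k' = k - l is s \<le> 2 k + q.\<close>
  define l where "l = s - k - q"
  have "k = (k - l) + l" "s = (k - l) + 2 * l + q" "s \<le> m"
    using \<open>s \<le> 2 * k + q\<close> q(1) w(1) s_least[OF Pm] unfolding l_def by auto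
  then show ?thesis using eq q(3) by metis
qed

lemma std_mod_submodule:
  assumes al: "\<alpha> \<in> gens"
  shows "submodule_D (std_mod j q \<alpha> s)"
  unfolding submodule_D_def
proof (intro conjI ballI subsetI)
  let ?g = "t [^] j \<otimes> xi q \<alpha>"
  have g: "?g \<in> E" using xi_props[OF al] by simp
  show "x \<in> E" if x: "x \<in> std_mod j q \<alpha> s" for x
    using x al
  proof (rule std_mod_E)
    fix d y assume "d \<in> D" "y \<in> P s" "x = d \<otimes> ?g \<oplus> y"
    then show "x \<in> E" using g P_E by simp
  qed
  show "\<zero> \<in> std_mod j q \<alpha> s" using std_mod_I[OF al, of \<zero> \<zero> s j q] g by simp
next
  let ?g = "t [^] j \<otimes> xi q \<alpha>"
  have g: "?g \<in> E" "?g \<in> carrier R" using xi_props[OF al] by simp_all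
  fix x x' assume x: "x \<in> std_mod j q \<alpha> s" "x' \<in> std_mod j q \<alpha> s"
  obtain d y where d: "d \<in> D" "y \<in> P s" "x = d \<otimes> ?g \<oplus> y" using x al by (auto elim: std_mod_E)
  obtain d' y' where d': "d' \<in> D" "y' \<in> P s" "x' = d' \<otimes> ?g \<oplus> y'" using x al by (auto elim: std_mod_E)
  have car: "d \<in> carrier R" "d' \<in> carrier R" "y \<in> carrier R" "y' \<in> carrier R"
    using d d' P_E by auto
  have "x \<oplus> x' = (d \<oplus> d') \<otimes> ?g \<oplus> (y \<oplus> y')" unfolding d(3) d'(3) using car g(2) by algebra
  then show "x \<oplus> x' \<in> std_mod j q \<alpha> s" using std_mod_I[OF al, of "d \<oplus> d'" "y \<oplus> y'"] d d' by simp
next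
  let ?g = "t [^] j \<otimes> xi q \<alpha>"
  have g: "?g \<in> E" "?g \<in> carrier R" using xi_props[OF al] by simp_all
  fix c x assume c: "c \<in> D" and x: "x \<in> std_mod j q \<alpha> s"
  obtain d y where d: "d \<in> D" "y \<in> P s" "x = d \<otimes> ?g \<oplus> y" using x al by (auto elim: std_mod_E)
  have car: "d \<in> carrier R" "c \<in> carrier R" "y \<in> carrier R"
    using d c P_E by auto
  have "c \<otimes> x = (c \<otimes> d) \<otimes> ?g \<oplus> c \<otimes> y" unfolding d(3) using car g(2) by algebra
  then show "c \<otimes> x \<in> std_mod j q \<alpha> s" using std_mod_I[OF al, of "c \<otimes> d" "c \<otimes> y"] c d by simp
qed

lemma P_subset_std_mod: "\<alpha> \<in> gens \<Longrightarrow> P s \<subseteq> std_mod j q \<alpha> s"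
proof
  fix x assume "\<alpha> \<in> gens" "x \<in> P s"
  then show "x \<in> std_mod j q \<alpha> s"
    using std_mod_I[of \<alpha> \<zero> x s j q] xi_props P_E by simp
qed

lemma std_mod_subset_P:
  assumes "\<alpha> \<in> gens" "j \<le> s" shows "std_mod j q \<alpha> s \<subseteq> P j"
proof
  fix x assume "x \<in> std_mod j q \<alpha> s"
  then obtain d y where "d \<in> D" "y \<in> P s" "x = d \<otimes> (t [^] j \<otimes> xi q \<alpha>) \<oplus> y" using std_mod_E assms by metis
  then show "x \<in> P j" using xi_props assms P_mono[of j s y] by simp
qed

text \<open>The number i is the slack in s \<le> 2 j + q. For i = 0, the case of
  \<open>C_ring\<close>, the square produces the second generator itself; for i > 0 only a multiple
  of t.\<close>

lemma generator_square:
  assumes al: "\<alpha> \<in> gens" and s: "s + i = 2 * j + q"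
  shows "(t [^] j \<otimes> xi q \<alpha>) \<otimes> (t [^] j \<otimes> xi q \<alpha>) =
    t [^] j \<otimes> (t [^] j \<otimes> xi q \<alpha>) \<oplus> t [^] i \<otimes> (t [^] s \<otimes> (\<alpha> \<otimes> xi q \<alpha>))"
proof -
  have car: "xi q \<alpha> \<in> carrier R" "\<alpha> \<in> carrier R" "t [^] q \<in> carrier R" "t [^] j \<in> carrier R"
     "t [^] i \<in> carrier R" "t [^] s \<in> carrier R"
    using xi_props[OF al] gens_E[OF al] by auto
  have e: "t [^] i \<otimes> t [^] s = t [^] q \<otimes> (t [^] j \<otimes> t [^] j)"
    using s tpow_add[of i s] tpow_add[of q "j + j"] tpow_add[of j j] by (simp add: mult_2 add.commute)
  have "(t [^] j \<otimes> xi q \<alpha>) \<otimes> (t [^] j \<otimes> xi q \<alpha>) = t [^] j \<otimes> t [^] j \<otimes> (xi q \<alpha> \<otimes> xi q \<alpha>)"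
    using car by algebra
  also have "xi q \<alpha> \<otimes> xi q \<alpha> = xi q \<alpha> \<oplus> t [^] q \<otimes> (\<alpha> \<otimes> xi q \<alpha>)" using xi_square gens_E al by blast
  also have "t [^] j \<otimes> t [^] j \<otimes> (xi q \<alpha> \<oplus> t [^] q \<otimes> (\<alpha> \<otimes> xi q \<alpha>)) =
    t [^] j \<otimes> (t [^] j \<otimes> xi q \<alpha>) \<oplus> t [^] q \<otimes> (t [^] j \<otimes> t [^] j) \<otimes> (\<alpha> \<otimes> xi q \<alpha>)"
    using car by algebra
  also have "\<dots> = t [^] j \<otimes> (t [^] j \<otimes> xi q \<alpha>) \<oplus> t [^] i \<otimes> (t [^] s \<otimes> (\<alpha> \<otimes> xi q \<alpha>))"
    unfolding e[symmetric] using car by algebra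
  finally show ?thesis .
qed

lemma std_mod_mult:
  assumes al: "\<alpha> \<in> gens" and s: "s \<le> 2 * j + q" and x: "x \<in> std_mod j q \<alpha> s" "x' \<in> std_mod j q \<alpha> s"
  shows "x \<otimes> x' \<in> std_mod j q \<alpha> s"
proof -
  let ?g = "t [^] j \<otimes> xi q \<alpha>"
  note xi = xi_props[OF al, of q]
  have g: "?g \<in> E" "?g \<in> carrier R" using xi by simp_all
  obtain d y where d: "d \<in> D" "y \<in> P s" "x = d \<otimes> ?g \<oplus> y" using x al by (auto elim: std_mod_E)
  obtain d' y' where d': "d' \<in> D" "y' \<in> P s" "x' = d' \<otimes> ?g \<oplus> y'" using x al by (auto elim: std_mod_E)
  have car: "d \<in> carrier R" "d' \<in> carrier R" "y \<in> carrier R" "y' \<in> carrier R"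
    using d d' P_E by auto
  obtain i where i: "s + i = 2 * j + q" using s le_Suc_ex by metis
  define w where "w = t [^] i \<otimes> (t [^] s \<otimes> (\<alpha> \<otimes> xi q \<alpha>))"
  have w: "w \<in> P s" "w \<in> carrier R" using xi gens_E[OF al] by (simp_all add: w_def)
  have tj: "t [^] j \<in> carrier R" by simp
  have "x \<otimes> x' = (d \<otimes> d') \<otimes> (?g \<otimes> ?g) \<oplus> ((d \<otimes> ?g) \<otimes> y' \<oplus> (d' \<otimes> ?g) \<otimes> y \<oplus> y \<otimes> y')"
    unfolding d(3) d'(3) using car g(2) by algebra
  also have "?g \<otimes> ?g = t [^] j \<otimes> ?g \<oplus> w" unfolding w_def by (rule generator_square[OF al i])
  also have "(d \<otimes> d') \<otimes> (t [^] j \<otimes> ?g \<oplus> w) \<oplus> ((d \<otimes> ?g) \<otimes> y' \<oplus> (d' \<otimes> ?g) \<otimes> y \<oplus> y \<otimes> y') =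
     (d \<otimes> d' \<otimes> t [^] j) \<otimes> ?g \<oplus> ((d \<otimes> d') \<otimes> w \<oplus> ((d \<otimes> ?g) \<otimes> y' \<oplus> (d' \<otimes> ?g) \<otimes> y \<oplus> y \<otimes> y'))"
    using car g(2) w(2) tj by algebra
  also have "\<dots> \<in> std_mod j q \<alpha> s"
    using d d' g w P_E by (intro std_mod_I[OF al]) simp_all
  finally show ?thesis .
qed

definition basis2 :: "'a set \<Rightarrow> 'a \<Rightarrow> 'a \<Rightarrow> bool"
  where "basis2 M b c \<longleftrightarrow> b \<in> E \<and> c \<in> E \<and> M = {x \<otimes> b \<oplus> y \<otimes> c | x y. x \<in> D \<and> y \<in> D} \<and>
    (\<forall>x\<in>D. \<forall>y\<in>D. x \<otimes> b \<oplus> y \<otimes> c = \<zero> \<longrightarrow> x = \<zero> \<and> y = \<zero>)"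

lemma basis2D:
  assumes "basis2 M b c"
  shows "b \<in> E" "c \<in> E" "M = {x \<otimes> b \<oplus> y \<otimes> c | x y. x \<in> D \<and> y \<in> D}"
    "\<And>x y. x \<in> D \<Longrightarrow> y \<in> D \<Longrightarrow> x \<otimes> b \<oplus> y \<otimes> c = \<zero> \<Longrightarrow> x = \<zero> \<and> y = \<zero>"
  using assms unfolding basis2_def by auto

lemma basis2_mem:
  assumes "basis2 M b c"
  shows "b \<in> M" "c \<in> M" "b \<noteq> c"
proof -
  note bc = basis2D[OF assms]
  have "b = \<one> \<otimes> b \<oplus> \<zero> \<otimes> c" "c = \<zero> \<otimes> b \<oplus> \<one> \<otimes> c" using bc(1,2) by simp_all
  then show "b \<in> M" "c \<in> M" unfolding bc(3) using D_closed(1,2) by blast+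
  show "b \<noteq> c"
  proof
    assume "b = c"
    then have "\<one> \<otimes> b \<oplus> (\<ominus> \<one>) \<otimes> c = \<zero>" using bc(2) by (simp add: l_minus r_neg)
    then show False using bc(4)[of \<one> "\<ominus> \<one>"] by simp
  qed
qed

text \<open>The module t^s E has basis t^s \<xi>, t^s \<alpha> \<xi>. As j \<le> s, the first is a
  D-multiple of t^j \<xi>, so only the second is new.\<close>

lemma std_mod_basis:
  assumes al: "\<alpha> \<in> gens" and js: "j \<le> s"
  shows "basis2 (std_mod j q \<alpha> s) (t [^] j \<otimes> xi q \<alpha>) (t [^] s \<otimes> (\<alpha> \<otimes> xi q \<alpha>))"
  unfolding basis2_def
proof (intro conjI ballI impI)
  let ?g = "t [^] j \<otimes> xi q \<alpha>" and ?h = "t [^] s \<otimes> (\<alpha> \<otimes> xi q \<alpha>)"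
  note xi = xi_props[OF al, of q]
  show gh: "?g \<in> E" "?h \<in> E" using xi gens_E[OF al] by simp_all
  have hP: "?h \<in> P s" using xi gens_E[OF al] by simp
  have car: "xi q \<alpha> \<in> carrier R" "\<alpha> \<in> carrier R" "t [^] j \<in> carrier R" "t [^] (s - j) \<in> carrier R" "t [^] s \<in> carrier R"
    using xi gens_E[OF al] by auto
  have sj: "t [^] s = t [^] j \<otimes> t [^] (s - j)" using js tpow_add[of j "s - j"] by simp
  show "std_mod j q \<alpha> s = {x \<otimes> ?g \<oplus> y \<otimes> ?h | x y. x \<in> D \<and> y \<in> D}"
  proof (intro equalityI subsetI)
    fix x assume "x \<in> std_mod j q \<alpha> s"
    then obtain d y where d: "d \<in> D" "y \<in> P s" "x = d \<otimes> ?g \<oplus> y" using std_mod_E al by metis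
    obtain z where z: "z \<in> E" "y = t [^] s \<otimes> z" using d(2) by (rule PE)
    obtain a b where ab: "a \<in> D" "b \<in> D" "z = a \<otimes> xi q \<alpha> \<oplus> b \<otimes> (\<alpha> \<otimes> xi q \<alpha>)"
      using unit_span[OF al xi z(1)] by blast
    have dc: "d \<in> carrier R" "a \<in> carrier R" "b \<in> carrier R" using d ab by auto
    have "x = (d \<oplus> t [^] (s - j) \<otimes> a) \<otimes> ?g \<oplus> b \<otimes> ?h"
      unfolding d(3) z(2) ab(3) sj using car dc by algebra
    then show "x \<in> {x \<otimes> ?g \<oplus> y \<otimes> ?h | x y. x \<in> D \<and> y \<in> D}" using d ab by (blast intro: D_closed tpow_D)
  next
    fix x assume "x \<in> {x \<otimes> ?g \<oplus> y \<otimes> ?h | x y. x \<in> D \<and> y \<in> D}"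
    then obtain d e where "d \<in> D" "e \<in> D" "x = d \<otimes> ?g \<oplus> e \<otimes> ?h" by blast
    then show "x \<in> std_mod j q \<alpha> s" using std_mod_I[OF al, of d "e \<otimes> ?h"] hP by simp
  qed
  fix x y assume xy: "x \<in> D" "y \<in> D" and z: "x \<otimes> ?g \<oplus> y \<otimes> ?h = \<zero>"
  have xyc: "x \<in> carrier R" "y \<in> carrier R" using xy by auto
  have "(x \<otimes> t [^] j) \<otimes> xi q \<alpha> \<oplus> (y \<otimes> t [^] s) \<otimes> (\<alpha> \<otimes> xi q \<alpha>) = x \<otimes> ?g \<oplus> y \<otimes> ?h"
    using car xyc by algebra
  then have z': "(x \<otimes> t [^] j) \<otimes> xi q \<alpha> \<oplus> (y \<otimes> t [^] s) \<otimes> (\<alpha> \<otimes> xi q \<alpha>) = \<zero>" using z by (rule trans)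
  have "x \<otimes> t [^] j = \<zero> \<and> y \<otimes> t [^] s = \<zero>"
    using xi_indep[OF al, of "x \<otimes> t [^] j" "y \<otimes> t [^] s" q, OF _ _ z'] xy by simp
  then show "x = \<zero>" "y = \<zero>" using integral_iff xyc car by simp_all
qed

end

section \<open>Cubic rings as sets of pairs\<close>

text \<open>The last two assumptions say that powers of t are sufficient denominators: R and K arise
  from E and D by inverting t.\<close>

locale two_branches = unramified_pair +
  fixes K :: "'a set"
  assumes K_subring: "subring K R"
    and D_subset_K: "D \<subseteq> K"
    and frac_R: "\<And>x. x \<in> carrier R \<Longrightarrow> \<exists>n::nat. t [^] n \<otimes> x \<in> E"
    and frac_K: "\<And>x. x \<in> K \<Longrightarrow> \<exists>n::nat. t [^] n \<otimes> x \<in> D"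
begin

abbreviation L :: "('a \<times> 'a) ring"
  where "L \<equiv> RDirProd R (R\<lparr>carrier := K\<rparr>)"

text \<open>\<open>D \<oplus> (M \<times> 0)\<close>, with \<open>D\<close> embedded diagonally.\<close>

definition pairs :: "'a set \<Rightarrow> ('a \<times> 'a) set"
  where "pairs M = {(d \<oplus> x, d) | d x. d \<in> D \<and> x \<in> M}"

lemma K_carrier: "x \<in> K \<Longrightarrow> x \<in> carrier R"
  using subringE(1)[OF K_subring] by blast

lemma D_K: "x \<in> D \<Longrightarrow> x \<in> K"
  using D_subset_K by blast

lemma L_simps [simp]:
  "carrier L = carrier R \<times> K"
  "(a, b) \<otimes>\<^bsub>L\<^esub> (c, d) = (a \<otimes> c, b \<otimes> d)"
  "(a, b) \<oplus>\<^bsub>L\<^esub> (c, d) = (a \<oplus> c, b \<oplus> d)"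
  "\<zero>\<^bsub>L\<^esub> = (\<zero>, \<zero>)" "\<one>\<^bsub>L\<^esub> = (\<one>, \<one>)"
  by (simp_all add: RDirProd_def DirProd_def monoid.defs)

lemma L_cring: "cring L"
proof -
  have "ring L" using RDirProd_ring[OF ring_axioms subring_is_ring[OF K_subring]] .
  then show ?thesis
    by (intro cring.intro) (auto simp: comm_monoid_def comm_monoid_axioms_def ring_def m_comm K_carrier)
qed

sublocale L: cring L
  by (rule L_cring)

lemma L_uminus [simp]: "a \<in> carrier R \<Longrightarrow> b \<in> K \<Longrightarrow> \<ominus>\<^bsub>L\<^esub> (a, b) = (\<ominus> a, \<ominus> b)"
  using subringE(5)[OF K_subring] K_carrier by (intro L.minus_equality) (auto simp: l_neg)

lemma L_pow [simp]: "(a, b) [^]\<^bsub>L\<^esub> (n::nat) = (a [^] n, b [^] n)"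
  by (induction n) simp_all

lemma diagonal_iff [simp]: "(a, b) \<in> diagonal D \<longleftrightarrow> a = b \<and> a \<in> D"
  by (auto simp: diagonal_def)

lemma pairs_iff: "M \<subseteq> E \<Longrightarrow> (a, b) \<in> pairs M \<longleftrightarrow> b \<in> D \<and> a \<in> carrier R \<and> a \<ominus> b \<in> M"
proof
  assume M: "M \<subseteq> E" and "(a, b) \<in> pairs M"
  then obtain x where x: "b \<in> D" "x \<in> M" "a = b \<oplus> x" by (auto simp: pairs_def)
  have c: "b \<in> carrier R" "x \<in> carrier R" using x M by auto
  have "a \<ominus> b = x" unfolding x(3) using c by algebra
  then show "b \<in> D \<and> a \<in> carrier R \<and> a \<ominus> b \<in> M" using x c by simp
next
  assume "M \<subseteq> E" and ab: "b \<in> D \<and> a \<in> carrier R \<and> a \<ominus> b \<in> M"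
  then have c: "b \<in> carrier R" "a \<in> carrier R" by auto
  then have "a = b \<oplus> (a \<ominus> b)" by algebra
  then show "(a, b) \<in> pairs M" using ab unfolding pairs_def by blast
qed

lemma bex_pairs: "(\<exists>p \<in> pairs M. Q p) \<longleftrightarrow> (\<exists>d\<in>D. \<exists>x\<in>M. Q (d \<oplus> x, d))"
  by (auto simp: pairs_def)

lemma pairsI: "d \<in> D \<Longrightarrow> x \<in> M \<Longrightarrow> (d \<oplus> x, d) \<in> pairs M"
  by (auto simp: pairs_def)

lemma pairsE:
  assumes "p \<in> pairs M" obtains d x where "d \<in> D" "x \<in> M" "p = (d \<oplus> x, d)"
  using assms by (auto simp: pairs_def)

lemma diagonal_subring: "subring (diagonal D) L"
  by (rule L.subringI) (auto simp: D_K)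

lemma pairs_subring:
  assumes M: "submodule_D M" and mult: "\<And>x y. x \<in> M \<Longrightarrow> y \<in> M \<Longrightarrow> x \<otimes> y \<in> M"
  shows "subring (pairs M) L" "diagonal D \<subseteq> pairs M"
proof -
  note m = submoduleD[OF M]
  have mc: "x \<in> carrier R" if "x \<in> M" for x using m(1) that by auto
  show "diagonal D \<subseteq> pairs M"
  proof
    fix p assume "p \<in> diagonal D"
    then obtain d where "d \<in> D" "p = (d, d)" by (auto simp: diagonal_def)
    then show "p \<in> pairs M" using pairsI[of d \<zero> M] m(2) by simp
  qed
  show "subring (pairs M) L"
  proof (rule L.subringI)
    show "pairs M \<subseteq> carrier L" using mc D_K by (auto simp: pairs_def)
    show "\<one>\<^bsub>L\<^esub> \<in> pairs M" using pairsI[of \<one> \<zero> M] m(2) by simp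
  next
    fix p assume "p \<in> pairs M"
    then obtain d x where p: "d \<in> D" "x \<in> M" "p = (d \<oplus> x, d)" by (rule pairsE)
    then show "\<ominus>\<^bsub>L\<^esub> p \<in> pairs M" using pairsI[of "\<ominus> d" "\<ominus> x" M] m(5) mc D_K by (simp add: minus_add)
  next
    fix p p' assume "p \<in> pairs M" "p' \<in> pairs M"
    then obtain d x d' x' where p: "d \<in> D" "x \<in> M" "p = (d \<oplus> x, d)" "d' \<in> D" "x' \<in> M" "p' = (d' \<oplus> x', d')"
      by (metis pairsE)
    have c: "d \<in> carrier R" "d' \<in> carrier R" "x \<in> carrier R" "x' \<in> carrier R" using p mc by auto
    have "(d \<oplus> x) \<otimes> (d' \<oplus> x') = d \<otimes> d' \<oplus> (d \<otimes> x' \<oplus> d' \<otimes> x \<oplus> x \<otimes> x')"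
      "(d \<oplus> x) \<oplus> (d' \<oplus> x') = (d \<oplus> d') \<oplus> (x \<oplus> x')"
      using c by algebra+
    then show "p \<otimes>\<^bsub>L\<^esub> p' \<in> pairs M" "p \<oplus>\<^bsub>L\<^esub> p' \<in> pairs M"
      using pairsI[of "d \<otimes> d'" "d \<otimes> x' \<oplus> d' \<otimes> x \<oplus> x \<otimes> x'" M] pairsI[of "d \<oplus> d'" "x \<oplus> x'" M] p m(3,4) mult
      by simp_all
  qed
qed

lemma alphas_eq: "alphas L (diagonal D) (E \<times> D) (t, t) (\<one>, \<zero>) = (\<lambda>\<alpha>. (\<alpha>, \<zero>)) ` gens"
proof -
  have 1: "(\<one>, \<zero>) <#\<^bsub>L\<^esub> (E \<times> D) = E \<times> {\<zero>}"
    unfolding l_coset_def by (force intro: D_closed)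
  have 2: "((\<one>, \<zero>) <#\<^bsub>L\<^esub> diagonal D) <+>\<^bsub>L\<^esub> ((t, t) <#\<^bsub>L\<^esub> (E \<times> {\<zero>})) = {(d \<oplus> x, \<zero>) | d x. d \<in> D \<and> x \<in> P 1}"
    unfolding l_coset_def diagonal_def set_add_def set_mult_def P_def
    by auto blast+
  have 3: "(\<alpha>, \<zero>) \<in> {(d \<oplus> x, \<zero>) | d x. d \<in> D \<and> x \<in> P 1} \<longleftrightarrow> (\<exists>d\<in>D. \<alpha> \<ominus> d \<in> P 1)" if "\<alpha> \<in> E" for \<alpha>
  proof
    assume "(\<alpha>, \<zero>) \<in> {(d \<oplus> x, \<zero>) | d x. d \<in> D \<and> x \<in> P 1}"
    then obtain d x where d: "d \<in> D" "x \<in> P 1" "\<alpha> = d \<oplus> x" by auto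
    have c: "d \<in> carrier R" "x \<in> carrier R" using d P_E by auto
    have "\<alpha> \<ominus> d = x" unfolding d(3) using c by algebra
    then have "\<alpha> \<ominus> d \<in> P 1" using d by simp
    then show "\<exists>d\<in>D. \<alpha> \<ominus> d \<in> P 1" using d by blast
  next
    assume "\<exists>d\<in>D. \<alpha> \<ominus> d \<in> P 1"
    then obtain d where d: "d \<in> D" "\<alpha> \<ominus> d \<in> P 1" by auto
    have c: "d \<in> carrier R" "\<alpha> \<in> carrier R" using d that by auto
    have "\<alpha> = d \<oplus> (\<alpha> \<ominus> d)" using c by algebra
    then show "(\<alpha>, \<zero>) \<in> {(d \<oplus> x, \<zero>) | d x. d \<in> D \<and> x \<in> P 1}" using d by blast
  qed
  show ?thesis unfolding alphas_def 1 2 using 3 by (auto simp: gens_def)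
qed

text \<open>The summand t^r A also moves the second coordinate. That part is diagonal up to an
  element of t^r E x 0, so it can be absorbed into D.\<close>

lemma C_ring_eq:
  assumes al: "\<alpha> \<in> gens"
  shows "C_ring L (diagonal D) (E \<times> D) (t, t) (\<one>, \<zero>) l q (\<alpha>, \<zero>) = pairs (std_mod l q \<alpha> (2 * l + q))"
    (is "?C = pairs ?N")
proof -
  let ?r = "2 * l + q"
  have aE: "\<alpha> \<in> E" using al gens_E by auto
  have gen: "(t, t) [^]\<^bsub>L\<^esub> l \<otimes>\<^bsub>L\<^esub> ((\<one>, \<zero>) \<oplus>\<^bsub>L\<^esub> ((t, t) [^]\<^bsub>L\<^esub> q \<otimes>\<^bsub>L\<^esub> (\<alpha>, \<zero>))) = (t [^] l \<otimes> xi q \<alpha>, \<zero>)"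
    by (simp add: xi_def)
  have xiE: "t [^] l \<otimes> xi q \<alpha> \<in> E" using xi_props[OF al] by simp
  have mem: "p \<in> ?C \<longleftrightarrow> (\<exists>d\<in>D. \<exists>d'\<in>D. \<exists>x\<in>E. \<exists>y\<in>D.
       p = (d \<oplus> t [^] l \<otimes> xi q \<alpha> \<otimes> d' \<oplus> t [^] ?r \<otimes> x, d \<oplus> \<zero> \<otimes> d' \<oplus> t [^] ?r \<otimes> y))" for p
  proof -
    have "p \<in> ?C \<longleftrightarrow> (\<exists>y\<in>?C. p = y)" by blast
    then show ?thesis
      unfolding C_ring_def gen bex_set_add bex_l_coset bex_diagonal L_pow L_simps bex_Times
      by (simp add: xi_def)
  qed
  show ?thesis
  proof (intro equalityI subsetI)
    fix p assume "p \<in> ?C"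
    then obtain d d' x y where p: "d \<in> D" "d' \<in> D" "x \<in> E" "y \<in> D"
       "p = (d \<oplus> t [^] l \<otimes> xi q \<alpha> \<otimes> d' \<oplus> t [^] ?r \<otimes> x, d \<oplus> \<zero> \<otimes> d' \<oplus> t [^] ?r \<otimes> y)"
      unfolding mem by blast
    let ?g = "t [^] l \<otimes> xi q \<alpha>" and ?T = "t [^] ?r"
    have c: "d \<in> carrier R" "d' \<in> carrier R" "x \<in> carrier R" "y \<in> carrier R" "?g \<in> carrier R" "?T \<in> carrier R"
      using p xiE by auto
    \<comment> \<open>The new diagonal entry is d + t^r y; the first coordinate is corrected by t^r
      (x - y), still in t^r E.\<close>
    have "p = ((d \<oplus> ?T \<otimes> y) \<oplus> (d' \<otimes> ?g \<oplus> ?T \<otimes> (x \<ominus> y)), d \<oplus> ?T \<otimes> y)"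
    proof -
      have "d \<oplus> ?g \<otimes> d' \<oplus> ?T \<otimes> x = (d \<oplus> ?T \<otimes> y) \<oplus> (d' \<otimes> ?g \<oplus> ?T \<otimes> (x \<ominus> y))"
        using c by algebra
      then show ?thesis using p(5) c by simp
    qed
    then show "p \<in> pairs ?N"
      using pairsI[of "d \<oplus> ?T \<otimes> y" "d' \<otimes> ?g \<oplus> ?T \<otimes> (x \<ominus> y)" ?N] std_mod_I[OF al, of d' "?T \<otimes> (x \<ominus> y)" ?r l q] p
      by simp
  next
    fix p assume "p \<in> pairs ?N"
    then obtain d m where d: "d \<in> D" "m \<in> ?N" "p = (d \<oplus> m, d)" by (rule pairsE)
    obtain d' y where m: "d' \<in> D" "y \<in> P ?r" "m = t [^] l \<otimes> xi q \<alpha> \<otimes> d' \<oplus> y" using d(2) by (auto simp: std_mod_def)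
    obtain x where x: "x \<in> E" "y = t [^] ?r \<otimes> x" using m(2) by (rule PE)
    have "p = (d \<oplus> t [^] l \<otimes> xi q \<alpha> \<otimes> d' \<oplus> t [^] ?r \<otimes> x, d \<oplus> \<zero> \<otimes> d' \<oplus> t [^] ?r \<otimes> \<zero>)"
      using d m x xiE by (simp add: a_assoc)
    then show "p \<in> ?C" unfolding mem using d(1) m(1) x(1) D_closed(1) by blast
  qed
qed

lemma thicken_pairs:
  assumes M: "submodule_D M"
  shows "thicken L (diagonal D) (t, t) k (pairs M) = pairs {t [^] k \<otimes> x | x. x \<in> M}" (is "?T = pairs ?N")
proof -
  have mem: "p \<in> ?T \<longleftrightarrow> (\<exists>d\<in>D. \<exists>x\<in>M. \<exists>d'\<in>D. p = (t [^] k \<otimes> (d \<oplus> x) \<oplus> d', t [^] k \<otimes> d \<oplus> d'))" for p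
  proof -
    have "p \<in> ?T \<longleftrightarrow> (\<exists>y\<in>?T. p = y)" by blast
    then show ?thesis
      unfolding thicken_def bex_set_add bex_l_coset bex_diagonal bex_pairs L_pow L_simps by simp
  qed
  have Mc: "x \<in> carrier R" if "x \<in> M" for x using that submoduleD(1)[OF M] by simp
  show ?thesis
  proof (intro equalityI subsetI)
    fix p assume "p \<in> ?T"
    then obtain d x d' where p: "d \<in> D" "x \<in> M" "d' \<in> D" "p = (t [^] k \<otimes> (d \<oplus> x) \<oplus> d', t [^] k \<otimes> d \<oplus> d')"
      unfolding mem by blast
    have c: "d \<in> carrier R" "d' \<in> carrier R" "x \<in> carrier R" "t [^] k \<in> carrier R" using p Mc by auto
    have "t [^] k \<otimes> (d \<oplus> x) \<oplus> d' = (t [^] k \<otimes> d \<oplus> d') \<oplus> t [^] k \<otimes> x" using c by algebra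
    then show "p \<in> pairs ?N" using pairsI[of "t [^] k \<otimes> d \<oplus> d'" "t [^] k \<otimes> x" ?N] p by auto
  next
    fix p assume "p \<in> pairs ?N"
    then obtain d x where p: "d \<in> D" "x \<in> M" "p = (d \<oplus> t [^] k \<otimes> x, d)" by (auto elim!: pairsE)
    have "p = (t [^] k \<otimes> (\<zero> \<oplus> x) \<oplus> d, t [^] k \<otimes> \<zero> \<oplus> d)" using p Mc[OF p(2)] by (simp add: a_comm)
    then show "p \<in> ?T" unfolding mem using p D_closed(1) by blast
  qed
qed

text \<open>Together with \<open>thicken_pairs\<close> this identifies t^k C + D with the ring of a
  standard module whose two exponents are raised by k.\<close>

lemma tpow_std_mod:
  assumes al: "\<alpha> \<in> gens"
  shows "{t [^] k \<otimes> x | x. x \<in> std_mod j q \<alpha> s} = std_mod (k + j) q \<alpha> (k + s)"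
proof (intro equalityI subsetI)
  have xi: "xi q \<alpha> \<in> carrier R" using xi_props[OF al] by auto
  fix p assume "p \<in> {t [^] k \<otimes> x | x. x \<in> std_mod j q \<alpha> s}"
  then obtain x where x: "x \<in> std_mod j q \<alpha> s" "p = t [^] k \<otimes> x" by blast
  obtain d y where d: "d \<in> D" "y \<in> P s" "x = d \<otimes> (t [^] j \<otimes> xi q \<alpha>) \<oplus> y" using x al by (auto elim: std_mod_E)
  have c: "d \<in> carrier R" "y \<in> carrier R" "t [^] k \<in> carrier R" "t [^] j \<in> carrier R" using d P_E by auto
  have "p = d \<otimes> (t [^] (k + j) \<otimes> xi q \<alpha>) \<oplus> t [^] k \<otimes> y"
    unfolding x(2) d(3) tpow_add using c xi by algebra
  then show "p \<in> std_mod (k + j) q \<alpha> (k + s)"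
    using std_mod_I[OF al, of d "t [^] k \<otimes> y" "k + s"] d tpow_mult_P_iff[of y k s] c by simp
next
  have xi: "xi q \<alpha> \<in> carrier R" using xi_props[OF al] by auto
  fix p assume "p \<in> std_mod (k + j) q \<alpha> (k + s)"
  then obtain d y where d: "d \<in> D" "y \<in> P (k + s)" "p = d \<otimes> (t [^] (k + j) \<otimes> xi q \<alpha>) \<oplus> y"
    using al by (auto elim: std_mod_E)
  obtain z where z: "z \<in> E" "y = t [^] (k + s) \<otimes> z" using d(2) by (rule PE)
  have c: "d \<in> carrier R" "z \<in> carrier R" "t [^] k \<in> carrier R" "t [^] j \<in> carrier R" "t [^] s \<in> carrier R" using d z by auto
  have "p = t [^] k \<otimes> (d \<otimes> (t [^] j \<otimes> xi q \<alpha>) \<oplus> t [^] s \<otimes> z)"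
    unfolding d(3) z(2) tpow_add using c xi by algebra
  then show "p \<in> {t [^] k \<otimes> x | x. x \<in> std_mod j q \<alpha> s}"
    using std_mod_I[OF al, of d "t [^] s \<otimes> z" s j q] d z by auto
qed

end

section \<open>Poles of powers, and linear dependence of three vectors in D^2\<close>

context dvr_pair begin

lemma notin_P1_mult:
  assumes "x \<in> E" "x \<notin> P 1" "y \<in> E" "y \<notin> P 1" shows "x \<otimes> y \<notin> P 1"
proof
  assume "x \<otimes> y \<in> P 1"
  then have "inv x \<otimes> (x \<otimes> y) \<in> P 1" using E_unit[OF assms(1,2)] by simp
  then show False using inv_inv_mult(3)[of x y] E_unit[OF assms(1,2)] assms by simp
qed

text \<open>If x has a pole of order n0 > 0, then y = t^n0 x is a unit and x^j has a pole of order j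
  n0, which exceeds N for j = N + 1.\<close>

lemma mem_E_of_bounded_powers:
  assumes x: "x \<in> carrier R" and frac: "t [^] (n::nat) \<otimes> x \<in> E" and bd: "\<And>j::nat. t [^] (N::nat) \<otimes> x [^] j \<in> E"
  shows "x \<in> E"
proof (rule ccontr)
  assume nE: "x \<notin> E"
  define n0 where "n0 = (LEAST n. t [^] (n::nat) \<otimes> x \<in> E)"
  have n0: "t [^] n0 \<otimes> x \<in> E" unfolding n0_def using frac by (rule LeastI)
  have "n0 \<noteq> 0" using n0 nE x by (intro notI) simp
  then obtain k where k: "n0 = k + 1" by (cases n0) auto
  define y where "y = t [^] n0 \<otimes> x"
  have "t [^] k \<otimes> x \<notin> E" using not_less_Least[of k "\<lambda>n. t [^] (n::nat) \<otimes> x \<in> E"] k n0_def by auto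
  moreover have "y = t [^] (1::nat) \<otimes> (t [^] k \<otimes> x)"
    unfolding y_def k using tpow_add[of 1 k] x by (simp add: m_assoc add.commute)
  ultimately have yP: "y \<notin> P 1"
    using tpow_mult_P_iff[of "t [^] k \<otimes> x" 1 0] x by (simp add: P_0)
  have yE: "y \<in> E" using n0 by (simp add: y_def)
  have pow: "y [^] j \<in> E \<and> y [^] j \<notin> P 1" for j :: nat
  proof (induction j)
    case 0 then show ?case using unit_notin_P1[of \<one>] by simp
  next
    case (Suc j) then show ?case using notin_P1_mult[of "y [^] j" y] yE yP by simp
  qed
  \<comment> \<open>The exponent n0 (N + 1) - N is positive because n0 \<ge> 1, so the unit y^(N+1)
    would be divisible by t.\<close>
  have "N + (n0 * Suc N - N) = n0 * Suc N" "1 \<le> n0 * Suc N - N" using k by auto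
  moreover have "y [^] Suc N = t [^] (n0 * Suc N) \<otimes> x [^] Suc N"
    unfolding y_def using x by (simp only: nat_pow_distrib nat_pow_pow tpow_D D_carrier t_simps)
  ultimately have eq: "y [^] Suc N = t [^] (n0 * Suc N - N) \<otimes> (t [^] N \<otimes> x [^] Suc N)"
    using tpow_add[of "n0 * Suc N - N" N] x by (simp add: m_assoc add.commute)
  have "y [^] Suc N \<in> P (n0 * Suc N - N)" unfolding eq using bd by (rule PI)
  then show False using pow[of "Suc N"] P_mono[OF \<open>1 \<le> n0 * Suc N - N\<close>] by blast
qed

lemma three_dependent:
  assumes a: "a1 \<in> D" "a2 \<in> D" "a3 \<in> D" and b: "b1 \<in> D" "b2 \<in> D" "b3 \<in> D"
  shows "\<exists>c1\<in>D. \<exists>c2\<in>D. \<exists>c3\<in>D. \<not> (c1 = \<zero> \<and> c2 = \<zero> \<and> c3 = \<zero>) \<and>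
    c1 \<otimes> a1 \<oplus> c2 \<otimes> a2 \<oplus> c3 \<otimes> a3 = \<zero> \<and> c1 \<otimes> b1 \<oplus> c2 \<otimes> b2 \<oplus> c3 \<otimes> b3 = \<zero>"
    (is "\<exists>c1\<in>D. \<exists>c2\<in>D. \<exists>c3\<in>D. ?P c1 c2 c3")
proof -
  have car: "a1 \<in> carrier R" "a2 \<in> carrier R" "a3 \<in> carrier R" "b1 \<in> carrier R" "b2 \<in> carrier R" "b3 \<in> carrier R"
    using a b by auto
  \<comment> \<open>The cross product of the vectors a and b is orthogonal to both, giving a
    relation without division.\<close>
  define m1 m2 m3 where "m1 = a2 \<otimes> b3 \<ominus> a3 \<otimes> b2" and "m2 = a3 \<otimes> b1 \<ominus> a1 \<otimes> b3" and "m3 = a1 \<otimes> b2 \<ominus> a2 \<otimes> b1"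
  have m: "m1 \<in> D" "m2 \<in> D" "m3 \<in> D" using a b by (simp_all add: m1_def m2_def m3_def)
  have id: "m1 \<otimes> a1 \<oplus> m2 \<otimes> a2 \<oplus> m3 \<otimes> a3 = \<zero>" "m1 \<otimes> b1 \<oplus> m2 \<otimes> b2 \<oplus> m3 \<otimes> b3 = \<zero>"
    unfolding m1_def m2_def m3_def using car by algebra+
  show ?thesis
  proof (cases "m1 = \<zero> \<and> m2 = \<zero> \<and> m3 = \<zero>")
    case False
    then have "?P m1 m2 m3" using id by blast
    then show ?thesis using m by blast
  next
    \<comment> \<open>If all minors vanish, a and b are proportional over the field, so a relation
      orthogonal to one nonzero vector, such as (b2, -b1, 0), is orthogonal to both.\<close>
    case True
    have p12: "b2 \<otimes> a1 \<oplus> \<ominus> b1 \<otimes> a2 \<oplus> \<zero> \<otimes> a3 = m3" "b2 \<otimes> b1 \<oplus> \<ominus> b1 \<otimes> b2 \<oplus> \<zero> \<otimes> b3 = \<zero>"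
      unfolding m3_def using car by algebra+
    have p23: "\<zero> \<otimes> a1 \<oplus> b3 \<otimes> a2 \<oplus> \<ominus> b2 \<otimes> a3 = m1" "\<zero> \<otimes> b1 \<oplus> b3 \<otimes> b2 \<oplus> \<ominus> b2 \<otimes> b3 = \<zero>"
      unfolding m1_def using car by algebra+
    have q12: "a2 \<otimes> a1 \<oplus> \<ominus> a1 \<otimes> a2 \<oplus> \<zero> \<otimes> a3 = \<zero>" using car by algebra
    have z: "\<ominus> x = \<zero> \<longleftrightarrow> x = \<zero>" if "x \<in> D" for x
      using that D_carrier minus_minus minus_zero by metis
    consider "b1 \<noteq> \<zero> \<or> b2 \<noteq> \<zero>" | "b3 \<noteq> \<zero>" | "b1 = \<zero>" "b2 = \<zero>" "b3 = \<zero>" "a1 \<noteq> \<zero> \<or> a2 \<noteq> \<zero>"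
      | "b1 = \<zero>" "b2 = \<zero>" "b3 = \<zero>" "a1 = \<zero>" "a2 = \<zero>" by blast
    then show ?thesis
    proof cases
      case 1
      then have "?P b2 (\<ominus> b1) \<zero>" using p12 True z b by auto
      then show ?thesis using b D_closed by blast
    next
      case 2
      then have "?P \<zero> b3 (\<ominus> b2)" using p23 True z b by auto
      then show ?thesis using b D_closed by blast
    next
      case 3
      then have "?P a2 (\<ominus> a1) \<zero>" using q12 z a by auto
      then show ?thesis using a D_closed by blast
    next
      case 4
      then have "?P \<one> \<zero> \<zero>" using a by auto
      then show ?thesis using D_closed by blast
    qed
  qed
qed

end

section \<open>Cubic rings correspond to multiplicatively closed submodules of E\<close>

context two_branches begin

lemma cubic_module:
  assumes "subring C L" "diagonal D \<subseteq> C"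
  shows "module (L\<lparr>carrier := diagonal D\<rparr>) (submod L C)"
  by (rule L.submod_module[OF diagonal_subring assms])

lemma common_denominator:
  assumes "finite G" "G \<subseteq> carrier L"
  shows "\<exists>N::nat. \<forall>(x, y) \<in> G. t [^] N \<otimes> x \<in> E \<and> t [^] N \<otimes> y \<in> E"
  using assms
proof (induction G)
  case (insert p G)
  obtain N where N: "\<forall>(x, y) \<in> G. t [^] (N::nat) \<otimes> x \<in> E \<and> t [^] N \<otimes> y \<in> E" using insert by auto
  obtain x y where p: "p = (x, y)" "x \<in> carrier R" "y \<in> K" using insert.prems by auto
  obtain m n where mn: "t [^] (m::nat) \<otimes> x \<in> E" "t [^] (n::nat) \<otimes> y \<in> D" using frac_R frac_K p by metis
  have up: "t [^] (a + b) \<otimes> z \<in> E" if "t [^] a \<otimes> z \<in> E" "z \<in> carrier R" for a b :: nat and z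
  proof -
    have "t [^] (a + b) \<otimes> z = t [^] b \<otimes> (t [^] a \<otimes> z)"
      using that(2) tpow_add[of b a] by (simp add: m_assoc add.commute)
    then show ?thesis using that by simp
  qed
  have "t [^] (N + m + n) \<otimes> u \<in> E \<and> t [^] (N + m + n) \<otimes> v \<in> E" if "(u, v) \<in> insert p G" for u v
  proof (cases "(u, v) = p")
    case True
    then show ?thesis using up[of m x "N + n"] up[of n y "N + m"] mn p K_carrier by (simp add: ac_simps)
  next
    case False
    then have "(u, v) \<in> G" using that by blast
    then have "t [^] N \<otimes> u \<in> E" "t [^] N \<otimes> v \<in> E" "u \<in> carrier R" "v \<in> K" using N insert.prems by auto
    then show ?thesis using up[of N u "m + n"] up[of N v "m + n"] K_carrier by (simp add: ac_simps)
  qed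
  then show ?case by blast
qed auto

text \<open>Finitely many generators have a common denominator t^N, which then bounds the poles of
  all powers of an element.\<close>

lemma cubic_ring_subset:
  assumes "cubic_ring L (diagonal D) B"
  shows "B \<subseteq> E \<times> D"
proof -
  have B: "subring B L" "diagonal D \<subseteq> B" and fr: "free_module_of_rank 3 (L\<lparr>carrier := diagonal D\<rparr>) (submod L B)"
    using assms by (auto simp: cubic_ring_def)
  interpret m: module "L\<lparr>carrier := diagonal D\<rparr>" "submod L B" by (rule cubic_module[OF B])
  obtain G where G: "G \<subseteq> B" "finite G" "m.span G = B" using fr by (auto simp: free_module_of_rank_def)
  have BL: "B \<subseteq> carrier L" using subringE(1)[OF B(1)] .
  obtain N where N: "\<forall>(x, y) \<in> G. t [^] (N::nat) \<otimes> x \<in> E \<and> t [^] N \<otimes> y \<in> E"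
    using common_denominator[of G] G BL by blast
  \<comment> \<open>The elements with denominator t^N form a submodule, so containing the generators
    it contains all of B.\<close>
  define Q where "Q = {(x, y). (x, y) \<in> B \<and> t [^] N \<otimes> x \<in> E \<and> t [^] N \<otimes> y \<in> E}"
  have "submodule (L\<lparr>carrier := diagonal D\<rparr>) Q (submod L B)"
  proof (rule submodule.intro, goal_cases)
    case 1 show ?case by (rule m.module_axioms)
  next
    case 2 show ?case by (auto simp: Q_def)
  next
    case (3 v w)
    then obtain x y x' y' where p: "v = (x, y)" "w = (x', y')" by (metis surj_pair)
    have pc: "x \<in> carrier R" "y \<in> carrier R" "x' \<in> carrier R" "y' \<in> carrier R" using 3 BL K_carrier p by (auto simp: Q_def)
    show ?case using 3 p subringE(7)[OF B(1), of v w] pc by (auto simp: Q_def r_distr)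
  next
    case 4 show ?case using subringE(2)[OF B(1)] by (auto simp: Q_def)
  next
    case (5 c v)
    obtain x y where v: "v = (x, y)" by (metis surj_pair)
    obtain d where "c = (d, d)" "d \<in> D" using 5 by (auto simp: diagonal_def)
    note p = v this
    have pc: "x \<in> carrier R" "y \<in> carrier R" using 5 BL K_carrier p by (auto simp: Q_def)
    have "t [^] N \<otimes> (d \<otimes> x) = d \<otimes> (t [^] N \<otimes> x)" "t [^] N \<otimes> (d \<otimes> y) = d \<otimes> (t [^] N \<otimes> y)"
      using pc p(3) by (simp_all add: m_lcomm)
    moreover have "c \<in> B" using 5 B(2) by auto
    ultimately show ?case using 5 p subringE(6)[OF B(1), of c v] by (auto simp: Q_def)
  qed
  moreover have "G \<subseteq> Q" using G N by (auto simp: Q_def)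
  ultimately have BQ: "B \<subseteq> Q" using m.span_is_subset[of G Q] G by blast
  show ?thesis
  proof
    fix p assume p: "p \<in> B"
    obtain x y where xy: "p = (x, y)" "x \<in> carrier R" "y \<in> K" using p BL by auto
    have "p [^]\<^bsub>L\<^esub> j \<in> B" for j :: nat
      using p subringE(3,6)[OF B(1)] by (induction j) auto
    then have pow: "t [^] N \<otimes> x [^] j \<in> E \<and> t [^] N \<otimes> y [^] j \<in> E" for j :: nat
      using BQ xy by (auto simp: Q_def)
    obtain m n where mn: "t [^] (m::nat) \<otimes> x \<in> E" "t [^] (n::nat) \<otimes> y \<in> D" using frac_R frac_K xy by metis
    have xE: "x \<in> E" using mem_E_of_bounded_powers[of x m N] xy mn pow by blast
    have yE: "y \<in> E" using mem_E_of_bounded_powers[of y n N] K_carrier[OF xy(3)] D_E[OF mn(2)] pow by blast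
    \<comment> \<open>The second coordinate lies in K and in E; their intersection is D, because a
      numerator in D divisible by t^n in E is divisible by t^n in D.\<close>
    then obtain c where "c \<in> D" "t [^] n \<otimes> y = t [^] n \<otimes> c" using D_Int_P[of "t [^] n \<otimes> y" n] mn by auto
    then have "y \<in> D" using tpow_cancel[of y c n] yE by auto
    then show "p \<in> E \<times> D" using xE xy by simp
  qed
qed

text \<open>M is the kernel of the second projection. Subtracting the diagonal element (y, y) from
  (x, y) lands in it.\<close>

lemma cubic_ring_imp_pairs:
  assumes "cubic_ring L (diagonal D) B"
  shows "\<exists>M. submodule_D M \<and> (\<forall>x\<in>M. \<forall>y\<in>M. x \<otimes> y \<in> M) \<and> B = pairs M"
proof -
  have B: "subring B L" "diagonal D \<subseteq> B" using assms by (auto simp: cubic_ring_def)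
  note b = subringE[OF B(1)]
  have BED: "B \<subseteq> E \<times> D" by (rule cubic_ring_subset[OF assms])
  define M where "M = {x \<in> E. (x, \<zero>) \<in> B}"
  have dB: "(d, d) \<in> B" if "d \<in> D" for d using that B(2) by auto
  have "submodule_D M"
    unfolding submodule_D_def
  proof (intro conjI ballI)
    show "M \<subseteq> E" "\<zero> \<in> M" using b(2) by (auto simp: M_def)
    show "x \<oplus> y \<in> M" if "x \<in> M" "y \<in> M" for x y using that b(7)[of "(x, \<zero>)" "(y, \<zero>)"] by (simp add: M_def)
    show "d \<otimes> x \<in> M" if "d \<in> D" "x \<in> M" for d x using that b(6)[of "(d, d)" "(x, \<zero>)"] dB by (simp add: M_def)
  qed
  moreover have "\<forall>x\<in>M. \<forall>y\<in>M. x \<otimes> y \<in> M"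
    using b(6)[of "(x, \<zero>)" "(y, \<zero>)" for x y] by (simp add: M_def)
  moreover have "B = pairs M"
  proof (intro equalityI subsetI)
    fix p assume p: "p \<in> B"
    then obtain x y where xy: "p = (x, y)" "x \<in> E" "y \<in> D" using BED by auto
    then have "(\<ominus> y, \<ominus> y) \<in> B" using dB by simp
    then have "(x, y) \<oplus>\<^bsub>L\<^esub> (\<ominus> y, \<ominus> y) \<in> B" using b(7) p xy by blast
    then have "x \<ominus> y \<in> M" using xy by (simp add: M_def r_neg minus_eq)
    then show "p \<in> pairs M" using xy pairs_iff[of M x y] by (auto simp: M_def)
  next
    fix p assume "p \<in> pairs M"
    then obtain d x where p: "d \<in> D" "x \<in> M" "p = (d \<oplus> x, d)" by (rule pairsE)
    then show "p \<in> B" using b(7)[of "(d, d)" "(x, \<zero>)"] dB by (simp add: M_def)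
  qed
  ultimately show ?thesis by blast
qed

text \<open>Otherwise M = D z, and every element is (a + b z, a) with two coordinates a, b in D.
  \<open>three_dependent\<close> then contradicts the independence of a three-element basis.\<close>

lemma cubic_ring_contains_P:
  assumes pairs: "cubic_ring L (diagonal D) (pairs M)" and M: "submodule_D M"
  shows "\<exists>m. P m \<subseteq> M"
proof (rule ccontr)
  assume "\<not> (\<exists>m. P m \<subseteq> M)"
  then obtain z where z: "z \<in> M" "\<forall>x\<in>M. \<exists>d\<in>D. x = d \<otimes> z" using submodule_dichotomy[OF M] by blast
  have zc: "z \<in> carrier R" using submoduleD(1)[OF M z(1)] by simp
  have B: "subring (pairs M) L" "diagonal D \<subseteq> pairs M"
    and fr: "free_module_of_rank 3 (L\<lparr>carrier := diagonal D\<rparr>) (submod L (pairs M))"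
    using assms by (auto simp: cubic_ring_def)
  interpret m: module "L\<lparr>carrier := diagonal D\<rparr>" "submod L (pairs M)" by (rule cubic_module[OF B])
  obtain G where G: "G \<subseteq> pairs M" "card G = 3" "m.lin_indpt G" using fr by (auto simp: free_module_of_rank_def)
  obtain p1 p2 p3 where p: "G = {p1, p2, p3}" "p1 \<noteq> p2" "p1 \<noteq> p3" "p2 \<noteq> p3" using G(2) by (metis card_3_iff)
  have form: "\<exists>a\<in>D. \<exists>b\<in>D. p = (a \<oplus> b \<otimes> z, a)" if "p \<in> pairs M" for p
    using that z by (metis pairsE)
  have pX: "p1 \<in> pairs M" "p2 \<in> pairs M" "p3 \<in> pairs M" using G p by auto
  obtain a1 b1 where ab1: "a1 \<in> D" "b1 \<in> D" "p1 = (a1 \<oplus> b1 \<otimes> z, a1)" using form[OF pX(1)] by blast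
  obtain a2 b2 where ab2: "a2 \<in> D" "b2 \<in> D" "p2 = (a2 \<oplus> b2 \<otimes> z, a2)" using form[OF pX(2)] by blast
  obtain a3 b3 where ab3: "a3 \<in> D" "b3 \<in> D" "p3 = (a3 \<oplus> b3 \<otimes> z, a3)" using form[OF pX(3)] by blast
  note ab = ab1 ab2 ab3
  obtain c1 c2 c3 where c: "c1 \<in> D" "c2 \<in> D" "c3 \<in> D" "\<not> (c1 = \<zero> \<and> c2 = \<zero> \<and> c3 = \<zero>)"
    "c1 \<otimes> a1 \<oplus> c2 \<otimes> a2 \<oplus> c3 \<otimes> a3 = \<zero>" "c1 \<otimes> b1 \<oplus> c2 \<otimes> b2 \<oplus> c3 \<otimes> b3 = \<zero>"
    using three_dependent[OF ab(1,4,7,2,5,8)] by blast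
  define f where "f = (\<lambda>p. if p = p1 then (c1, c1) else if p = p2 then (c2, c2) else (c3, c3))"
  have f: "f \<in> G \<rightarrow> diagonal D" using c by (auto simp: f_def)
  have fp: "f q \<otimes>\<^bsub>L\<^esub> q \<in> pairs M" if "q \<in> G" for q
    using that f B subringE(6)[OF B(1)] G by blast
  have car: "a1 \<in> carrier R" "a2 \<in> carrier R" "a3 \<in> carrier R" "b1 \<in> carrier R" "b2 \<in> carrier R" "b3 \<in> carrier R"
     "c1 \<in> carrier R" "c2 \<in> carrier R" "c3 \<in> carrier R" using ab c by auto
  have "m.lincomb f G = f p1 \<otimes>\<^bsub>L\<^esub> p1 \<oplus>\<^bsub>L\<^esub> (f p2 \<otimes>\<^bsub>L\<^esub> p2 \<oplus>\<^bsub>L\<^esub> (f p3 \<otimes>\<^bsub>L\<^esub> p3 \<oplus>\<^bsub>L\<^esub> \<zero>\<^bsub>L\<^esub>))"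
    unfolding m.lincomb_def p(1) using p fp
    by (simp add: m.finsum_insert Pi_def)
  also have "\<dots> = (c1 \<otimes> (a1 \<oplus> b1 \<otimes> z) \<oplus> (c2 \<otimes> (a2 \<oplus> b2 \<otimes> z) \<oplus> c3 \<otimes> (a3 \<oplus> b3 \<otimes> z)), c1 \<otimes> a1 \<oplus> (c2 \<otimes> a2 \<oplus> c3 \<otimes> a3))"
  proof -
    have "f p1 = (c1, c1)" "f p2 = (c2, c2)" "f p3 = (c3, c3)" using p by (auto simp: f_def)
    then show ?thesis using car zc by (simp add: ab(3,6,9))
  qed
  also have "c1 \<otimes> (a1 \<oplus> b1 \<otimes> z) \<oplus> (c2 \<otimes> (a2 \<oplus> b2 \<otimes> z) \<oplus> c3 \<otimes> (a3 \<oplus> b3 \<otimes> z)) =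
     (c1 \<otimes> a1 \<oplus> c2 \<otimes> a2 \<oplus> c3 \<otimes> a3) \<oplus> (c1 \<otimes> b1 \<oplus> c2 \<otimes> b2 \<oplus> c3 \<otimes> b3) \<otimes> z" using car zc by algebra
  also have "\<dots> = \<zero>" using c zc by simp
  also have "c1 \<otimes> a1 \<oplus> (c2 \<otimes> a2 \<oplus> c3 \<otimes> a3) = \<zero>" using c(5) car by (simp add: a_assoc)
  finally have z0: "m.lincomb f G = \<zero>\<^bsub>submod L (pairs M)\<^esub>" by simp
  have nz: "\<exists>v\<in>G. f v \<noteq> (\<zero>, \<zero>)" using c p by (auto simp: f_def)
  then obtain v where "v \<in> G" "f v \<noteq> (\<zero>, \<zero>)" by blast
  then have "m.lin_dep G" using f z0 p(1) by (intro m.lin_dep_crit[of G G f v]) auto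
  then show False using G by blast
qed

lemma pairs_cubic_ring:
  assumes M: "submodule_D M" and mult: "\<And>x y. x \<in> M \<Longrightarrow> y \<in> M \<Longrightarrow> x \<otimes> y \<in> M" and basis: "basis2 M b c"
  shows "cubic_ring L (diagonal D) (pairs M)"
proof -
  note B = pairs_subring[OF M mult]
  interpret m: module "L\<lparr>carrier := diagonal D\<rparr>" "submod L (pairs M)" by (rule cubic_module[OF B])
  note bc = basis2D[OF basis] and bM = basis2_mem[OF basis]
  \<comment> \<open>The unit spans the diagonal; the other two carry a basis of M on the first
    branch.\<close>
  define p1 p2 p3 where "p1 = (\<one>, \<one>)" and "p2 = (b, \<zero>)" and "p3 = (c, \<zero>)"
  have dist: "p1 \<noteq> p2" "p1 \<noteq> p3" "p2 \<noteq> p3" using bM(3) by (auto simp: p1_def p2_def p3_def)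
  let ?G = "{p1, p2, p3}"
  have G: "?G \<subseteq> pairs M"
    using pairsI[of \<one> \<zero> M] pairsI[of \<zero> b M] pairsI[of \<zero> c M] bM bc submoduleD(2)[OF M] by (simp add: p1_def p2_def p3_def)
  have lin: "m.lincomb f ?G = f p1 \<otimes>\<^bsub>L\<^esub> p1 \<oplus>\<^bsub>L\<^esub> (f p2 \<otimes>\<^bsub>L\<^esub> p2 \<oplus>\<^bsub>L\<^esub> (f p3 \<otimes>\<^bsub>L\<^esub> p3 \<oplus>\<^bsub>L\<^esub> \<zero>\<^bsub>L\<^esub>))"
    if f: "f \<in> ?G \<rightarrow> diagonal D" for f
  proof -
    have fp: "f q \<otimes>\<^bsub>L\<^esub> q \<in> pairs M" if "q \<in> ?G" for q
      using that f B subringE(6)[OF B(1)] G by blast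
    show ?thesis
      unfolding m.lincomb_def using dist fp
      by (simp add: m.finsum_insert Pi_def)
  qed
  have lin': "m.lincomb f ?G = (d1 \<oplus> (d2 \<otimes> b \<oplus> d3 \<otimes> c), d1)"
    if "f p1 = (d1, d1)" "f p2 = (d2, d2)" "f p3 = (d3, d3)" "d1 \<in> D" "d2 \<in> D" "d3 \<in> D" for f d1 d2 d3
  proof -
    have "f \<in> ?G \<rightarrow> diagonal D" using that by auto
    then show ?thesis using lin[of f] that bc(1,2) by (simp add: p1_def p2_def p3_def)
  qed
  have "m.lin_indpt ?G"
  proof (rule m.finite_lin_indpt2)
    show "finite ?G" "?G \<subseteq> carrier (submod L (pairs M))" using G by simp_all
    fix f assume "f \<in> ?G \<rightarrow> carrier (L\<lparr>carrier := diagonal D\<rparr>)" and z: "m.lincomb f ?G = \<zero>\<^bsub>submod L (pairs M)\<^esub>"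
    then have fD: "f p1 \<in> diagonal D" "f p2 \<in> diagonal D" "f p3 \<in> diagonal D" by auto
    obtain d1 d2 d3 where d: "f p1 = (d1, d1)" "f p2 = (d2, d2)" "f p3 = (d3, d3)" "d1 \<in> D" "d2 \<in> D" "d3 \<in> D"
      using fD unfolding diagonal_def by auto
    have "(d1 \<oplus> (d2 \<otimes> b \<oplus> d3 \<otimes> c), d1) = (\<zero>, \<zero>)" using lin'[OF d] z by (simp only: submod_simps L_simps)
    then have "d1 \<oplus> (d2 \<otimes> b \<oplus> d3 \<otimes> c) = \<zero>" "d1 = \<zero>" unfolding prod.inject by blast+
    then have "d1 = \<zero>" "d2 = \<zero> \<and> d3 = \<zero>" using bc(4)[of d2 d3] d bc(1,2) by simp_all
    then show "\<forall>v\<in>?G. f v = \<zero>\<^bsub>L\<lparr>carrier := diagonal D\<rparr>\<^esub>" using d by simp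
  qed
  moreover have "m.span ?G = pairs M"
  proof
    show "m.span ?G \<subseteq> pairs M" using m.span_is_subset2[of ?G] G by simp
    show "pairs M \<subseteq> m.span ?G"
    proof
      fix p assume "p \<in> pairs M"
      then obtain d x where p: "d \<in> D" "x \<in> M" "p = (d \<oplus> x, d)" by (rule pairsE)
      obtain y z where yz: "y \<in> D" "z \<in> D" "x = y \<otimes> b \<oplus> z \<otimes> c" using p(2) unfolding bc(3) by blast
      define f where "f = (\<lambda>p. if p = p1 then (d, d) else if p = p2 then (y, y) else (z, z))"
      have "f p1 = (d, d)" "f p2 = (y, y)" "f p3 = (z, z)" using dist by (auto simp: f_def)
      then have "m.lincomb f ?G = p" using lin'[of f d y z] p yz by simp
      moreover have "f \<in> ?G \<rightarrow> diagonal D" using p yz by (auto simp: f_def)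
      ultimately show "p \<in> m.span ?G" unfolding m.span_def
        by (intro CollectI exI[of _ f] exI[of _ ?G]) auto
    qed
  qed
  moreover have "card ?G = 3" using dist by simp
  ultimately have "free_module_of_rank 3 (L\<lparr>carrier := diagonal D\<rparr>) (submod L (pairs M))"
    unfolding free_module_of_rank_def using m.module_axioms G by (intro conjI exI[of _ ?G]) simp_all
  then show ?thesis using B by (simp add: cubic_ring_def)
qed

end

section \<open>Orders in the maximal ideal\<close>

text \<open>\<open>M_P\<close> keeps M inside t E. Hence d + x is a unit of E whenever d is a unit
  of D, and the powers of an element of M become divisible by arbitrarily high powers of t.\<close>

locale cubic_order = two_branches +
  fixes M :: "'a set"
  assumes M: "submodule_D M" and M_mult: "\<And>x y. x \<in> M \<Longrightarrow> y \<in> M \<Longrightarrow> x \<otimes> y \<in> M" and M_P: "M \<subseteq> P 1"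
begin

abbreviation S where "S \<equiv> L\<lparr>carrier := pairs M\<rparr>"

lemmas C_subring = pairs_subring(1)[OF M M_mult]

sublocale S: cring S
  by (rule L.subring_is_cring[OF C_subring])

lemmas M_closed = submoduleD(2-6)[OF M]

lemma M_E: "x \<in> M \<Longrightarrow> x \<in> E" "x \<in> M \<Longrightarrow> x \<in> carrier R"
  using submoduleD(1)[OF M] by simp_all

lemma M_subset_E: "M \<subseteq> E"
  using M_E by blast

lemma pairs_pair: "(a, b) \<in> pairs M \<longleftrightarrow> b \<in> D \<and> a \<in> carrier R \<and> a \<ominus> b \<in> M"
  by (rule pairs_iff[OF M_subset_E])

lemma diag_pairs: "d \<in> D \<Longrightarrow> (d, d) \<in> pairs M"
  using pairsI[of d \<zero> M] M_closed by simp

lemma M_pairs: "x \<in> M \<Longrightarrow> (x, \<zero>) \<in> pairs M"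
  using pairsI[of \<zero> x M] M_E by simp

definition maxid :: "('a \<times> 'a) set"
  where "maxid = {(d \<oplus> x, d) | d x. d \<in> D \<and> d \<in> P 1 \<and> x \<in> M}"

lemma maxid_pairs: "p \<in> maxid \<Longrightarrow> p \<in> pairs M"
  by (auto simp: maxid_def pairs_def)

lemma maxid_pair_iff:
  assumes "d \<in> D" "x \<in> M" shows "(d \<oplus> x, d) \<in> maxid \<longleftrightarrow> d \<in> P 1"
  using assms by (auto simp: maxid_def)

lemma maxid_ideal: "ideal maxid S"
proof (rule L.ideal_in_subringI[OF C_subring])
  show "maxid \<subseteq> pairs M" using maxid_pairs by blast
  show "\<zero>\<^bsub>L\<^esub> \<in> maxid" using maxid_pair_iff[of \<zero> \<zero>] M_closed by simp
next
  fix p p' assume "p \<in> maxid" "p' \<in> maxid"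
  then obtain d x d' x' where p: "d \<in> D" "d \<in> P 1" "x \<in> M" "p = (d \<oplus> x, d)"
      "d' \<in> D" "d' \<in> P 1" "x' \<in> M" "p' = (d' \<oplus> x', d')"
    unfolding maxid_def by blast
  have c: "d \<in> carrier R" "d' \<in> carrier R" "x \<in> carrier R" "x' \<in> carrier R" using p M_E by auto
  have "(d \<oplus> x) \<oplus> (d' \<oplus> x') = (d \<oplus> d') \<oplus> (x \<oplus> x')" using c by algebra
  then show "p \<oplus>\<^bsub>L\<^esub> p' \<in> maxid" using maxid_pair_iff[of "d \<oplus> d'" "x \<oplus> x'"] p M_closed by simp
next
  fix p p' assume "p \<in> pairs M" "p' \<in> maxid"
  then obtain d x d' x' where p: "d \<in> D" "x \<in> M" "p = (d \<oplus> x, d)"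
      "d' \<in> D" "d' \<in> P 1" "x' \<in> M" "p' = (d' \<oplus> x', d')"
    unfolding maxid_def pairs_def by blast
  have c: "d \<in> carrier R" "d' \<in> carrier R" "x \<in> carrier R" "x' \<in> carrier R" using p M_E by auto
  have "(d \<oplus> x) \<otimes> (d' \<oplus> x') = d \<otimes> d' \<oplus> (d \<otimes> x' \<oplus> d' \<otimes> x \<oplus> x \<otimes> x')" using c by algebra
  then show "p \<otimes>\<^bsub>L\<^esub> p' \<in> maxid"
    using maxid_pair_iff[of "d \<otimes> d'" "d \<otimes> x' \<oplus> d' \<otimes> x \<oplus> x \<otimes> x'"] p M_closed M_mult by simp
qed

lemma maxid_maximal: "maximalideal maxid S"
proof (rule S.maximalidealI_inverse[OF maxid_ideal])
  have "\<one> \<oplus> \<zero> = \<one>" by simp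
  then show "\<one>\<^bsub>S\<^esub> \<notin> maxid"
    using maxid_pair_iff[of \<one> \<zero>] M_closed unit_notin_P1[of \<one>] by simp
  fix p assume "p \<in> carrier S" "p \<notin> maxid"
  then obtain d x where p: "d \<in> D" "x \<in> M" "p = (d \<oplus> x, d)" "d \<notin> P 1" by (auto simp: maxid_def pairs_def)
  note u = D_unit[OF p(1,4)]
  have c: "d \<in> carrier R" "x \<in> carrier R" "inv d \<in> carrier R" using p u M_E by auto
  have i: "d \<otimes> inv d = \<one>" using inv_inv_mult(4)[of d d] c u by simp
  have "(d \<oplus> x) \<otimes> inv d = d \<otimes> inv d \<oplus> inv d \<otimes> x" using c by algebra
  then have "(d \<oplus> x) \<otimes> inv d = \<one> \<oplus> inv d \<otimes> x" using i by simp
  then have "p \<otimes>\<^bsub>S\<^esub> (inv d, inv d) = \<one>\<^bsub>S\<^esub> \<oplus>\<^bsub>S\<^esub> (inv d \<otimes> x, \<zero>)" using p(3) i by simp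
  moreover have "(inv d \<otimes> x, \<zero>) \<in> maxid" using maxid_pair_iff[of \<zero> "inv d \<otimes> x"] M_closed u p c by simp
  moreover have "(inv d, inv d) \<in> carrier S" using diag_pairs u by simp
  ultimately show "\<exists>y\<in>carrier S. \<exists>j\<in>maxid. p \<otimes>\<^bsub>S\<^esub> y = \<one>\<^bsub>S\<^esub> \<oplus>\<^bsub>S\<^esub> j" by blast
qed

text \<open>If \<open>x\<^sup>2 = \<delta> x + z\<close>, then \<open>x / (d + x) = (x - z / (d + x)) / (d + \<delta>)\<close>, which stays in \<open>M\<close>.\<close>

lemma local_if_quadratic:
  assumes Pr: "P r \<subseteq> M"
    and quad: "\<And>x. x \<in> M \<Longrightarrow> \<exists>\<delta>\<in>D. \<exists>z\<in>P r. \<delta> \<in> P 1 \<and> x \<otimes> x = \<delta> \<otimes> x \<oplus> z"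
  shows "local_ring S"
proof (rule S.local_ringI_units[OF maxid_maximal])
  fix p assume "p \<in> carrier S" "p \<notin> maxid"
  then obtain d x where p: "d \<in> D" "x \<in> M" "p = (d \<oplus> x, d)" "d \<notin> P 1" by (auto simp: maxid_def pairs_def)
  have xP: "x \<in> P 1" using M_P p by blast
  obtain \<delta> z where q: "\<delta> \<in> D" "z \<in> P r" "\<delta> \<in> P 1" "x \<otimes> x = \<delta> \<otimes> x \<oplus> z" using quad[OF p(2)] by blast
  have sub: "d \<oplus> y \<notin> P 1" if "y \<in> P 1" for y
  proof
    assume "d \<oplus> y \<in> P 1"
    then have "(d \<oplus> y) \<ominus> y \<in> P 1" using that by simp
    moreover have "(d \<oplus> y) \<ominus> y = d" using p that P_E[OF that] by (simp add: minus_eq a_assoc r_neg)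
    ultimately show False using p by simp
  qed
  have u: "d \<noteq> \<zero>" "inv d \<in> D" using D_unit p by auto
  have v: "d \<oplus> \<delta> \<noteq> \<zero>" "inv (d \<oplus> \<delta>) \<in> D" using D_unit[of "d \<oplus> \<delta>"] sub[OF q(3)] p q by auto
  have w: "d \<oplus> x \<noteq> \<zero>" "inv (d \<oplus> x) \<in> E" using E_unit[of "d \<oplus> x"] sub[OF xP] p M_E by auto
  define a b c where "a = inv d" and "b = inv (d \<oplus> \<delta>)" and "c = inv (d \<oplus> x)"
  have car: "d \<in> carrier R" "x \<in> carrier R" "z \<in> carrier R" "\<delta> \<in> carrier R" "a \<in> carrier R" "b \<in> carrier R" "c \<in> carrier R"
    using p q u v w M_E P_E by (auto simp: a_def b_def c_def)
  have e: "d \<otimes> a = \<one>" "b \<otimes> (d \<oplus> \<delta>) = \<one>" "(d \<oplus> x) \<otimes> c = \<one>"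
    using inv_inv_mult(4)[of d d] inv_inv_mult(5)[of "d \<oplus> \<delta>" d] inv_inv_mult(4)[of "d \<oplus> x" d] car u v w
    by (simp_all add: a_def b_def c_def)
  have "(d \<oplus> \<delta>) \<otimes> x = (d \<oplus> x) \<otimes> x \<ominus> (x \<otimes> x \<ominus> \<delta> \<otimes> x)" using car by algebra
  also have "x \<otimes> x \<ominus> \<delta> \<otimes> x = z" unfolding q(4) using car by algebra
  finally have 1: "(d \<oplus> \<delta>) \<otimes> x = (d \<oplus> x) \<otimes> x \<ominus> z" .
  have "x \<otimes> c = (b \<otimes> (d \<oplus> \<delta>)) \<otimes> (x \<otimes> c)" using e car by simp
  also have "\<dots> = b \<otimes> (((d \<oplus> \<delta>) \<otimes> x) \<otimes> c)" using car by algebra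
  also have "\<dots> = b \<otimes> (((d \<oplus> x) \<otimes> c) \<otimes> x \<ominus> c \<otimes> z)" unfolding 1 using car by algebra
  also have "\<dots> = b \<otimes> (x \<ominus> c \<otimes> z)" using e car by simp
  finally have xc: "x \<otimes> c = b \<otimes> (x \<ominus> c \<otimes> z)" .
  have "c \<otimes> z \<in> M" using w q Pr by (auto simp: c_def)
  then have xcM: "x \<otimes> c \<in> M" unfolding xc using M_closed p v by (simp add: b_def)
  \<comment> \<open>The inverse of p in A is (c, a). It belongs to the ring once c - a, which is -(x
    c) / d, lies in M.\<close>
  have "c \<ominus> a = (d \<otimes> a) \<otimes> c \<ominus> a \<otimes> ((d \<oplus> x) \<otimes> c)" using e car by simp
  also have "\<dots> = (\<ominus> a) \<otimes> (x \<otimes> c)" using car by algebra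
  also have "\<dots> \<in> M" using M_closed xcM u by (simp add: a_def)
  finally have "(c, a) \<in> pairs M" using pairs_pair car u by (simp add: a_def)
  moreover have "p \<otimes>\<^bsub>L\<^esub> (c, a) = \<one>\<^bsub>L\<^esub>" using p e by simp
  ultimately show "\<exists>y\<in>carrier S. p \<otimes>\<^bsub>S\<^esub> y = \<one>\<^bsub>S\<^esub>" by auto
qed

definition branch :: "('a \<times> 'a) set"
  where "branch = (\<lambda>x. (x, \<zero>)) ` M"

text \<open>This is the kernel of the second projection onto the domain D. It supplies the lower
  term of a chain of primes below \<open>maxid\<close>.\<close>

lemma branch_prime: "primeideal branch S"
proof (rule primeidealI)
  show "ideal branch S"
  proof (rule L.ideal_in_subringI[OF C_subring])
    show "branch \<subseteq> pairs M" using M_pairs by (auto simp: branch_def)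
    show "\<zero>\<^bsub>L\<^esub> \<in> branch" using M_closed by (auto simp: branch_def)
    show "p \<oplus>\<^bsub>L\<^esub> p' \<in> branch" if "p \<in> branch" "p' \<in> branch" for p p' using that M_closed by (auto simp: branch_def)
    show "p \<otimes>\<^bsub>L\<^esub> p' \<in> branch" if pm: "p \<in> pairs M" "p' \<in> branch" for p p'
    proof -
      obtain d x y where p: "d \<in> D" "x \<in> M" "p = (d \<oplus> x, d)" "y \<in> M" "p' = (y, \<zero>)"
        using pm unfolding branch_def pairs_def by blast
      have "(d \<oplus> x) \<otimes> y = d \<otimes> y \<oplus> x \<otimes> y" using p M_E by (simp add: l_distr)
      then show ?thesis using p M_closed M_mult by (simp add: branch_def)
    qed
  qed
  show "cring S" by (rule S.is_cring)
  show "carrier S \<noteq> branch" using diag_pairs[of \<one>] by (auto simp: branch_def)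
  fix p p' assume "p \<in> carrier S" "p' \<in> carrier S" and m: "p \<otimes>\<^bsub>S\<^esub> p' \<in> branch"
  then obtain d x d' x' where p: "d \<in> D" "x \<in> M" "p = (d \<oplus> x, d)" "d' \<in> D" "x' \<in> M" "p' = (d' \<oplus> x', d')"
    by (auto simp: pairs_def)
  then have "d \<otimes> d' = \<zero>" using m by (auto simp: branch_def)
  then have "d = \<zero> \<or> d' = \<zero>" using integral p D_carrier by blast
  then show "p \<in> branch \<or> p' \<in> branch" using p M_E by (auto simp: branch_def)
qed

lemma branch_maxid: "branch \<subset> maxid"
proof (rule psubsetI)
  show "branch \<subseteq> maxid" using maxid_pair_iff[of \<zero>] M_E by (auto simp: branch_def)
  have "(t, t) \<in> maxid" using maxid_pair_iff[of t \<zero>] M_closed PI[of \<one> 1] by simp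
  moreover have "(t, t) \<notin> branch" by (auto simp: branch_def)
  ultimately show "branch \<noteq> maxid" by blast
qed

lemma S_pow: "p [^]\<^bsub>S\<^esub> (n::nat) = p [^]\<^bsub>L\<^esub> n"
  by (simp add: nat_pow_def)

section \<open>Prime ideals and Krull dimension\<close>

context
  fixes r assumes Pr: "P r \<subseteq> M"
begin

text \<open>A high power of each element of M is t times an element of the ring, so a prime
  containing t contains M x 0, and thus \<open>maxid\<close>.\<close>

lemma prime_containing_t:
  assumes I: "primeideal I S" and tI: "(t, t) \<in> I"
  shows "I = maxid"
proof -
  interpret I: primeideal I S by (rule I)
  interpret J: maximalideal maxid S by (rule maxid_maximal)
  have "(x, \<zero>) \<in> I" if x: "x \<in> M" for x
  proof -
    have "x [^] (n::nat) \<in> P n" for n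
    proof (induction n)
      case 0 then show ?case by (simp add: P_0)
    next
      case (Suc n) then show ?case using P_mult[of "x [^] n" n x 1] M_P x by auto
    qed
    \<comment> \<open>The exponent is r + 1 because t^r is spent on making t^r y an element of M,
      and one factor t must remain.\<close>
    then obtain y where y: "y \<in> E" "x [^] (r + 1) = t [^] (r + 1) \<otimes> y" by (metis PE)
    have "t [^] r \<otimes> y \<in> M" using Pr y by auto
    then have "(t, t) \<otimes>\<^bsub>S\<^esub> (t [^] r \<otimes> y, \<zero>) \<in> I" using I.I_r_closed[OF tI, of "(t [^] r \<otimes> y, \<zero>)"] M_pairs by simp
    also have "(t, t) \<otimes>\<^bsub>S\<^esub> (t [^] r \<otimes> y, \<zero>) = (x, \<zero>) [^]\<^bsub>S\<^esub> (r + 1)"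
    proof -
      have "t \<otimes> (t [^] r \<otimes> y) = x [^] (r + 1)"
        unfolding y(2) using tpow_add[of 1 r] y(1) by (simp add: m_assoc add.commute)
      moreover have "\<zero> [^] (r + 1) = \<zero>" by simp
      ultimately show ?thesis unfolding S_pow L_pow by simp
    qed
    finally show ?thesis using I.nat_pow_mem[of "(x, \<zero>)" "r + 1"] M_pairs x by simp
  qed
  moreover have "(d, d) \<in> I" if d: "d \<in> D" "d \<in> P 1" for d
  proof -
    obtain c where c: "c \<in> D" "d = t [^] (1::nat) \<otimes> c" using D_Int_P[OF d] by blast
    then have "(t, t) \<otimes>\<^bsub>S\<^esub> (c, c) \<in> I" using I.I_r_closed[OF tI, of "(c, c)"] diag_pairs by simp
    then show ?thesis using c by simp
  qed
  ultimately have "(d, d) \<oplus>\<^bsub>S\<^esub> (x, \<zero>) \<in> I" if "d \<in> D" "d \<in> P 1" "x \<in> M" for d x using I.a_closed that by blast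
  then have "maxid \<subseteq> I" unfolding maxid_def by auto
  then show ?thesis using J.I_maximal[OF I.ideal_axioms] I.a_subset I.I_notcarr by auto
qed

lemma prime_not_containing_t:
  assumes I: "primeideal I S" and tI: "(t, t) \<notin> I" and d: "d \<in> D" "d \<noteq> \<zero>"
  shows "(d, d) \<notin> I"
proof
  interpret I: primeideal I S by (rule I)
  assume dI: "(d, d) \<in> I"
  obtain n u where u: "u \<in> D" "u \<noteq> \<zero>" "inv u \<in> D" "d = t [^] (n::nat) \<otimes> u" using D_val d by metis
  have "(d, d) \<otimes>\<^bsub>S\<^esub> (inv u, inv u) \<in> I" using I.I_r_closed[OF dI, of "(inv u, inv u)"] diag_pairs[OF u(3)] by simp
  moreover have "d \<otimes> inv u = t [^] n" using u inv_inv_mult(4)[of u u] by (simp add: m_assoc)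
  ultimately have "(t, t) [^]\<^bsub>S\<^esub> n \<in> I" unfolding S_pow by simp
  then show False using I.nat_pow_mem[of "(t, t)" n] diag_pairs[of t] tI by simp
qed

text \<open>Primes avoiding t come from the two factors of the localization at t. Concretely, each
  way for I to contain half of the product (T, 0)(0, T) = 0 puts a nonzero diagonal element into the
  larger prime.\<close>

lemma no_prime_chain:
  assumes I: "primeideal I S" and I': "primeideal I' S" and sub: "I \<subset> I'" and tI: "(t, t) \<notin> I'"
  shows False
proof -
  interpret I: primeideal I S by (rule I)
  interpret I': primeideal I' S by (rule I')
  have tI0: "(t, t) \<notin> I" using tI sub by blast
  obtain p where p: "p \<in> I'" "p \<notin> I" using sub by blast
  have pc: "p \<in> pairs M" using I'.a_subset p by auto
  then obtain d x where dx: "d \<in> D" "x \<in> M" "p = (d \<oplus> x, d)" by (rule pairsE)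
  have car: "d \<in> carrier R" "x \<in> carrier R" using dx M_E by auto
  \<comment> \<open>Since \<open>P r\<close> lies in M, the multiples (T, 0) and (0, T) of the two
    idempotents belong to the ring.\<close>
  define T where "T = t [^] r"
  have T: "T \<in> D" "T \<noteq> \<zero>" "T \<in> P r" by (simp_all add: T_def) (use PI[of \<one> r] in simp)
  have TM: "T \<otimes> y \<in> M" if "y \<in> E" for y using Pr that unfolding T_def by auto
  have eps: "(T, \<zero>) \<in> pairs M" "(\<zero>, T) \<in> pairs M"
  proof -
    have "T \<in> M" using Pr T(3) by blast
    then show "(T, \<zero>) \<in> pairs M" by (rule M_pairs)
    have "\<ominus> T \<in> M" using \<open>T \<in> M\<close> by (rule M_closed(4))
    then show "(\<zero>, T) \<in> pairs M" using pairs_pair[of \<zero> T] T by (simp add: minus_eq)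
  qed
  have TnI: "(T, T) \<notin> I" using prime_not_containing_t[OF I tI0] T by simp
  have "(T, \<zero>) \<otimes>\<^bsub>S\<^esub> (\<zero>, T) \<in> I" using T I.zero_closed by simp
  then consider "(T, \<zero>) \<in> I" | "(\<zero>, T) \<in> I" using I.I_prime[of "(T, \<zero>)" "(\<zero>, T)"] eps by auto
  then show False
  proof cases
    \<comment> \<open>Here I contains M x 0, so removing the M-part of p leaves (d, d) in I', with d
      nonzero as p is not in I.\<close>
    case 1
    have "(T, \<zero>) \<otimes>\<^bsub>S\<^esub> (x, \<zero>) \<in> I" using I.I_r_closed[OF 1, of "(x, \<zero>)"] M_pairs dx by simp
    then have "(T, T) \<otimes>\<^bsub>S\<^esub> (x, \<zero>) \<in> I" using T by simp
    then have xI: "(x, \<zero>) \<in> I" using I.I_prime[of "(T, T)" "(x, \<zero>)"] TnI diag_pairs M_pairs T dx by auto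
    have "d \<noteq> \<zero>" using xI p dx car by auto
    have "p \<oplus>\<^bsub>S\<^esub> (\<ominus>\<^bsub>S\<^esub> (x, \<zero>)) \<in> I'" using I'.a_closed p xI sub I'.a_inv_closed by blast
    moreover have "\<ominus>\<^bsub>S\<^esub> (x, \<zero>) = (\<ominus> x, \<zero>)"
      using L.subring_uminus[OF C_subring M_pairs[OF dx(2)]] car D_K[of \<zero>] by simp
    moreover have "(d \<oplus> x) \<oplus> \<ominus> x = d" using car by (simp add: a_assoc r_neg)
    ultimately have "(d, d) \<in> I'" using dx by simp
    then show False using prime_not_containing_t[OF I' tI dx(1) \<open>d \<noteq> \<zero>\<close>] by blast
  next
    \<comment> \<open>Here the first coordinate of p is nonzero. Scaling p gives (t^n T, 0) in I',
      and adding (0, t^n T) yields a diagonal element.\<close>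
    case 2
    have "d \<oplus> x \<noteq> \<zero>"
    proof
      assume z: "d \<oplus> x = \<zero>"
      have "(\<zero>, T) \<otimes>\<^bsub>S\<^esub> p \<in> I" using I.I_r_closed[OF 2, of p] pc by simp
      then have "(T, T) \<otimes>\<^bsub>S\<^esub> p \<in> I" using dx z T by simp
      then have "p \<in> I" using I.I_prime[of "(T, T)" p] TnI diag_pairs T pc by auto
      then show False using p by blast
    qed
    then obtain n u where u: "u \<in> E" "u \<noteq> \<zero>" "inv u \<in> E" "d \<oplus> x = t [^] (n::nat) \<otimes> u"
      using E_val[of "d \<oplus> x"] dx M_E by auto
    have "(T \<otimes> inv u, \<zero>) \<in> pairs M" using M_pairs TM u by blast
    then have "p \<otimes>\<^bsub>S\<^esub> (T \<otimes> inv u, \<zero>) \<in> I'" using I'.I_r_closed[OF p(1), of "(T \<otimes> inv u, \<zero>)"] by simp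
    moreover have "(t [^] n \<otimes> u) \<otimes> (T \<otimes> inv u) = t [^] n \<otimes> T"
    proof -
      have "(t [^] n \<otimes> u) \<otimes> (T \<otimes> inv u) = t [^] n \<otimes> T \<otimes> (u \<otimes> inv u)"
        using T u by (simp add: m_ac)
      then show ?thesis using inv_inv_mult(4)[of u u] u T by simp
    qed
    ultimately have 3: "(t [^] n \<otimes> T, \<zero>) \<in> I'" using dx u by simp
    have "(\<zero>, T) \<otimes>\<^bsub>S\<^esub> (t [^] n, t [^] n) \<in> I'" using I'.I_r_closed[of "(\<zero>, T)" "(t [^] n, t [^] n)"] 2 sub diag_pairs by auto
    then have "(\<zero>, t [^] n \<otimes> T) \<in> I'" using T by (simp add: m_comm)
    then have "(t [^] n \<otimes> T, \<zero>) \<oplus>\<^bsub>S\<^esub> (\<zero>, t [^] n \<otimes> T) \<in> I'" using 3 I'.a_closed by blast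
    then have "(t [^] n \<otimes> T, t [^] n \<otimes> T) \<in> I'" using T by simp
    moreover have "t [^] n \<otimes> T \<noteq> \<zero>" using T integral_iff by simp
    ultimately show False using prime_not_containing_t[OF I' tI, of "t [^] n \<otimes> T"] T by simp
  qed
qed

lemma krull_dim_pairs: "krull_dim S = 1"
proof (rule krull_dim_eq_1[OF branch_prime _ branch_maxid])
  show "primeideal maxid S" using maxid_maximal S.maximalideal_prime by blast
  fix I0 I1 I2 assume I: "primeideal I0 S" "primeideal I1 S" "primeideal I2 S" "I0 \<subset> I1"
  show "\<not> I1 \<subset> I2"
  proof
    assume "I1 \<subset> I2"
    moreover have "(t, t) \<in> I1" using no_prime_chain I by blast
    ultimately have "I1 = maxid" "I2 = maxid" using prime_containing_t I by auto
    then show False using \<open>I1 \<subset> I2\<close> by blast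
  qed
qed

end

end

section \<open>Finite generation of submodules over D\<close>

context dvr_pair begin

lemma minimal_valuation:
  assumes A: "A \<subseteq> D" "\<not> A \<subseteq> {\<zero>}"
  shows "\<exists>a\<in>A. \<forall>d\<in>A. \<exists>c\<in>D. d = c \<otimes> a"
proof -
  let ?Q = "\<lambda>n. \<exists>u\<in>D. u \<noteq> \<zero> \<and> inv u \<in> D \<and> t [^] (n::nat) \<otimes> u \<in> A"
  define n where "n = (LEAST n. ?Q n)"
  have val: "\<exists>n u. u \<in> D \<and> u \<noteq> \<zero> \<and> inv u \<in> D \<and> d = t [^] (n::nat) \<otimes> u" if "d \<in> A" "d \<noteq> \<zero>" for d
    using D_val[of d] that A(1) by blast
  obtain d where "d \<in> A" "d \<noteq> \<zero>" using A(2) by blast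
  then have "\<exists>n. ?Q n" using val by blast
  then have "?Q n" unfolding n_def by (rule LeastI_ex)
  then obtain u where u: "u \<in> D" "u \<noteq> \<zero>" "inv u \<in> D" "t [^] n \<otimes> u \<in> A" by blast
  have "\<exists>c\<in>D. d = c \<otimes> (t [^] n \<otimes> u)" if d: "d \<in> A" for d
  proof (cases "d = \<zero>")
    case True
    then show ?thesis using u by (intro bexI[of _ \<zero>]) simp_all
  next
    case False
    then obtain m v where v: "v \<in> D" "v \<noteq> \<zero>" "inv v \<in> D" "d = t [^] (m::nat) \<otimes> v" using val d by blast
    then have "n \<le> m" unfolding n_def using d by (intro Least_le) blast
    then have e: "t [^] m = t [^] (m - n) \<otimes> t [^] n" using tpow_add[of "m - n" n] by simp
    have c: "v \<in> carrier R" "u \<in> carrier R" "inv u \<in> carrier R" "t [^] n \<in> carrier R" "t [^] (m - n) \<in> carrier R"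
      using u v by auto
    have "(t [^] (m - n) \<otimes> (v \<otimes> inv u)) \<otimes> (t [^] n \<otimes> u) = t [^] (m - n) \<otimes> t [^] n \<otimes> v \<otimes> (u \<otimes> inv u)"
      using c by algebra
    also have "\<dots> = d" using inv_inv_mult(4)[of u u] u c v(4) e by simp
    finally show ?thesis using u v by (intro bexI[of _ "t [^] (m - n) \<otimes> (v \<otimes> inv u)"]) simp_all
  qed
  then show ?thesis using u by blast
qed

end

context two_branches begin

definition D_module :: "('a \<times> 'a) set \<Rightarrow> bool"
  where "D_module N \<longleftrightarrow> N \<subseteq> carrier L \<and> \<zero>\<^bsub>L\<^esub> \<in> N \<and> (\<forall>p\<in>N. \<forall>q\<in>N. p \<oplus>\<^bsub>L\<^esub> q \<in> N) \<and>
    (\<forall>d\<in>D. \<forall>p\<in>N. (d, d) \<otimes>\<^bsub>L\<^esub> p \<in> N)"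

lemma D_moduleD:
  assumes "D_module N"
  shows "\<And>p. p \<in> N \<Longrightarrow> p \<in> carrier L" "\<zero>\<^bsub>L\<^esub> \<in> N" "\<And>p q. p \<in> N \<Longrightarrow> q \<in> N \<Longrightarrow> p \<oplus>\<^bsub>L\<^esub> q \<in> N"
    "\<And>d p. d \<in> D \<Longrightarrow> p \<in> N \<Longrightarrow> (d, d) \<otimes>\<^bsub>L\<^esub> p \<in> N"
  using assms unfolding D_module_def by blast+

text \<open>Generation is expressed by minimality among the D-modules containing G, which avoids
  linear combinations.\<close>

definition fin_gen :: "('a \<times> 'a) set \<Rightarrow> bool"
  where "fin_gen N \<longleftrightarrow> (\<exists>G\<subseteq>N. finite G \<and> (\<forall>Z. D_module Z \<longrightarrow> G \<subseteq> Z \<longrightarrow> N \<subseteq> Z))"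

text \<open>Inductive step from Q to Q + D g. The coefficients of g occurring in N are multiples of
  one of them, so N is generated by N \<inter> Q and one element realizing that coefficient.\<close>

lemma fin_gen_step:
  assumes Q: "D_module Q" and IH: "\<And>N. D_module N \<Longrightarrow> N \<subseteq> Q \<Longrightarrow> fin_gen N"
    and g: "g \<in> carrier L" and N: "D_module N" and sub: "\<And>n. n \<in> N \<Longrightarrow> \<exists>p\<in>Q. \<exists>d\<in>D. n = p \<oplus>\<^bsub>L\<^esub> (d, d) \<otimes>\<^bsub>L\<^esub> g"
  shows "fin_gen N"
proof -
  note n = D_moduleD[OF N] and q = D_moduleD[OF Q]
  define A where "A = {d \<in> D. \<exists>p\<in>Q. p \<oplus>\<^bsub>L\<^esub> (d, d) \<otimes>\<^bsub>L\<^esub> g \<in> N}"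
  have dL: "(d, d) \<in> carrier L" if "d \<in> D" for d using that D_K by auto
  show ?thesis
  proof (cases "A \<subseteq> {\<zero>}")
    case True
    have "N \<subseteq> Q"
    proof
      fix x assume x: "x \<in> N"
      obtain p d where p: "p \<in> Q" "d \<in> D" "x = p \<oplus>\<^bsub>L\<^esub> (d, d) \<otimes>\<^bsub>L\<^esub> g" using sub[OF x] by blast
      then have "d \<in> A" using x by (auto simp: A_def)
      then have d0: "(d, d) = \<zero>\<^bsub>L\<^esub>" using True by auto
      have "x = p" unfolding p(3) d0 using q(1)[OF p(1)] g by (simp only: L.l_null L.r_zero)
      then show "x \<in> Q" using p by simp
    qed
    then show ?thesis using IH N by blast
  next
    case False
    have "A \<subseteq> D" by (auto simp: A_def)
    then obtain a where a: "a \<in> A" "\<And>d. d \<in> A \<Longrightarrow> \<exists>c\<in>D. d = c \<otimes> a" using minimal_valuation[OF _ False] by blast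
    obtain p0 where p0: "p0 \<in> Q" "p0 \<oplus>\<^bsub>L\<^esub> (a, a) \<otimes>\<^bsub>L\<^esub> g \<in> N" and aD: "a \<in> D" using a(1) by (auto simp: A_def)
    define n0 where "n0 = p0 \<oplus>\<^bsub>L\<^esub> (a, a) \<otimes>\<^bsub>L\<^esub> g"
    have "D_module (N \<inter> Q)" using N Q unfolding D_module_def by blast
    then have "fin_gen (N \<inter> Q)" using IH by blast
    then obtain G where G: "G \<subseteq> N \<inter> Q" "finite G" "\<And>Z. D_module Z \<Longrightarrow> G \<subseteq> Z \<Longrightarrow> N \<inter> Q \<subseteq> Z"
      unfolding fin_gen_def by blast
    have "N \<subseteq> Z" if Z: "D_module Z" "insert n0 G \<subseteq> Z" for Z
    proof
      fix x assume x: "x \<in> N"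
      obtain p d where p: "p \<in> Q" "d \<in> D" "x = p \<oplus>\<^bsub>L\<^esub> (d, d) \<otimes>\<^bsub>L\<^esub> g" using sub[OF x] by blast
      then have "d \<in> A" using x by (auto simp: A_def)
      then obtain c where c: "c \<in> D" "d = c \<otimes> a" using a(2) by blast
      define C e where "C = (c, c)" and "e = (a, a)"
      have dd: "(d, d) = C \<otimes>\<^bsub>L\<^esub> e" using c by (simp add: C_def e_def)
      have car: "C \<in> carrier L" "e \<in> carrier L" "p \<in> carrier L" "p0 \<in> carrier L"
        using dL c aD q(1) p p0 by (auto simp: C_def e_def)
      have uC: "(\<ominus> c, \<ominus> c) = \<ominus>\<^bsub>L\<^esub> C" using c D_K by (simp add: C_def)
      \<comment> \<open>Removing c times n0 cancels the coordinate at g, so the remainder lies in N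
        \<inter> Q and is covered by G.\<close>
      define w where "w = x \<oplus>\<^bsub>L\<^esub> (\<ominus>\<^bsub>L\<^esub> C) \<otimes>\<^bsub>L\<^esub> n0"
      have cD: "\<ominus> c \<in> D" using c by simp
      have "w \<in> N" unfolding w_def uC[symmetric] using n(3)[OF x n(4)[OF cD]] p0 by (simp add: n0_def)
      moreover have "w = p \<oplus>\<^bsub>L\<^esub> (\<ominus>\<^bsub>L\<^esub> C) \<otimes>\<^bsub>L\<^esub> p0"
        unfolding w_def p(3) n0_def dd e_def[symmetric] using car g by (intro L.eliminate_generator)
      then have "w \<in> Q" unfolding uC[symmetric] using q(3)[OF p(1) q(4)[OF cD p0(1)]] by simp
      ultimately have wZ: "w \<in> Z" using G(3)[OF Z(1)] Z(2) by blast
      have n0Z: "n0 \<in> Z" using Z by blast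
      have n0c: "n0 \<in> carrier L" using D_moduleD(1)[OF Z(1) n0Z] .
      have xc: "x \<in> carrier L" using n(1) x by blast
      have "x = w \<oplus>\<^bsub>L\<^esub> C \<otimes>\<^bsub>L\<^esub> n0" unfolding w_def using xc n0c car by (intro L.restore_generator[symmetric])
      then show "x \<in> Z" using D_moduleD(3)[OF Z(1) wZ D_moduleD(4)[OF Z(1) c(1) n0Z]] by (simp add: C_def)
    qed
    then show ?thesis unfolding fin_gen_def using G p0 by (intro exI[of _ "insert n0 G"]) (auto simp: n0_def)
  qed
qed

end

context cubic_order begin

text \<open>The filtration 0, D c, M x 0, D + (M x 0) adds one generator at a time, so
  \<open>fin_gen_step\<close> applies three times. Ideals are D-modules through the diagonal, and a
  generating set over D also generates as an ideal.\<close>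

lemma noetherian_pairs:
  assumes basis: "basis2 M b c"
  shows "noetherian_ring S"
proof (rule S.noetherian_ringI)
  note bc = basis2D[OF basis]
  have z: "\<zero> \<in> K" using D_K by simp
  have Q0: "fin_gen N" if "D_module N" "N \<subseteq> {\<zero>\<^bsub>L\<^esub>}" for N
    unfolding fin_gen_def using that D_moduleD(2) by (intro exI[of _ "{}"]) auto
  have D0: "D_module {\<zero>\<^bsub>L\<^esub>}" unfolding D_module_def using z by auto
  let ?Q1 = "{(y \<otimes> c, \<zero>) | y. y \<in> D}"
  have D1: "D_module ?Q1" unfolding D_module_def
  proof (intro conjI ballI)
    show "?Q1 \<subseteq> carrier L" using bc z by auto
    show "\<zero>\<^bsub>L\<^esub> \<in> ?Q1" using bc by (auto intro!: exI[of _ \<zero>])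
    show "p \<oplus>\<^bsub>L\<^esub> p' \<in> ?Q1" if "p \<in> ?Q1" "p' \<in> ?Q1" for p p'
    proof -
      obtain y y' where "y \<in> D" "p = (y \<otimes> c, \<zero>)" "y' \<in> D" "p' = (y' \<otimes> c, \<zero>)" using \<open>p \<in> ?Q1\<close> \<open>p' \<in> ?Q1\<close> by auto
      then show ?thesis using bc by (auto simp: l_distr intro!: exI[of _ "y \<oplus> y'"])
    qed
    show "(d, d) \<otimes>\<^bsub>L\<^esub> p \<in> ?Q1" if "d \<in> D" "p \<in> ?Q1" for d p
    proof -
      obtain y where "y \<in> D" "p = (y \<otimes> c, \<zero>)" using \<open>p \<in> ?Q1\<close> by auto
      then show ?thesis using bc \<open>d \<in> D\<close> by (auto simp: m_assoc intro!: exI[of _ "d \<otimes> y"])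
    qed
  qed
  have Q1: "fin_gen N" if N: "D_module N" "N \<subseteq> ?Q1" for N
  proof (rule fin_gen_step[OF D0 Q0 _ N(1), of "(c, \<zero>)"])
    show "(c, \<zero>) \<in> carrier L" using bc z by simp
    fix n assume "n \<in> N"
    then obtain y where "y \<in> D" "n = (y \<otimes> c, \<zero>)" using N(2) by blast
    then show "\<exists>p\<in>{\<zero>\<^bsub>L\<^esub>}. \<exists>d\<in>D. n = p \<oplus>\<^bsub>L\<^esub> (d, d) \<otimes>\<^bsub>L\<^esub> (c, \<zero>)" using bc by auto
  qed
  have D2: "D_module branch" unfolding D_module_def
    using M_closed M_E z by (auto simp: branch_def)
  have Q2: "fin_gen N" if N: "D_module N" "N \<subseteq> branch" for N
  proof (rule fin_gen_step[OF D1 Q1 _ N(1), of "(b, \<zero>)"])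
    show "(b, \<zero>) \<in> carrier L" using bc z by simp
    fix n assume "n \<in> N"
    then obtain x where "x \<in> M" "n = (x, \<zero>)" using N(2) by (auto simp: branch_def)
    then obtain d e where "d \<in> D" "e \<in> D" "n = (d \<otimes> b \<oplus> e \<otimes> c, \<zero>)" unfolding bc(3) by blast
    then have "n = (e \<otimes> c, \<zero>) \<oplus>\<^bsub>L\<^esub> (d, d) \<otimes>\<^bsub>L\<^esub> (b, \<zero>)" using bc by (simp add: a_comm)
    then show "\<exists>p\<in>?Q1. \<exists>d\<in>D. n = p \<oplus>\<^bsub>L\<^esub> (d, d) \<otimes>\<^bsub>L\<^esub> (b, \<zero>)" using \<open>d \<in> D\<close> \<open>e \<in> D\<close> by blast
  qed auto
  have Q3: "fin_gen N" if N: "D_module N" "N \<subseteq> pairs M" for N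
  proof (rule fin_gen_step[OF D2 Q2 _ N(1), of "\<one>\<^bsub>L\<^esub>"])
    show "\<one>\<^bsub>L\<^esub> \<in> carrier L" by (rule L.one_closed)
    fix n assume "n \<in> N"
    then obtain d x where d: "d \<in> D" "x \<in> M" "n = (d \<oplus> x, d)" using N(2) by (blast elim: pairsE)
    then have "n = (x, \<zero>) \<oplus>\<^bsub>L\<^esub> (d, d) \<otimes>\<^bsub>L\<^esub> \<one>\<^bsub>L\<^esub>" using M_E by (simp add: a_comm)
    moreover have "(x, \<zero>) \<in> branch" using d by (simp add: branch_def)
    ultimately show "\<exists>p\<in>branch. \<exists>d\<in>D. n = p \<oplus>\<^bsub>L\<^esub> (d, d) \<otimes>\<^bsub>L\<^esub> \<one>\<^bsub>L\<^esub>" using d by blast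
  qed auto
  have CL: "pairs M \<subseteq> carrier L" using subringE(1)[OF C_subring] .
  have ideal_D_module: "D_module I" if I: "ideal I S" for I
  proof -
    interpret I: ideal I S by (rule I)
    show ?thesis unfolding D_module_def
    proof (intro conjI ballI)
      show "I \<subseteq> carrier L" using I.a_subset CL by auto
      show "\<zero>\<^bsub>L\<^esub> \<in> I" using I.zero_closed by simp
      show "p \<oplus>\<^bsub>L\<^esub> q \<in> I" if "p \<in> I" "q \<in> I" for p q using I.a_closed[OF that] by simp
      show "(d, d) \<otimes>\<^bsub>L\<^esub> p \<in> I" if "d \<in> D" "p \<in> I" for d p
        using I.I_l_closed[OF that(2), of "(d, d)"] diag_pairs[OF that(1)] by simp
    qed
  qed
  fix I assume I: "ideal I S"
  have IC: "I \<subseteq> pairs M" using ideal.Icarr[OF I] by auto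
  then obtain G where G: "G \<subseteq> I" "finite G" "\<And>Z. D_module Z \<Longrightarrow> G \<subseteq> Z \<Longrightarrow> I \<subseteq> Z"
    using Q3[OF ideal_D_module[OF I]] unfolding fin_gen_def by blast
  have GS: "G \<subseteq> carrier S" using G IC by auto
  have "I \<subseteq> Idl\<^bsub>S\<^esub> G" using G(3)[OF ideal_D_module[OF S.genideal_ideal[OF GS]] S.genideal_self[OF GS]] .
  moreover have "Idl\<^bsub>S\<^esub> G \<subseteq> I" using S.genideal_minimal[OF I G(1)] .
  ultimately show "\<exists>A\<subseteq>carrier S. finite A \<and> I = Idl\<^bsub>S\<^esub> A" using G GS by blast
qed

section \<open>The square of the maximal ideal and the embedding dimension\<close>

definition tM :: "'a set"
  where "tM = {t \<otimes> x | x. x \<in> M}"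

lemma tM_add: "x \<in> tM \<Longrightarrow> y \<in> tM \<Longrightarrow> x \<oplus> y \<in> tM"
proof -
  assume "x \<in> tM" "y \<in> tM"
  then obtain a b where "a \<in> M" "x = t \<otimes> a" "b \<in> M" "y = t \<otimes> b" by (auto simp: tM_def)
  then have "x \<oplus> y = t \<otimes> (a \<oplus> b)" "a \<oplus> b \<in> M" using M_closed M_E by (simp_all add: r_distr)
  then show ?thesis by (auto simp: tM_def)
qed

lemma tM_smult: "d \<in> D \<Longrightarrow> x \<in> tM \<Longrightarrow> d \<otimes> x \<in> tM"
proof -
  assume d: "d \<in> D" and "x \<in> tM"
  then obtain a where "a \<in> M" "x = t \<otimes> a" by (auto simp: tM_def)
  then have "d \<otimes> x = t \<otimes> (d \<otimes> a)" "d \<otimes> a \<in> M" using M_closed M_E d by (simp_all add: m_lcomm)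
  then show ?thesis by (auto simp: tM_def)
qed

lemma M_tM: "x \<in> M \<Longrightarrow> t \<otimes> x \<in> tM"
  by (auto simp: tM_def)

lemma tM_M: "x \<in> tM \<Longrightarrow> x \<in> M"
  using M_closed by (auto simp: tM_def)

text \<open>Upper bound for \<open>J\<^sup>2\<close>: it suffices to bound the products of elements of \<open>M\<close>.\<close>

lemma maxid_square_subset:
  assumes W: "\<And>x y. x \<in> W \<Longrightarrow> y \<in> W \<Longrightarrow> x \<oplus> y \<in> W" "W \<subseteq> M" "tM \<subseteq> W"
    and prod: "\<And>x y. x \<in> M \<Longrightarrow> y \<in> M \<Longrightarrow> x \<otimes> y \<in> W"
    and p: "p \<in> maxid \<cdot>\<^bsub>S\<^esub> maxid"
  shows "\<exists>d\<in>D. \<exists>w\<in>W. p = (t \<otimes> (t \<otimes> d) \<oplus> w, t \<otimes> (t \<otimes> d))"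
  using p
proof (induction p rule: ideal_prod.induct)
  case (prod p p')
  then obtain d x d' x' where q: "d \<in> D" "d \<in> P 1" "x \<in> M" "p = (d \<oplus> x, d)"
      "d' \<in> D" "d' \<in> P 1" "x' \<in> M" "p' = (d' \<oplus> x', d')"
    unfolding maxid_def by blast
  obtain e e' where e: "e \<in> D" "d = t \<otimes> e" "e' \<in> D" "d' = t \<otimes> e'"
    using D_Int_P[of d 1] D_Int_P[of d' 1] q by auto
  have c: "e \<in> carrier R" "e' \<in> carrier R" "x \<in> carrier R" "x' \<in> carrier R" "t \<in> carrier R" using e q M_E by auto
  have "(d \<oplus> x) \<otimes> (d' \<oplus> x') = t \<otimes> (t \<otimes> (e \<otimes> e')) \<oplus> ((t \<otimes> (e \<otimes> x') \<oplus> t \<otimes> (e' \<otimes> x)) \<oplus> x \<otimes> x')"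
    "d \<otimes> d' = t \<otimes> (t \<otimes> (e \<otimes> e'))"
    unfolding e using c by algebra+
  then have "p \<otimes>\<^bsub>S\<^esub> p' = (t \<otimes> (t \<otimes> (e \<otimes> e')) \<oplus> ((t \<otimes> (e \<otimes> x') \<oplus> t \<otimes> (e' \<otimes> x)) \<oplus> x \<otimes> x'), t \<otimes> (t \<otimes> (e \<otimes> e')))"
    using q by simp
  moreover have "t \<otimes> (e \<otimes> x') \<in> W" "t \<otimes> (e' \<otimes> x) \<in> W"
    using M_tM[of "e \<otimes> x'"] M_tM[of "e' \<otimes> x"] M_closed q e W(3) by auto
  then have "(t \<otimes> (e \<otimes> x') \<oplus> t \<otimes> (e' \<otimes> x)) \<oplus> x \<otimes> x' \<in> W" using W(1) assms(4) q by simp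
  ultimately show ?case using e by (intro bexI[of _ "e \<otimes> e'"] bexI) auto
next
  case (sum p p')
  then obtain d w d' w' where q: "d \<in> D" "w \<in> W" "p = (t \<otimes> (t \<otimes> d) \<oplus> w, t \<otimes> (t \<otimes> d))"
     "d' \<in> D" "w' \<in> W" "p' = (t \<otimes> (t \<otimes> d') \<oplus> w', t \<otimes> (t \<otimes> d'))" by blast
  have c: "d \<in> carrier R" "d' \<in> carrier R" "w \<in> carrier R" "w' \<in> carrier R" "t \<in> carrier R"
    using q M_E W(2) by auto
  have "(t \<otimes> (t \<otimes> d) \<oplus> w) \<oplus> (t \<otimes> (t \<otimes> d') \<oplus> w') = t \<otimes> (t \<otimes> (d \<oplus> d')) \<oplus> (w \<oplus> w')"
    "t \<otimes> (t \<otimes> d) \<oplus> t \<otimes> (t \<otimes> d') = t \<otimes> (t \<otimes> (d \<oplus> d'))" using c by algebra+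
  then have "p \<oplus>\<^bsub>S\<^esub> p' = (t \<otimes> (t \<otimes> (d \<oplus> d')) \<oplus> (w \<oplus> w'), t \<otimes> (t \<otimes> (d \<oplus> d')))"
    using q by simp
  then show ?case using q W(1)[OF q(2,5)] by (intro bexI[of _ "d \<oplus> d'"] bexI[of _ "w \<oplus> w'"]) auto
qed

text \<open>Comparing second coordinates gives d1 t in t^2 D, so d1 is divisible by t. The first
  coordinate then places x in W. The term y absorbs the products caused by the M-parts of the
  coefficients.\<close>

lemma relation_mod_square:
  assumes W: "\<And>x y. x \<in> W \<Longrightarrow> y \<in> W \<Longrightarrow> x \<oplus> y \<in> W" "W \<subseteq> M" "tM \<subseteq> W"
    and prod: "\<And>x y. x \<in> M \<Longrightarrow> y \<in> M \<Longrightarrow> x \<otimes> y \<in> W"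
    and neg: "\<And>x. x \<in> W \<Longrightarrow> \<ominus> x \<in> W"
    and d1: "d1 \<in> D" "m1 \<in> M" and x: "x \<in> M" "y \<in> W"
    and rel: "(d1 \<oplus> m1, d1) \<otimes>\<^bsub>L\<^esub> (t, t) \<oplus>\<^bsub>L\<^esub> (x \<oplus> y, \<zero>) \<in> maxid \<cdot>\<^bsub>S\<^esub> maxid"
  shows "d1 \<in> P 1 \<and> x \<in> W"
proof -
  obtain d w where d: "d \<in> D" "w \<in> W"
    "(d1 \<oplus> m1, d1) \<otimes>\<^bsub>L\<^esub> (t, t) \<oplus>\<^bsub>L\<^esub> (x \<oplus> y, \<zero>) = (t \<otimes> (t \<otimes> d) \<oplus> w, t \<otimes> (t \<otimes> d))"
    using maxid_square_subset[OF W prod rel] by blast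
  have c: "d \<in> carrier R" "d1 \<in> carrier R" "m1 \<in> carrier R" "w \<in> carrier R" "x \<in> carrier R" "y \<in> carrier R" "t \<in> carrier R"
    using d d1 x M_E W(2) by auto
  have e: "(d1 \<oplus> m1) \<otimes> t \<oplus> (x \<oplus> y) = t \<otimes> (t \<otimes> d) \<oplus> w" "d1 \<otimes> t = t \<otimes> (t \<otimes> d)" using d(3) c by simp_all
  have "t \<otimes> d1 = t \<otimes> (t \<otimes> d)" using e(2) c by (simp add: m_comm)
  then have d1t: "d1 = t \<otimes> d" using m_lcancel[of t d1 "t \<otimes> d"] c by simp
  then have "d1 \<in> P 1" using PI[of d 1] d by simp
  moreover have "x = ((d1 \<oplus> m1) \<otimes> t \<oplus> (x \<oplus> y)) \<ominus> (d1 \<oplus> m1) \<otimes> t \<ominus> y" using c by algebra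
  then have "x = t \<otimes> (t \<otimes> d) \<oplus> w \<ominus> (d1 \<oplus> m1) \<otimes> t \<ominus> y" unfolding e(1) .
  then have "x = w \<oplus> (\<ominus> (t \<otimes> m1) \<oplus> \<ominus> y)" unfolding d1t using c by algebra
  moreover have "t \<otimes> m1 \<in> W" using M_tM d1 W(3) by blast
  ultimately show ?thesis using W(1) neg d x by simp
qed

text \<open>The module t M has basis t b, t c, and coordinates are unique.\<close>

lemma coefficient_in_P1:
  assumes basis: "basis2 M b c" and x: "x \<in> D" "y \<in> D" and xt: "x \<otimes> b \<oplus> y \<otimes> c \<in> tM"
  shows "x \<in> P 1 \<and> y \<in> P 1"
proof -
  note bc = basis2D[OF basis]
  obtain m where m: "m \<in> M" "x \<otimes> b \<oplus> y \<otimes> c = t \<otimes> m" using xt by (auto simp: tM_def)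
  obtain u v where u: "u \<in> D" "v \<in> D" "m = u \<otimes> b \<oplus> v \<otimes> c" using m(1) unfolding bc(3) by blast
  have car: "b \<in> carrier R" "c \<in> carrier R" "x \<in> carrier R" "y \<in> carrier R" "u \<in> carrier R" "v \<in> carrier R" "t \<in> carrier R"
    using bc x u by auto
  have "(x \<ominus> t \<otimes> u) \<otimes> b \<oplus> (y \<ominus> t \<otimes> v) \<otimes> c = (x \<otimes> b \<oplus> y \<otimes> c) \<ominus> t \<otimes> (u \<otimes> b \<oplus> v \<otimes> c)" using car by algebra
  also have "\<dots> = \<zero>" using m u car by (simp add: minus_eq r_neg)
  finally have "x \<ominus> t \<otimes> u = \<zero> \<and> y \<ominus> t \<otimes> v = \<zero>" using bc(4)[of "x \<ominus> t \<otimes> u" "y \<ominus> t \<otimes> v"] x u by simp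
  then have "x = t \<otimes> u" "y = t \<otimes> v" using car by simp_all
  then show ?thesis using PI[of u 1] PI[of v 1] u by simp
qed

lemma embedding_dim_3:
  assumes loc: "local_ring S" and basis: "basis2 M b c" and prod: "\<And>x y. x \<in> M \<Longrightarrow> y \<in> M \<Longrightarrow> x \<otimes> y \<in> tM"
  shows "embedding_dim S = 3"
proof -
  note bc = basis2D[OF basis] and bM = basis2_mem(1,2)[OF basis]
  define p1 p2 p3 where "p1 = (t, t)" and "p2 = (b, \<zero>)" and "p3 = (c, \<zero>)"
  have dist: "p1 \<noteq> p2" "p1 \<noteq> p3" "p2 \<noteq> p3" using basis2_mem(3)[OF basis] by (auto simp: p1_def p2_def p3_def)
  let ?G = "{p1, p2, p3}"
  have tP: "t \<in> P 1" using PI[of \<one> 1] by simp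
  have GJ: "?G \<subseteq> maxid"
    using maxid_pair_iff[of t \<zero>] maxid_pair_iff[of \<zero> b] maxid_pair_iff[of \<zero> c] bM M_closed bc(1,2) tP
    by (simp add: p1_def p2_def p3_def)
  then have GC: "?G \<subseteq> pairs M" using maxid_pairs by blast
  have fs: "(\<Oplus>\<^bsub>S\<^esub>s\<in>?G. r s \<otimes>\<^bsub>S\<^esub> s) = r p1 \<otimes>\<^bsub>L\<^esub> p1 \<oplus>\<^bsub>L\<^esub> (r p2 \<otimes>\<^bsub>L\<^esub> p2 \<oplus>\<^bsub>L\<^esub> r p3 \<otimes>\<^bsub>L\<^esub> p3)"
    if r: "r \<in> ?G \<rightarrow> carrier S" for r
  proof -
    have m: "r s \<otimes>\<^bsub>S\<^esub> s \<in> carrier S" if "s \<in> ?G" for s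
      using r GC that by (intro S.m_closed) auto
    have "(\<Oplus>\<^bsub>S\<^esub>s\<in>?G. r s \<otimes>\<^bsub>S\<^esub> s) = r p1 \<otimes>\<^bsub>S\<^esub> p1 \<oplus>\<^bsub>S\<^esub> (r p2 \<otimes>\<^bsub>S\<^esub> p2 \<oplus>\<^bsub>S\<^esub> (r p3 \<otimes>\<^bsub>S\<^esub> p3 \<oplus>\<^bsub>S\<^esub> \<zero>\<^bsub>S\<^esub>))"
      using dist m by (simp add: S.finsum_insert Pi_def del: partial_object.select_convs ring.simps monoid.simps)
    then show ?thesis using m[of p3] S.r_zero[of "r p3 \<otimes>\<^bsub>S\<^esub> p3"] by simp
  qed
  have "embedding_dim S = card ?G"
  proof (rule embedding_dim_eq_card[OF loc maxid_maximal _ GJ])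
    fix j assume j: "j \<in> maxid"
    then obtain d m where d: "d \<in> D" "d \<in> P 1" "m \<in> M" "j = (d \<oplus> m, d)" unfolding maxid_def by blast
    obtain e where e: "e \<in> D" "d = t \<otimes> e" using D_Int_P[of d 1] d by auto
    obtain x y where xy: "x \<in> D" "y \<in> D" "m = x \<otimes> b \<oplus> y \<otimes> c" using d(3) unfolding bc(3) by blast
    \<comment> \<open>Diagonal coefficients represent j exactly, so the required difference is
      zero.\<close>
    define r where "r = (\<lambda>p. if p = p1 then (e, e) else if p = p2 then (x, x) else (y, y))"
    have r: "r p1 = (e, e)" "r p2 = (x, x)" "r p3 = (y, y)" using dist by (auto simp: r_def)
    have rC: "r \<in> ?G \<rightarrow> carrier S" using r diag_pairs e xy by auto
    have "r p1 \<otimes>\<^bsub>L\<^esub> p1 \<oplus>\<^bsub>L\<^esub> (r p2 \<otimes>\<^bsub>L\<^esub> p2 \<oplus>\<^bsub>L\<^esub> r p3 \<otimes>\<^bsub>L\<^esub> p3) = j"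
      unfolding r unfolding d(4) e(2) xy(3) p1_def p2_def p3_def using e xy bc(1,2) by (simp add: m_comm)
    then have sum: "(\<Oplus>\<^bsub>S\<^esub>s\<in>?G. r s \<otimes>\<^bsub>S\<^esub> s) = j" using fs[OF rC] by (rule trans[rotated])
    have diff: "j \<ominus>\<^bsub>S\<^esub> j = \<zero>\<^bsub>S\<^esub>" using maxid_pairs[OF j] S.r_neg[of j] by (simp add: a_minus_def)
    have "j \<ominus>\<^bsub>S\<^esub> (\<Oplus>\<^bsub>S\<^esub>s\<in>?G. r s \<otimes>\<^bsub>S\<^esub> s) \<in> maxid \<cdot>\<^bsub>S\<^esub> maxid"
      unfolding sum diff
      by (rule additive_subgroup.zero_closed[OF ideal.axioms(1)[OF S.ideal_prod_is_ideal[OF maxid_ideal maxid_ideal]]])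
    then show "\<exists>r\<in>?G \<rightarrow> carrier S. j \<ominus>\<^bsub>S\<^esub> (\<Oplus>\<^bsub>S\<^esub>s\<in>?G. r s \<otimes>\<^bsub>S\<^esub> s) \<in> maxid \<cdot>\<^bsub>S\<^esub> maxid"
      using rC by (rule bexI)
  next
    fix r s assume r: "r \<in> ?G \<rightarrow> carrier S" and rel: "(\<Oplus>\<^bsub>S\<^esub>s\<in>?G. r s \<otimes>\<^bsub>S\<^esub> s) \<in> maxid \<cdot>\<^bsub>S\<^esub> maxid" and s: "s \<in> ?G"
    have "r p1 \<in> pairs M" "r p2 \<in> pairs M" "r p3 \<in> pairs M" using r by auto
    then obtain d1 m1 d2 m2 d3 m3 where d: "d1 \<in> D" "m1 \<in> M" "r p1 = (d1 \<oplus> m1, d1)"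
      "d2 \<in> D" "m2 \<in> M" "r p2 = (d2 \<oplus> m2, d2)" "d3 \<in> D" "m3 \<in> M" "r p3 = (d3 \<oplus> m3, d3)"
      by (blast elim: pairsE)
    \<comment> \<open>Each coefficient splits into a D-part and an M-part: x collects the former,
      while y consists of products of elements of M and lies in t M.\<close>
    define x y where "x = d2 \<otimes> b \<oplus> d3 \<otimes> c" and "y = m2 \<otimes> b \<oplus> m3 \<otimes> c"
    have x: "x \<in> M" using M_closed bM d by (simp add: x_def)
    have y: "y \<in> tM" using tM_add prod bM d by (simp add: y_def)
    have car: "d2 \<in> carrier R" "d3 \<in> carrier R" "m2 \<in> carrier R" "m3 \<in> carrier R" "b \<in> carrier R" "c \<in> carrier R"
      using d bc(1,2) M_E by auto
    have "(d2 \<oplus> m2) \<otimes> b \<oplus> (d3 \<oplus> m3) \<otimes> c = x \<oplus> y" unfolding x_def y_def using car by algebra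
    then have "(d1 \<oplus> m1, d1) \<otimes>\<^bsub>L\<^esub> (t, t) \<oplus>\<^bsub>L\<^esub> (x \<oplus> y, \<zero>) \<in> maxid \<cdot>\<^bsub>S\<^esub> maxid"
      using rel d unfolding fs[OF r] p2_def[symmetric] by (simp add: p1_def p2_def p3_def)
    then have 1: "d1 \<in> P 1 \<and> x \<in> tM"
    proof (rule relation_mod_square[of tM, rotated -1])
      show "tM \<subseteq> M" using tM_M by blast
      show "\<ominus> z \<in> tM" if "z \<in> tM" for z using tM_smult[of "\<ominus> \<one>" z] that tM_M[OF that] M_E by (simp add: l_minus)
    qed (use tM_add prod d x y in auto)
    then have "d2 \<in> P 1 \<and> d3 \<in> P 1" using coefficient_in_P1[OF basis d(4,7)] unfolding x_def by blast
    then show "r s \<in> maxid" using s 1 d maxid_pair_iff by auto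
  qed simp
  then show ?thesis using dist by simp
qed

text \<open>The relation for b^2 puts c into J^2, so t and b suffice. Conversely J^2 meets M x 0 in
  at most W = t M + D c, which does not contain b.\<close>

lemma embedding_dim_2:
  assumes loc: "local_ring S" and basis: "basis2 M b c"
    and sq: "k \<in> D" "b \<otimes> b = t \<otimes> (k \<otimes> b) \<oplus> c" and prod: "b \<otimes> c \<in> tM" "c \<otimes> c \<in> tM"
  shows "embedding_dim S = 2"
proof -
  note bc = basis2D[OF basis] and bM = basis2_mem(1,2)[OF basis]
  have bcc: "b \<in> carrier R" "c \<in> carrier R" using bc by auto
  define W where "W = {x \<oplus> e \<otimes> c | x e. x \<in> tM \<and> e \<in> D}"
  have WI: "x \<oplus> e \<otimes> c \<in> W" if "x \<in> tM" "e \<in> D" for x e using that by (auto simp: W_def)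
  have tMc: "x \<in> carrier R" if "x \<in> tM" for x using tM_M[OF that] M_E by simp
  have W_add: "x \<oplus> y \<in> W" if "x \<in> W" "y \<in> W" for x y
  proof -
    obtain u e v f where u: "u \<in> tM" "e \<in> D" "x = u \<oplus> e \<otimes> c" "v \<in> tM" "f \<in> D" "y = v \<oplus> f \<otimes> c"
      using \<open>x \<in> W\<close> \<open>y \<in> W\<close> unfolding W_def by blast
    have car: "u \<in> carrier R" "v \<in> carrier R" "e \<in> carrier R" "f \<in> carrier R" using u tMc by auto
    have "x \<oplus> y = (u \<oplus> v) \<oplus> (e \<oplus> f) \<otimes> c" unfolding u(3,6) using car bcc by algebra
    then show ?thesis using WI tM_add u by simp
  qed
  have W_smult: "d \<otimes> x \<in> W" if "d \<in> D" "x \<in> W" for d x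
  proof -
    obtain u e where u: "u \<in> tM" "e \<in> D" "x = u \<oplus> e \<otimes> c" using \<open>x \<in> W\<close> unfolding W_def by blast
    have car: "u \<in> carrier R" "d \<in> carrier R" "e \<in> carrier R" using u tMc \<open>d \<in> D\<close> by auto
    have "d \<otimes> x = d \<otimes> u \<oplus> (d \<otimes> e) \<otimes> c" unfolding u(3) using car bcc by algebra
    then show ?thesis using WI tM_smult u \<open>d \<in> D\<close> by simp
  qed
  have W_M: "W \<subseteq> M" using tM_M M_closed bM by (auto simp: W_def)
  have tM_W: "tM \<subseteq> W"
  proof
    fix x assume "x \<in> tM"
    then show "x \<in> W" using WI[of x \<zero>] tMc bcc by simp
  qed
  have bbW: "b \<otimes> b \<in> W"
    unfolding sq(2) using WI[of "t \<otimes> (k \<otimes> b)" \<one>] M_tM M_closed(3) sq(1) bM(1) bcc by simp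
  have W_prod: "x \<otimes> y \<in> W" if "x \<in> M" "y \<in> M" for x y
  proof -
    obtain x1 x2 y1 y2 where xy: "x1 \<in> D" "x2 \<in> D" "x = x1 \<otimes> b \<oplus> x2 \<otimes> c" "y1 \<in> D" "y2 \<in> D" "y = y1 \<otimes> b \<oplus> y2 \<otimes> c"
      using \<open>x \<in> M\<close> \<open>y \<in> M\<close> unfolding bc(3) by blast
    have car: "x1 \<in> carrier R" "x2 \<in> carrier R" "y1 \<in> carrier R" "y2 \<in> carrier R" using xy by auto
    have "x \<otimes> y = (x1 \<otimes> y1) \<otimes> (b \<otimes> b) \<oplus> ((x1 \<otimes> y2 \<oplus> x2 \<otimes> y1) \<otimes> (b \<otimes> c) \<oplus> (x2 \<otimes> y2) \<otimes> (c \<otimes> c))"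
      unfolding xy(3,6) using car bcc by algebra
    moreover have "b \<otimes> c \<in> W" "c \<otimes> c \<in> W" using prod tM_W by auto
    ultimately show ?thesis using bbW W_add W_smult xy by simp
  qed
  have W_neg: "\<ominus> x \<in> W" if "x \<in> W" for x
    using W_smult[of "\<ominus> \<one>" x] that M_E(2)[of x] W_M by (auto simp: l_minus)
  define p1 p2 where "p1 = (t, t)" and "p2 = (b, \<zero>)"
  have dist: "p1 \<noteq> p2" by (simp add: p1_def p2_def)
  let ?G = "{p1, p2}"
  have tP: "t \<in> P 1" using PI[of \<one> 1] by simp
  have GJ: "?G \<subseteq> maxid"
    using maxid_pair_iff[of t \<zero>] maxid_pair_iff[of \<zero> b] bM M_closed bc(1,2) tP
    by (simp add: p1_def p2_def)
  then have GC: "?G \<subseteq> pairs M" using maxid_pairs by blast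
  interpret Q: ideal "maxid \<cdot>\<^bsub>S\<^esub> maxid" S by (rule S.ideal_prod_is_ideal[OF maxid_ideal maxid_ideal])
  \<comment> \<open>c is b^2 minus t times k b, a sum of two products of elements of J.\<close>
  have cQ: "(c, \<zero>) \<in> maxid \<cdot>\<^bsub>S\<^esub> maxid"
  proof -
    have kb: "(\<ominus> (k \<otimes> b), \<zero>) \<in> maxid"
      using maxid_pair_iff[of \<zero> "\<ominus> (k \<otimes> b)"] M_closed sq bM bcc by simp
    have G: "p1 \<in> maxid" "p2 \<in> maxid" using GJ by auto
    have "p2 \<otimes>\<^bsub>S\<^esub> p2 \<oplus>\<^bsub>S\<^esub> p1 \<otimes>\<^bsub>S\<^esub> (\<ominus> (k \<otimes> b), \<zero>) \<in> maxid \<cdot>\<^bsub>S\<^esub> maxid"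
      using ideal_prod.sum[OF ideal_prod.prod[OF G(2) G(2)] ideal_prod.prod[OF G(1) kb]] .
    moreover have "t \<otimes> (k \<otimes> b) \<oplus> c \<oplus> t \<otimes> \<ominus> (k \<otimes> b) = c"
      using bcc D_carrier[OF sq(1)] D_carrier[OF t_in_D] by algebra
    ultimately show ?thesis using sq by (simp add: p1_def p2_def)
  qed
  have fs: "(\<Oplus>\<^bsub>S\<^esub>s\<in>?G. r s \<otimes>\<^bsub>S\<^esub> s) = r p1 \<otimes>\<^bsub>L\<^esub> p1 \<oplus>\<^bsub>L\<^esub> r p2 \<otimes>\<^bsub>L\<^esub> p2"
    if r: "r \<in> ?G \<rightarrow> carrier S" for r
  proof -
    have m: "r s \<otimes>\<^bsub>S\<^esub> s \<in> carrier S" if "s \<in> ?G" for s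
      using r GC that by (intro S.m_closed) auto
    have "(\<Oplus>\<^bsub>S\<^esub>s\<in>?G. r s \<otimes>\<^bsub>S\<^esub> s) = r p1 \<otimes>\<^bsub>S\<^esub> p1 \<oplus>\<^bsub>S\<^esub> (r p2 \<otimes>\<^bsub>S\<^esub> p2 \<oplus>\<^bsub>S\<^esub> \<zero>\<^bsub>S\<^esub>)"
      using dist m by (simp add: S.finsum_insert Pi_def del: partial_object.select_convs ring.simps monoid.simps)
    then show ?thesis using m[of p2] S.r_zero[of "r p2 \<otimes>\<^bsub>S\<^esub> p2"] by simp
  qed
  have "embedding_dim S = card ?G"
  proof (rule embedding_dim_eq_card[OF loc maxid_maximal _ GJ])
    fix j assume j: "j \<in> maxid"
    then obtain d m where d: "d \<in> D" "d \<in> P 1" "m \<in> M" "j = (d \<oplus> m, d)" unfolding maxid_def by blast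
    obtain e where e: "e \<in> D" "d = t \<otimes> e" using D_Int_P[of d 1] d by auto
    obtain x y where xy: "x \<in> D" "y \<in> D" "m = x \<otimes> b \<oplus> y \<otimes> c" using d(3) unfolding bc(3) by blast
    define r where "r = (\<lambda>p. if p = p1 then (e, e) else (x, x))"
    have r: "r p1 = (e, e)" "r p2 = (x, x)" using dist by (auto simp: r_def)
    have rC: "r \<in> ?G \<rightarrow> carrier S" using r diag_pairs e xy by auto
    define s where "s = (\<Oplus>\<^bsub>S\<^esub>s\<in>?G. r s \<otimes>\<^bsub>S\<^esub> s)"
    have "r p1 \<otimes>\<^bsub>L\<^esub> p1 \<oplus>\<^bsub>L\<^esub> r p2 \<otimes>\<^bsub>L\<^esub> p2 = (d \<oplus> x \<otimes> b, d)"
      unfolding r unfolding e(2) p1_def p2_def using e xy bc(1,2) by (simp add: m_comm)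
    then have s: "s = (d \<oplus> x \<otimes> b, d)" using fs[OF rC] unfolding s_def by (rule trans[rotated])
    have sC: "s \<in> pairs M" unfolding s using pairsI M_closed d xy bM by simp
    have car: "d \<in> carrier R" "x \<in> carrier R" "y \<in> carrier R" using d xy by auto
    have "j \<ominus>\<^bsub>S\<^esub> s = j \<oplus>\<^bsub>L\<^esub> \<ominus>\<^bsub>L\<^esub> s" using L.subring_uminus[OF C_subring sC] by (simp add: a_minus_def)
    also have "\<dots> = (y, y) \<otimes>\<^bsub>L\<^esub> (c, \<zero>)"
    proof -
      have "d \<oplus> (x \<otimes> b \<oplus> y \<otimes> c) \<oplus> \<ominus> (d \<oplus> x \<otimes> b) = y \<otimes> c" using car bcc by algebra
      then show ?thesis unfolding s d(4) xy(3) using car bcc d(1) D_K by (simp add: r_neg)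
    qed
    also have "\<dots> \<in> maxid \<cdot>\<^bsub>S\<^esub> maxid" using Q.I_l_closed[OF cQ, of "(y, y)"] diag_pairs xy by simp
    finally show "\<exists>r\<in>?G \<rightarrow> carrier S. j \<ominus>\<^bsub>S\<^esub> (\<Oplus>\<^bsub>S\<^esub>s\<in>?G. r s \<otimes>\<^bsub>S\<^esub> s) \<in> maxid \<cdot>\<^bsub>S\<^esub> maxid"
      unfolding s_def using rC by (rule bexI)
  next
    fix r s assume r: "r \<in> ?G \<rightarrow> carrier S" and rel: "(\<Oplus>\<^bsub>S\<^esub>s\<in>?G. r s \<otimes>\<^bsub>S\<^esub> s) \<in> maxid \<cdot>\<^bsub>S\<^esub> maxid" and s: "s \<in> ?G"
    have "r p1 \<in> pairs M" "r p2 \<in> pairs M" using r by auto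
    then obtain d1 m1 d2 m2 where d: "d1 \<in> D" "m1 \<in> M" "r p1 = (d1 \<oplus> m1, d1)"
      "d2 \<in> D" "m2 \<in> M" "r p2 = (d2 \<oplus> m2, d2)"
      by (blast elim: pairsE)
    define x y where "x = d2 \<otimes> b" and "y = m2 \<otimes> b"
    have x: "x \<in> M" using M_closed bM d by (simp add: x_def)
    have y: "y \<in> W" using W_prod bM d by (simp add: y_def)
    have "(d2 \<oplus> m2) \<otimes> b = x \<oplus> y" unfolding x_def y_def using d M_E bcc by (simp add: l_distr)
    then have "(d1 \<oplus> m1, d1) \<otimes>\<^bsub>L\<^esub> (t, t) \<oplus>\<^bsub>L\<^esub> (x \<oplus> y, \<zero>) \<in> maxid \<cdot>\<^bsub>S\<^esub> maxid"
      using rel d unfolding fs[OF r] by (simp add: p1_def p2_def)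
    then have 1: "d1 \<in> P 1 \<and> x \<in> W"
      by (rule relation_mod_square[of W, rotated -1]) (use W_add W_M tM_W W_prod W_neg d x y in auto)
    \<comment> \<open>Moving e c to the left gives a combination of b and c in t M, so its
      coefficient d2 at b is divisible by t.\<close>
    then obtain u e where u: "u \<in> tM" "e \<in> D" "x = u \<oplus> e \<otimes> c" unfolding W_def by blast
    have car: "u \<in> carrier R" "e \<in> carrier R" using u tMc by auto
    have "d2 \<otimes> b \<oplus> (\<ominus> e) \<otimes> c = u" using u(3) unfolding x_def using car bcc by (simp add: l_minus a_assoc r_neg)
    then have "d2 \<in> P 1" using coefficient_in_P1[OF basis d(4), of "\<ominus> e"] u by simp
    then show "r s \<in> maxid" using s 1 d maxid_pair_iff by auto
  qed simp
  then show ?thesis using dist by simp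
qed

end

section \<open>Classification\<close>

context two_branches begin

lemma std_mod_cubic_order:
  assumes al: "\<alpha> \<in> gens" and j: "1 \<le> j" "j \<le> s" "s \<le> 2 * j + q"
  shows "cubic_order R D E t K (std_mod j q \<alpha> s)"
proof unfold_locales
  show "submodule_D (std_mod j q \<alpha> s)" by (rule std_mod_submodule[OF al])
  show "x \<otimes> y \<in> std_mod j q \<alpha> s" if "x \<in> std_mod j q \<alpha> s" "y \<in> std_mod j q \<alpha> s" for x y
    by (rule std_mod_mult[OF al j(3) that])
  show "std_mod j q \<alpha> s \<subseteq> P 1" using std_mod_subset_P[OF al j(2)] P_mono[OF j(1)] by blast
qed

text \<open>Supplies the hypothesis of \<open>local_if_quadratic\<close>. For x = d b + y the square
  of b contributes t^l b, so \<delta> = t^l d; it is divisible by t because l \<ge> 1.\<close>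

lemma std_mod_quadratic:
  assumes al: "\<alpha> \<in> gens" and l: "1 \<le> l" and x: "x \<in> std_mod l q \<alpha> (2 * l + q)"
  shows "\<exists>\<delta>\<in>D. \<exists>z\<in>P (2 * l + q). \<delta> \<in> P 1 \<and> x \<otimes> x = \<delta> \<otimes> x \<oplus> z"
proof -
  let ?b = "t [^] l \<otimes> xi q \<alpha>" and ?c = "t [^] (2 * l + q) \<otimes> (\<alpha> \<otimes> xi q \<alpha>)"
  obtain d y where d: "d \<in> D" "y \<in> P (2 * l + q)" "x = d \<otimes> ?b \<oplus> y" using x al by (auto elim: std_mod_E)
  have b: "?b \<in> E" "?c \<in> P (2 * l + q)" using xi_props[OF al] gens_E[OF al] by simp_all
  define b c where "b = ?b" and "c = ?c"
  have sq: "b \<otimes> b = t [^] l \<otimes> b \<oplus> c"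
    using generator_square[OF al, of "2 * l + q" 0 l q] P_E[OF b(2)] by (simp add: b_def c_def)
  have bc: "b \<in> E" "c \<in> P (2 * l + q)" using b by (simp_all add: b_def c_def)
  have car: "b \<in> carrier R" "c \<in> carrier R" "d \<in> carrier R" "y \<in> carrier R" "t [^] l \<in> carrier R"
    using bc d P_E by auto
  define \<delta> where "\<delta> = t [^] l \<otimes> d"
  have "x \<otimes> x = (d \<otimes> d) \<otimes> (b \<otimes> b) \<oplus> ((d \<otimes> b \<oplus> d \<otimes> b) \<otimes> y \<oplus> y \<otimes> y)"
    unfolding d(3) b_def[symmetric] using car by algebra
  also have "\<dots> = \<delta> \<otimes> x \<oplus> ((d \<otimes> d) \<otimes> c \<oplus> (\<ominus> \<delta>) \<otimes> y \<oplus> ((d \<otimes> b \<oplus> d \<otimes> b) \<otimes> y \<oplus> y \<otimes> y))"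
    unfolding sq d(3) b_def[symmetric] \<delta>_def using car by algebra
  finally have "x \<otimes> x = \<delta> \<otimes> x \<oplus> ((d \<otimes> d) \<otimes> c \<oplus> (\<ominus> \<delta>) \<otimes> y \<oplus> ((d \<otimes> b \<oplus> d \<otimes> b) \<otimes> y \<oplus> y \<otimes> y))" .
  moreover have "(d \<otimes> d) \<otimes> c \<oplus> (\<ominus> \<delta>) \<otimes> y \<oplus> ((d \<otimes> b \<oplus> d \<otimes> b) \<otimes> y \<oplus> y \<otimes> y) \<in> P (2 * l + q)"
    using d bc P_E by (simp add: \<delta>_def)
  moreover have "\<delta> \<in> D" "\<delta> \<in> P 1" using d P_mono[OF l, of \<delta>] by (simp_all add: \<delta>_def)
  ultimately show ?thesis by blast
qed

lemma P_Suc_tM: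
  assumes "P s \<subseteq> M" "x \<in> P (Suc s)" shows "\<exists>y\<in>M. x = t \<otimes> y"
proof -
  obtain z where z: "z \<in> E" "x = t [^] Suc s \<otimes> z" using assms(2) by (rule PE)
  then have "x = t \<otimes> (t [^] s \<otimes> z)" using tpow_add[of 1 s] by (simp add: m_ac)
  then show ?thesis using assms(1) z by auto
qed

lemma C_ring_plane:
  fixes \<alpha> :: 'a and l q :: nat
  assumes al: "\<alpha> \<in> gens" and l: "1 \<le> l"
  defines "M \<equiv> std_mod l q \<alpha> (2 * l + q)"
  shows "cubic_ring L (diagonal D) (pairs M)" "plane_curve_singularity (L\<lparr>carrier := pairs M\<rparr>)"
proof -
  let ?s = "2 * l + q"
  interpret O: cubic_order R D E t K M
    unfolding M_def using al l by (intro std_mod_cubic_order) simp_all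
  define b c where "b = t [^] l \<otimes> xi q \<alpha>" and "c = t [^] ?s \<otimes> (\<alpha> \<otimes> xi q \<alpha>)"
  have basis: "basis2 M b c" unfolding M_def b_def c_def using al by (intro std_mod_basis) simp_all
  have Ps: "P ?s \<subseteq> M" unfolding M_def by (rule P_subset_std_mod[OF al])
  show "cubic_ring L (diagonal D) (pairs M)" by (rule pairs_cubic_ring[OF O.M O.M_mult basis])
  have loc: "local_ring O.S"
    using std_mod_quadratic[OF al l] by (intro O.local_if_quadratic[OF Ps]) (simp add: M_def)
  have bc: "b \<in> P l" "c \<in> P ?s" using xi_props[OF al] gens_E[OF al] by (simp_all add: b_def c_def)
  have tl: "t [^] l = t \<otimes> t [^] (l - 1)" using l tpow_add[of 1 "l - 1"] by simp
  have "b \<otimes> b = t [^] l \<otimes> b \<oplus> c"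
    using generator_square[OF al, of ?s 0 l q] P_E[OF bc(2)] unfolding b_def c_def by simp
  moreover have "t [^] l \<otimes> b = t \<otimes> (t [^] (l - 1) \<otimes> b)"
    unfolding tl using P_E[OF bc(1)] by (simp add: m_assoc)
  ultimately have sq: "b \<otimes> b = t \<otimes> (t [^] (l - 1) \<otimes> b) \<oplus> c" by simp
  \<comment> \<open>Since l \<ge> 1, valuation l + s is at least s + 1, and t times
    \<open>P s\<close> lies in t M.\<close>
  have in_tM: "x \<in> O.tM" if "x \<in> P (l + ?s)" for x
    using P_Suc_tM[OF Ps, of x] P_mono[of "Suc ?s" "l + ?s" x] that l unfolding O.tM_def by auto
  have "b \<otimes> c \<in> O.tM" using in_tM P_mult[OF bc] by blast
  moreover have "c \<otimes> c \<in> O.tM" using in_tM[of "c \<otimes> c"] P_mult[OF bc(2) bc(2)] P_mono[of "l + ?s" "?s + ?s" "c \<otimes> c"] by simp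
  ultimately have "embedding_dim O.S = 2" using sq by (intro O.embedding_dim_2[OF loc basis, of "t [^] (l - 1)"]) simp_all
  then show "plane_curve_singularity O.S"
    unfolding plane_curve_singularity_def
    using loc O.noetherian_pairs[OF basis] O.krull_dim_pairs[OF Ps] by simp
qed

text \<open>The product of t^k u and t^k v is t times an element of M, since u v stays in the
  unscaled module. Locality is a hypothesis because the lemma serves to rule out k > 0 for a ring
  already known to be local.\<close>

lemma thickened_embedding_dim:
  fixes \<alpha> :: 'a and k l q :: nat
  assumes al: "\<alpha> \<in> gens" and k: "1 \<le> k"
  defines "M \<equiv> std_mod (k + l) q \<alpha> (k + (2 * l + q))"
  assumes loc: "local_ring (L\<lparr>carrier := pairs M\<rparr>)"
  shows "embedding_dim (L\<lparr>carrier := pairs M\<rparr>) = 3"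
proof -
  interpret O: cubic_order R D E t K M
    unfolding M_def using al k by (intro std_mod_cubic_order) simp_all
  let ?N = "std_mod l q \<alpha> (2 * l + q)"
  have M_eq: "M = {t [^] k \<otimes> x | x. x \<in> ?N}" unfolding M_def using tpow_std_mod[OF al] by simp
  have Nc: "x \<in> carrier R" if "x \<in> ?N" for x using submoduleD(1)[OF std_mod_submodule[OF al] that] by simp
  show ?thesis
  proof (rule O.embedding_dim_3[OF loc])
    show "basis2 M (t [^] (k + l) \<otimes> xi q \<alpha>) (t [^] (k + (2 * l + q)) \<otimes> (\<alpha> \<otimes> xi q \<alpha>))"
      unfolding M_def using al by (intro std_mod_basis) simp_all
    fix x y assume "x \<in> M" "y \<in> M"
    then obtain u v where u: "u \<in> ?N" "x = t [^] k \<otimes> u" "v \<in> ?N" "y = t [^] k \<otimes> v" unfolding M_eq by blast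
    have "u \<otimes> v \<in> ?N" using u by (intro std_mod_mult[OF al]) simp_all
    then have "t [^] k \<otimes> (u \<otimes> v) \<in> M" unfolding M_eq by blast
    then have "t [^] (k - 1) \<otimes> (t [^] k \<otimes> (u \<otimes> v)) \<in> M" by (rule O.M_closed(3)[rotated]) simp
    moreover have "x \<otimes> y = t \<otimes> (t [^] (k - 1) \<otimes> (t [^] k \<otimes> (u \<otimes> v)))"
    proof -
      have car: "u \<in> carrier R" "v \<in> carrier R" "t [^] (k - 1) \<in> carrier R" "t [^] k \<in> carrier R" "t \<in> carrier R"
        using Nc u by auto
      have tk: "t [^] k = t \<otimes> t [^] (k - 1)" using k tpow_add[of 1 "k - 1"] by simp
      have "x \<otimes> y = t [^] k \<otimes> (t [^] k \<otimes> (u \<otimes> v))" unfolding u(2,4) using car by algebra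
      also have "\<dots> = t \<otimes> (t [^] (k - 1) \<otimes> (t [^] k \<otimes> (u \<otimes> v)))" using tk car by (simp add: m_assoc)
      finally show ?thesis .
    qed
    ultimately show "x \<otimes> y \<in> O.tM" unfolding O.tM_def by blast
  qed
qed

text \<open>For \<open>l = 0\<close> the ring contains \<open>e\<^sub>1\<close>.\<close>

lemma C_ring_0_not_local:
  assumes al: "\<alpha> \<in> gens"
  shows "\<not> local_ring (L\<lparr>carrier := pairs (std_mod 0 q \<alpha> q)\<rparr>)"
proof
  assume loc: "local_ring (L\<lparr>carrier := pairs (std_mod 0 q \<alpha> q)\<rparr>)"
  have a: "\<alpha> \<in> carrier R" "t [^] q \<in> carrier R" using gens_E[OF al] by auto
  have "\<one> \<otimes> (t [^] (0::nat) \<otimes> xi q \<alpha>) \<oplus> \<ominus> (t [^] q \<otimes> \<alpha>) \<in> std_mod 0 q \<alpha> q"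
    using gens_E[OF al] by (intro std_mod_I[OF al]) simp_all
  also have "\<one> \<otimes> (t [^] (0::nat) \<otimes> xi q \<alpha>) \<oplus> \<ominus> (t [^] q \<otimes> \<alpha>) = \<one>"
    unfolding xi_def nat_pow_0 using a by algebra
  finally have "(\<one>, \<zero>) \<in> pairs (std_mod 0 q \<alpha> q)" using pairsI[of \<zero> \<one> "std_mod 0 q \<alpha> q"] by simp
  then have "(\<one>, \<zero>) = (\<zero>, \<zero>) \<or> (\<one>, \<zero>) = (\<one>, \<one>)"
    using local_ring_idempotent[OF loc, of "(\<one>, \<zero>)"] by simp
  then show False by simp
qed

text \<open>M is fixed before m is chosen: for over-rings of A_m the given m is inserted to obtain
  the bound, whereas for plane curve singularities any m will do.\<close>

lemma cubic_classification:
  assumes cubic: "cubic_ring L (diagonal D) B"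
  shows "\<exists>M. submodule_D M \<and> B = pairs M \<and> (\<exists>m. P m \<subseteq> M) \<and>
    (\<forall>m. P m \<subseteq> M \<longrightarrow> (\<exists>k l q. \<exists>\<alpha>\<in>gens. k + 2 * l + q \<le> m \<and> M = std_mod (k + l) q \<alpha> (k + 2 * l + q)))"
proof -
  obtain M where M: "submodule_D M" "\<forall>x\<in>M. \<forall>y\<in>M. x \<otimes> y \<in> M" "B = pairs M"
    using cubic_ring_imp_pairs[OF cubic] by blast
  have "\<exists>k l q. \<exists>\<alpha>\<in>gens. k + 2 * l + q \<le> m \<and> M = std_mod (k + l) q \<alpha> (k + 2 * l + q)" if "P m \<subseteq> M" for m
    using classify_multiplicative_submodules[OF M(1) _ that] M(2) by blast
  then show ?thesis using cubic_ring_contains_P[of M] cubic M by blast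
qed

text \<open>In the classification of a cubic ring, embedding dimension 2 forces k = 0 and locality
  forces l > 0.\<close>

theorem plane_curve_iff:
  "cubic_ring L (diagonal D) C \<and> plane_curve_singularity (L\<lparr>carrier := C\<rparr>) \<longleftrightarrow>
    (\<exists>l q. \<exists>\<alpha>\<in>gens. 1 \<le> l \<and> C = pairs (std_mod l q \<alpha> (2 * l + q)))"
proof
  assume "\<exists>l q. \<exists>\<alpha>\<in>gens. 1 \<le> l \<and> C = pairs (std_mod l q \<alpha> (2 * l + q))"
  then show "cubic_ring L (diagonal D) C \<and> plane_curve_singularity (L\<lparr>carrier := C\<rparr>)"
    using C_ring_plane by blast
next
  assume C: "cubic_ring L (diagonal D) C \<and> plane_curve_singularity (L\<lparr>carrier := C\<rparr>)"
  then obtain k l q \<alpha> where M: "\<alpha> \<in> gens" "C = pairs (std_mod (k + l) q \<alpha> (k + 2 * l + q))"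
    using cubic_classification[of C] by blast
  have loc: "local_ring (L\<lparr>carrier := C\<rparr>)" and emb: "embedding_dim (L\<lparr>carrier := C\<rparr>) = 2"
    using C by (simp_all add: plane_curve_singularity_def)
  have k: "k = 0"
  proof (rule ccontr)
    assume "k \<noteq> 0"
    then show False using thickened_embedding_dim[OF M(1), of k l q] loc emb M(2) by (simp add: add.assoc)
  qed
  have "l \<noteq> 0"
  proof
    assume "l = 0"
    then show False using C_ring_0_not_local[OF M(1), of q] loc M(2) k by simp
  qed
  then show "\<exists>l q. \<exists>\<alpha>\<in>gens. 1 \<le> l \<and> C = pairs (std_mod l q \<alpha> (2 * l + q))"
    using M k by (intro exI[of _ l] exI[of _ q] bexI[of _ \<alpha>]) simp_all
qed

theorem over_ring_classification:
  assumes "over_ring L (diagonal D) (thicken L (diagonal D) (t, t) m (E \<times> D)) B"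
  shows "\<exists>k l q. \<exists>\<alpha>\<in>gens. k + 2 * l + q \<le> m \<and>
    B = thicken L (diagonal D) (t, t) k (pairs (std_mod l q \<alpha> (2 * l + q)))"
proof -
  have cubic: "cubic_ring L (diagonal D) B" and sub: "thicken L (diagonal D) (t, t) m (E \<times> D) \<subseteq> B"
    using assms by (simp_all add: over_ring_def)
  obtain M where M: "submodule_D M" "B = pairs M"
    "\<And>m. P m \<subseteq> M \<Longrightarrow> \<exists>k l q. \<exists>\<alpha>\<in>gens. k + 2 * l + q \<le> m \<and> M = std_mod (k + l) q \<alpha> (k + 2 * l + q)"
    using cubic_classification[OF cubic] by blast
  \<comment> \<open>The element t^m (y, 0) of t^m A lies in B, and its first coordinate is therefore
    in M.\<close>
  have "P m \<subseteq> M"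
  proof
    fix x assume "x \<in> P m"
    then obtain y where y: "y \<in> E" "x = t [^] m \<otimes> y" by (rule PE)
    have "\<exists>p\<in>thicken L (diagonal D) (t, t) m (E \<times> D). p = (x, \<zero>)"
      unfolding thicken_def bex_set_add bex_l_coset bex_diagonal bex_Times L_pow L_simps
      using y by (intro bexI[of _ y] bexI[of _ \<zero>]) simp_all
    then have "(x, \<zero>) \<in> pairs M" using sub M by blast
    then show "x \<in> M" using pairs_iff[of M x \<zero>] submoduleD(1)[OF M(1)] y by (auto simp: minus_eq)
  qed
  then obtain k l q \<alpha> where k: "\<alpha> \<in> gens" "k + 2 * l + q \<le> m" "M = std_mod (k + l) q \<alpha> (k + 2 * l + q)"
    using M(3) by blast
  have "B = thicken L (diagonal D) (t, t) k (pairs (std_mod l q \<alpha> (2 * l + q)))"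
    unfolding thicken_pairs[OF std_mod_submodule[OF k(1)]] tpow_std_mod[OF k(1)] M(2) k(3) by (simp add: add.assoc)
  then show ?thesis using k by blast
qed

end

section \<open>From the quadratic field extension to coordinates over D\<close>

locale dvr_pair_over = dvr_pair +
  fixes K :: "'a set"
  assumes K_subfield: "subfield K R"
    and K_fractions: "K = fractions R D"
    and dim: "dimension 2 K (carrier R)"
begin

lemma fraction_denominator:
  assumes "x \<in> K" shows "\<exists>n::nat. t [^] n \<otimes> x \<in> D"
proof -
  obtain a b where ab: "x = a \<otimes> inv b" "a \<in> D" "b \<in> D" "b \<noteq> \<zero>"
    using assms by (auto simp: K_fractions fractions_def)
  obtain n u where u: "u \<in> D" "u \<noteq> \<zero>" "inv u \<in> D" "b = t [^] (n::nat) \<otimes> u"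
    using D_val ab by metis
  have ib: "inv b \<in> carrier R" "b \<otimes> inv b = \<one>" using inv_inv_mult[of b b] ab by auto
  have car: "u \<in> carrier R" "inv u \<in> carrier R" "a \<in> carrier R" "t [^] n \<in> carrier R" using u ab by auto
  have "t [^] n \<otimes> inv b = inv u \<otimes> (u \<otimes> (t [^] n \<otimes> inv b))"
    using inv_inv_mult(3)[of u "t [^] n \<otimes> inv b"] u ib by simp
  also have "u \<otimes> (t [^] n \<otimes> inv b) = (t [^] n \<otimes> u) \<otimes> inv b" using car ib(1) by algebra
  also have "\<dots> = \<one>" using ib(2) u(4) by simp
  finally have "t [^] n \<otimes> inv b = inv u" using car by simp
  moreover have "t [^] n \<otimes> x = a \<otimes> (t [^] n \<otimes> inv b)" unfolding ab(1) using car ib(1) by algebra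
  ultimately show ?thesis using ab u by (intro exI[of _ n]) simp
qed

lemma D_subset_fractions: "D \<subseteq> K"
proof
  fix d assume "d \<in> D"
  then have "d = d \<otimes> inv \<one>" "\<one> \<in> D - {\<zero>}" by simp_all
  then show "d \<in> K" unfolding K_fractions fractions_def using \<open>d \<in> D\<close> by blast
qed

text \<open>An element of K integral at t, that is, lying in E, already lies in D, so its residue
  cannot generate.\<close>

lemma gens_notin_K:
  assumes al: "\<alpha> \<in> gens" shows "\<alpha> \<notin> K"
proof
  assume "\<alpha> \<in> K"
  then obtain n where n: "t [^] (n::nat) \<otimes> \<alpha> \<in> D" using fraction_denominator by blast
  have aE: "\<alpha> \<in> E" using al by (rule gens_E)
  obtain c where c: "c \<in> D" "t [^] n \<otimes> \<alpha> = t [^] n \<otimes> c" using D_Int_P[OF n] aE by auto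
  then have "\<alpha> = c" using tpow_cancel[of \<alpha> c n] aE by auto
  then have "\<alpha> \<ominus> c \<in> P 1" using aE by (simp add: minus_eq r_neg)
  then show False using al c by (auto simp: gens_def)
qed

lemma coordinates:
  assumes al: "\<alpha> \<in> gens" and x: "x \<in> carrier R"
  shows "\<exists>N::nat. \<exists>a\<in>D. \<exists>b\<in>D. t [^] N \<otimes> x = a \<oplus> b \<otimes> \<alpha>"
proof -
  have ac: "\<alpha> \<in> carrier R" using gens_E[OF al] by auto
  obtain h k where hk: "h \<in> K" "k \<in> K" "x = h \<oplus> k \<otimes> \<alpha>"
    using dimension_2_span[OF K_subfield dim ac gens_notin_K[OF al] x] by blast
  obtain m n where mn: "t [^] (m::nat) \<otimes> h \<in> D" "t [^] (n::nat) \<otimes> k \<in> D"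
    using fraction_denominator hk by meson
  have c: "h \<in> carrier R" "k \<in> carrier R" using subfieldE(3)[OF K_subfield] hk by auto
  have "t [^] (m + n) \<otimes> x = t [^] n \<otimes> (t [^] m \<otimes> h) \<oplus> (t [^] m \<otimes> (t [^] n \<otimes> k)) \<otimes> \<alpha>"
    unfolding hk(3) tpow_add using c ac by (simp add: r_distr m_ac)
  then show ?thesis using mn by (meson D_closed(4) tpow_D)
qed

lemma E_coordinates:
  assumes al: "\<alpha> \<in> gens" and x: "x \<in> E"
  shows "\<exists>a\<in>D. \<exists>b\<in>D. x = a \<oplus> b \<otimes> \<alpha>"
proof -
  have aE: "\<alpha> \<in> E" using al by (rule gens_E)
  obtain N a b where ab: "a \<in> D" "b \<in> D" "t [^] (N::nat) \<otimes> x = a \<oplus> b \<otimes> \<alpha>"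
    using coordinates[OF al E_carrier[OF x]] by blast
  have "a \<in> P N \<and> b \<in> P N" using gens_indep_P[OF al ab(1,2), of N] PI[OF x, of N] unfolding ab(3) by blast
  then obtain a' b' where a': "a' \<in> D" "a = t [^] N \<otimes> a'" "b' \<in> D" "b = t [^] N \<otimes> b'"
    using D_Int_P ab by meson
  have "t [^] N \<otimes> x = t [^] N \<otimes> (a' \<oplus> b' \<otimes> \<alpha>)"
    unfolding ab(3) a'(2,4) using a' aE by (simp add: r_distr m_assoc)
  then have "x = a' \<oplus> b' \<otimes> \<alpha>" using a' aE x by (intro tpow_cancel[of x _ N]) simp_all
  then show ?thesis using a' by blast
qed

lemma two_branches:
  assumes "gens \<noteq> {}" shows "two_branches R D E t K"
proof (intro two_branches.intro unramified_pair.intro dvr_pair_axioms unramified_pair_axioms.intro two_branches_axioms.intro)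
  show "gens \<noteq> {}" "subring K R" "D \<subseteq> K" by (rule assms subfieldE(1)[OF K_subfield] D_subset_fractions)+
  show "\<exists>a\<in>D. \<exists>b\<in>D. x = a \<oplus> b \<otimes> \<alpha>" if "\<alpha> \<in> gens" "x \<in> E" for \<alpha> x by (rule E_coordinates[OF that])
  show "\<exists>n::nat. t [^] n \<otimes> x \<in> D" if "x \<in> K" for x by (rule fraction_denominator[OF that])
  fix x assume x: "x \<in> carrier R"
  obtain \<alpha> where al: "\<alpha> \<in> gens" using assms by blast
  obtain N a b where "a \<in> D" "b \<in> D" "t [^] (N::nat) \<otimes> x = a \<oplus> b \<otimes> \<alpha>" using coordinates[OF al x] by blast
  then show "\<exists>n::nat. t [^] n \<otimes> x \<in> E" using gens_E[OF al] by (intro exI[of _ N]) simp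
qed

end

section \<open>Translation of the concrete algebra into the abstract pair of valuation rings\<close>

theorem theorem2p4:
  fixes K\<^sub>1 :: "('a, 'b) ring_scheme"
    and K D D\<^sub>1 :: "'a set"
    and t :: 'a
    and \<theta> :: "'a set"
    and L :: "('a \<times> 'a) ring"
    and D' A :: "('a \<times> 'a) set"
    and t' e\<^sub>1 :: "'a \<times> 'a"
  assumes K1_over_K: "quadratic_extension K K\<^sub>1"
    and D_subring: "subring D K\<^sub>1"
    and D_dvr: "dvr (K\<^sub>1\<lparr>carrier := D\<rparr>) t"
    and D_complete: "adically_complete (K\<^sub>1\<lparr>carrier := D\<rparr>) t"
    and K_fractions: "K = fractions K\<^sub>1 D"
    and L_def: "L = RDirProd K\<^sub>1 (K\<^sub>1\<lparr>carrier := K\<rparr>)"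
    and D'_def: "D' = diagonal D"
    and t'_def: "t' = (t, t)"
    and e1_def: "e\<^sub>1 = (\<one>\<^bsub>K\<^sub>1\<^esub>, \<zero>\<^bsub>K\<^sub>1\<^esub>)"
    and A_def: "A = integral_closure L D'"
    and A_fg: "finitely_generated_module (L\<lparr>carrier := D'\<rparr>) (submod L A)"
    and D1_subring: "subring D\<^sub>1 K\<^sub>1"
    and A_product: "A = D\<^sub>1 \<times> D"
    and D1_dvr: "dvr (K\<^sub>1\<lparr>carrier := D\<^sub>1\<rparr>) t"
    and residue_quadratic:
      "quadratic_extension (residue_image (K\<^sub>1\<lparr>carrier := D\<^sub>1\<rparr>) t D) (residue_ring_at (K\<^sub>1\<lparr>carrier := D\<^sub>1\<rparr>) t)"
    and \<theta>_residue: "\<theta> \<in> carrier (residue_ring_at (K\<^sub>1\<lparr>carrier := D\<^sub>1\<rparr>) t)"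
    and \<theta>_generates:
      "carrier (residue_ring_at (K\<^sub>1\<lparr>carrier := D\<^sub>1\<rparr>) t) =
         ring.simple_extension (residue_ring_at (K\<^sub>1\<lparr>carrier := D\<^sub>1\<rparr>) t) (residue_image (K\<^sub>1\<lparr>carrier := D\<^sub>1\<rparr>) t D) \<theta>"
  shows "(\<forall>m B. over_ring L D' (thicken L D' t' m A) B \<longrightarrow>
            (\<exists>k l q. \<exists>\<alpha> \<in> alphas L D' A t' e\<^sub>1.
               k + 2 * l + q \<le> m \<and>
               B = thicken L D' t' k (C_ring L D' A t' e\<^sub>1 l q \<alpha>))) \<and>
         (\<forall>C. cubic_ring L D' C \<and> plane_curve_singularity (L\<lparr>carrier := C\<rparr>) \<longleftrightarrow>
            (\<exists>l q. \<exists>\<alpha> \<in> alphas L D' A t' e\<^sub>1.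
               1 \<le> l \<and> C = C_ring L D' A t' e\<^sub>1 l q \<alpha>))"
proof -
  have fK1: "field K\<^sub>1" and sK: "subfield K K\<^sub>1" and dim: "ring.dimension K\<^sub>1 2 K (carrier K\<^sub>1)"
    using K1_over_K by (auto simp: quadratic_extension_def)
  interpret K1: field K\<^sub>1 by (rule fK1)
  note Dd = K1.dvr_subring[OF D_subring D_dvr] and Ed = K1.dvr_subring[OF D1_subring D1_dvr]
  note Ds = subringE[OF D_subring] and Es = subringE[OF D1_subring]
  \<comment> \<open>The module structure on A makes it closed under the diagonal action of D, and A
    contains (1, 1); first coordinates give the inclusion.\<close>
  have DE: "D \<subseteq> D\<^sub>1"
  proof
    fix d assume d: "d \<in> D"
    have "module (L\<lparr>carrier := D'\<rparr>) (submod L A)" using A_fg by (simp add: finitely_generated_module_def)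
    then interpret m: module "L\<lparr>carrier := D'\<rparr>" "submod L A" .
    have "(d, d) \<otimes>\<^bsub>L\<^esub> (\<one>\<^bsub>K\<^sub>1\<^esub>, \<one>\<^bsub>K\<^sub>1\<^esub>) \<in> A"
      using m.smult_closed[of "(d, d)" "(\<one>\<^bsub>K\<^sub>1\<^esub>, \<one>\<^bsub>K\<^sub>1\<^esub>)"] d Ds Es by (simp add: D'_def diagonal_def A_product)
    moreover have "(d, d) \<otimes>\<^bsub>L\<^esub> (\<one>\<^bsub>K\<^sub>1\<^esub>, \<one>\<^bsub>K\<^sub>1\<^esub>) = (d, d)"
      using d Ds(1) by (auto simp: L_def RDirProd_def DirProd_def monoid.defs)
    ultimately show "d \<in> D\<^sub>1" by (simp add: A_product)
  qed
  interpret dvr_pair K\<^sub>1 D D\<^sub>1 t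
    by (rule dvr_pair.intro[OF fK1 dvr_pair_axioms.intro])
       (rule D_subring D1_subring DE Dd(1,2) Ed(3) Dd(4) Ed(4); assumption?)+
  have PIdl_P: "PIdl\<^bsub>K\<^sub>1\<lparr>carrier := D\<^sub>1\<rparr>\<^esub> t = P 1"
  proof -
    have "x \<otimes>\<^bsub>K\<^sub>1\<^esub> t = t \<otimes>\<^bsub>K\<^sub>1\<^esub> x" if "x \<in> D\<^sub>1" for x
      using E_carrier[OF that] D_carrier[OF t_in_D] by (rule K1.m_comm)
    moreover have "t [^]\<^bsub>K\<^sub>1\<^esub> (1::nat) = t" using D_carrier[OF t_in_D] by simp
    ultimately show ?thesis unfolding cgenideal_def P_def by auto metis+
  qed
  have crE: "cring (K\<^sub>1\<lparr>carrier := D\<^sub>1\<rparr>)" by (rule K1.subring_is_cring[OF D1_subring])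
  \<comment> \<open>Without a residue generator the residue ring equals the image of D and has
    dimension one over it, contradicting dimension two.\<close>
  have gens_ne: "gens \<noteq> {}"
  proof
    assume gens: "gens = {}"
    let ?Q = "residue_ring_at (K\<^sub>1\<lparr>carrier := D\<^sub>1\<rparr>) t" and ?k = "residue_image (K\<^sub>1\<lparr>carrier := D\<^sub>1\<rparr>) t D"
    have "?k = carrier ?Q"
    proof (rule residue_image_eq_carrier)
      show "cring (K\<^sub>1\<lparr>carrier := D\<^sub>1\<rparr>)" by (rule crE)
      show "t \<in> D\<^sub>1" "D \<subseteq> D\<^sub>1" by (simp, rule DE)
      fix x assume x: "x \<in> D\<^sub>1"
      then obtain d where "d \<in> D" "x \<ominus>\<^bsub>K\<^sub>1\<^esub> d \<in> P 1" using gens by (auto simp: gens_def)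
      then show "\<exists>d\<in>D. x \<ominus>\<^bsub>K\<^sub>1\<lparr>carrier := D\<^sub>1\<rparr>\<^esub> d \<in> PIdl\<^bsub>K\<^sub>1\<lparr>carrier := D\<^sub>1\<rparr>\<^esub> t"
        unfolding PIdl_P using K1.subring_minus[OF D1_subring x] DE by (intro bexI[of _ d]) auto
    qed
    moreover have Q: "field ?Q" "subfield ?k ?Q" "ring.dimension ?Q 2 ?k (carrier ?Q)"
      using residue_quadratic by (auto simp: quadratic_extension_def)
    interpret Q: field ?Q by (rule Q(1))
    have "Q.dimension 1 ?k ?k" using Q.dimension_one[OF Q(2)] .
    ultimately show False using Q.dimension_is_inj[OF Q(2), of 1 "carrier ?Q" 2] Q(3) by simp
  qed
  interpret dvr_pair_over K\<^sub>1 D D\<^sub>1 t K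
    by (rule dvr_pair_over.intro[OF dvr_pair_axioms dvr_pair_over_axioms.intro[OF sK K_fractions dim]])
  interpret two_branches K\<^sub>1 D D\<^sub>1 t K by (rule two_branches[OF gens_ne])
  have al: "(\<exists>\<alpha>\<in>alphas L D' A t' e\<^sub>1. Q \<alpha>) \<longleftrightarrow> (\<exists>\<alpha>\<in>gens. Q (\<alpha>, \<zero>\<^bsub>K\<^sub>1\<^esub>))" for Q
    unfolding L_def D'_def A_product t'_def e1_def alphas_eq by blast
  have C: "C_ring L D' A t' e\<^sub>1 l q (\<alpha>, \<zero>\<^bsub>K\<^sub>1\<^esub>) = pairs (std_mod l q \<alpha> (2 * l + q))" if "\<alpha> \<in> gens" for \<alpha> l q
    unfolding L_def D'_def A_product t'_def e1_def by (rule C_ring_eq[OF that])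
  show ?thesis
  proof (intro conjI allI impI)
    fix m B assume "over_ring L D' (thicken L D' t' m A) B"
    then obtain k l q \<alpha> where "\<alpha> \<in> gens" "k + 2 * l + q \<le> m"
      "B = thicken L D' t' k (pairs (std_mod l q \<alpha> (2 * l + q)))"
      using over_ring_classification[of m B] unfolding L_def D'_def A_product t'_def by blast
    then show "\<exists>k l q. \<exists>\<alpha>\<in>alphas L D' A t' e\<^sub>1. k + 2 * l + q \<le> m \<and>
        B = thicken L D' t' k (C_ring L D' A t' e\<^sub>1 l q \<alpha>)"
      unfolding al using C by (metis (no_types))
  next
    fix C'
    show "cubic_ring L D' C' \<and> plane_curve_singularity (L\<lparr>carrier := C'\<rparr>) \<longleftrightarrow>
        (\<exists>l q. \<exists>\<alpha>\<in>alphas L D' A t' e\<^sub>1. 1 \<le> l \<and> C' = C_ring L D' A t' e\<^sub>1 l q \<alpha>)"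
      unfolding al using plane_curve_iff[of C'] C unfolding L_def D'_def by (simp cong: bex_cong conj_cong)
  qed
qed

end
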